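(* Let $X$ and $Y$ be connected, countable CW complexes with non-degenerate basepoints. Let $j \colon Y \to E$ be the fibre inclusion of a fibration $Y\xrightarrow{j} E\xrightarrow{p} B$ in which $Y$ occurs as the fibre. Suppose $j\circ f \sim_* j\circ g \colon X \to E$ for based maps $f, g \colon X \to Y$. Then $\mathrm{map}(X,Y;f)$ and $\mathrm{map}(X, Y; g)$ are homotopy equivalent. If $X$ is a finite complex, then the evaluation fibrations $\omega_f \colon \mathrm{map}(X, Y;f) \to Y$ and $\omega_g \colon \mathrm{map}(X, Y;g) \to Y$ are fibre-homotopy equivalent.
   Context: $\sim_*$ denotes based homotopy. Fibrations are Hurewicz fibrations; $Y=p^{-1}(b_0)$ is the fibre over the basepoint of $B$. $\mathrm{map}(X,Y)$ is the space of all continuous (not necessarily based) maps with the compact-open topology, and $\mathrm{map}(X,Y;f)$ is its path component containing $f$, with basepoint $f$. With $x_0\in X$ the basepoint, $\omega_f\colon \mathrm{map}(X,Y;f)\to Y$ is the evaluation $\omega_f(h)=h(x_0)$, which is a Hurewicz fibration. Fibrations $p_1\colon E_1\to B'$ and $p_2\colon E_2\to B'$ are fibre-homotopy equivalent if there are based maps $h\colon E_1\to E_2$ and $k\colon E_2\to E_1$ over $B'$ such that $k\circ h$ and $h\circ k$ are homotopic to the respective identities by based homotopies $F$ and $H$ satisfying $p_1F(x,t)=p_1(x)$ and $p_2H(y,t)=p_2(y)$ for all $x\in E_1$, $y\in E_2$, $t\in[0,1]$. *)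

theory Defs
  imports "HOL-Analysis.Analysis"
begin

abbreviation unit_interval :: "real topology" where
  "unit_interval \<equiv> top_of_set {0..1}"

section \<open>CW complexes\<close>

definition disc :: "nat \<Rightarrow> (nat \<Rightarrow> real) topology" where
  "disc n = subtopology (Euclidean_space n) {x. (\<Sum>i<n. (x i)\<^sup>2) \<le> 1}"

definition open_disc :: "nat \<Rightarrow> (nat \<Rightarrow> real) set" where
  "open_disc n = {x \<in> topspace (disc n). (\<Sum>i<n. (x i)\<^sup>2) < 1}"

definition boundary_sphere :: "nat \<Rightarrow> (nat \<Rightarrow> real) set" where
  "boundary_sphere n = {x \<in> topspace (disc n). (\<Sum>i<n. (x i)\<^sup>2) = 1}"

text \<open>Whitehead's definition. \<open>\<E>\<close> is the set of open cells and \<open>d\<close> their dimension; the last two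
  conjuncts are closure finiteness and the weak topology.\<close>

definition cw_structure :: "'a topology \<Rightarrow> 'a set set \<Rightarrow> ('a set \<Rightarrow> nat) \<Rightarrow> bool" where
  "cw_structure X \<E> d \<longleftrightarrow>
     Hausdorff_space X \<and>
     disjoint \<E> \<and> \<Union>\<E> = topspace X \<and>
     (\<forall>e\<in>\<E>. \<exists>\<Phi>. continuous_map (disc (d e)) X \<Phi> \<and>
            homeomorphic_map (subtopology (disc (d e)) (open_disc (d e))) (subtopology X e) \<Phi> \<and>
            \<Phi> ` boundary_sphere (d e) \<subseteq> \<Union>{c \<in> \<E>. d c < d e}) \<and>
     (\<forall>e\<in>\<E>. finite {c \<in> \<E>. c \<inter> X closure_of e \<noteq> {}}) \<and>
     (\<forall>A. A \<subseteq> topspace X \<and> (\<forall>e\<in>\<E>. closedin X (A \<inter> X closure_of e)) \<longrightarrow> closedin X A)"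

definition countable_CW_complex :: "'a topology \<Rightarrow> bool" where
  "countable_CW_complex X \<longleftrightarrow> (\<exists>\<E> d. cw_structure X \<E> d \<and> countable \<E>)"

definition finite_CW_complex :: "'a topology \<Rightarrow> bool" where
  "finite_CW_complex X \<longleftrightarrow> (\<exists>\<E> d. cw_structure X \<E> d \<and> finite \<E>)"

section \<open>Mapping spaces\<close>

text \<open>Points of a mapping space are functions that are \<open>undefined\<close> off the domain, so that equality
  of points is equality of maps. The subbasic set for \<open>K = {}\<close> consists of all continuous maps.\<close>

definition mapping_space :: "'a topology \<Rightarrow> 'b topology \<Rightarrow> ('a \<Rightarrow> 'b) topology" where
  "mapping_space X Y =
     topology_generated_by
       {{f \<in> extensional (topspace X). continuous_map X Y f \<and> f ` K \<subseteq> U} | K U.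
          compactin X K \<and> openin Y U}"

definition mapping_point :: "'a topology \<Rightarrow> ('a \<Rightarrow> 'b) \<Rightarrow> 'a \<Rightarrow> 'b" where
  "mapping_point X f = restrict f (topspace X)"

definition mapping_component :: "'a topology \<Rightarrow> 'b topology \<Rightarrow> ('a \<Rightarrow> 'b) \<Rightarrow> ('a \<Rightarrow> 'b) topology" where
  "mapping_component X Y f =
     subtopology (mapping_space X Y) (path_component_of_set (mapping_space X Y) (mapping_point X f))"

definition evaluation :: "'a \<Rightarrow> ('a \<Rightarrow> 'b) \<Rightarrow> 'b" where
  "evaluation x0 = (\<lambda>h. h x0)"

lemma topspace_mapping_space:
  "topspace (mapping_space X Y) = {f \<in> extensional (topspace X). continuous_map X Y f}"
proof -
  have "compactin X {} \<and> openin Y {}" by simp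
  then show ?thesis
    unfolding mapping_space_def topology_generated_by_topspace by blast
qed

lemma mapping_point_in_mapping_space:
  assumes "continuous_map X Y f"
  shows "mapping_point X f \<in> topspace (mapping_space X Y)"
  using assms continuous_map_eq[of X Y f "mapping_point X f"]
  by (simp add: topspace_mapping_space mapping_point_def)

lemma mapping_point_in_mapping_component:
  assumes "continuous_map X Y f"
  shows "mapping_point X f \<in> topspace (mapping_component X Y f)"
  using mapping_point_in_mapping_space[OF assms]
  by (simp add: mapping_component_def path_component_of_refl)

section \<open>Hurewicz fibrations\<close>

definition homotopy_lifting_for ::
    "'w topology \<Rightarrow> 'e topology \<Rightarrow> 'b topology \<Rightarrow> ('e \<Rightarrow> 'b) \<Rightarrow> bool" where
  "homotopy_lifting_for W E B p \<longleftrightarrow>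
     (\<forall>k h. continuous_map W E k \<and> continuous_map (prod_topology unit_interval W) B h \<and>
            (\<forall>w\<in>topspace W. h (0, w) = p (k w)) \<longrightarrow>
        (\<exists>H. continuous_map (prod_topology unit_interval W) E H \<and>
             (\<forall>w\<in>topspace W. H (0, w) = k w) \<and>
             (\<forall>t\<in>{0..1}. \<forall>w\<in>topspace W. p (H (t, w)) = h (t, w))))"

text \<open>A formula cannot quantify over types, so the test spaces range over all topologies on one type,
  chosen large enough to carry the space of pairs \<open>(e, \<gamma>)\<close> with \<open>\<gamma>\<close> a path starting at \<open>p e\<close>. By
  \<open>hurewicz_fibration_lifting\<close> below, homotopy lifting then holds for spaces of every type.\<close>

definition hurewicz_fibration :: "'e topology \<Rightarrow> 'b topology \<Rightarrow> ('e \<Rightarrow> 'b) \<Rightarrow> bool" where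
  "hurewicz_fibration E B p \<longleftrightarrow>
     continuous_map E B p \<and>
     (\<forall>W :: ('e \<times> (real \<Rightarrow> 'b)) topology. homotopy_lifting_for W E B p)"

lemma continuous_map_path_evaluation:
  "continuous_map (prod_topology unit_interval (mapping_space unit_interval B)) B (\<lambda>(t, \<gamma>). \<gamma> t)"
proof -
  let ?M = "mapping_space unit_interval B"
  let ?P = "prod_topology unit_interval ?M"
  have nbhd: "\<exists>V. openin ?P V \<and> (t, \<gamma>) \<in> V \<and> V \<subseteq> {z \<in> topspace ?P. (\<lambda>(t, \<gamma>). \<gamma> t) z \<in> U}"
    if U: "openin B U" and t: "t \<in> {0..1}" and \<gamma>: "\<gamma> \<in> topspace ?M" and "\<gamma> t \<in> U" for U t \<gamma>
  proof -
    have "continuous_map unit_interval B \<gamma>"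
      using \<gamma> by (simp add: topspace_mapping_space)
    then have "openin unit_interval {s \<in> {0..1}. \<gamma> s \<in> U}"
      using U openin_continuous_map_preimage by fastforce
    then obtain \<delta> where "\<delta> > 0" and \<delta>: "\<And>s. \<lbrakk>s \<in> {0..1}; dist s t < \<delta>\<rbrakk> \<Longrightarrow> \<gamma> s \<in> U"
      using t \<open>\<gamma> t \<in> U\<close> unfolding openin_euclidean_subtopology_iff by blast
    define K where "K = {0..1} \<inter> cball t (\<delta>/2)"
    define A where "A = {f \<in> extensional (topspace unit_interval). continuous_map unit_interval B f \<and> f ` K \<subseteq> U}"
    have "compact K"
      unfolding K_def by (intro compact_Int) auto
    then have "compactin unit_interval K"
      by (simp add: compactin_subtopology K_def)
    then have "openin ?M A"
      unfolding mapping_space_def A_def using U by (intro topology_generated_by_Basis) blast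
    moreover have "openin unit_interval ({0..1} \<inter> ball t (\<delta>/2))"
      by (simp add: openin_open_Int)
    ultimately have "openin ?P (({0..1} \<inter> ball t (\<delta>/2)) \<times> A)"
      by (simp add: openin_prod_Times_iff)
    moreover have "\<gamma> \<in> A"
      using \<gamma> \<delta> \<open>\<delta> > 0\<close> by (auto simp: A_def K_def topspace_mapping_space dist_commute)
    moreover have "A \<subseteq> topspace ?M"
      using \<open>openin ?M A\<close> openin_subset by blast
    moreover have "f s \<in> U" if "f \<in> A" "s \<in> {0..1} \<inter> ball t (\<delta>/2)" for f s
    proof -
      have "s \<in> K" using that by (auto simp: K_def)
      then show ?thesis using that by (auto simp: A_def)
    qed
    ultimately show ?thesis
      using t \<open>\<delta> > 0\<close> by (intro exI[of _ "({0..1} \<inter> ball t (\<delta>/2)) \<times> A"]) auto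
  qed
  have "\<gamma> t \<in> topspace B" if "t \<in> {0..1}" "\<gamma> \<in> topspace ?M" for t \<gamma>
    using that by (auto simp: topspace_mapping_space continuous_map_def)
  then show ?thesis
    unfolding continuous_map
  proof (intro conjI allI impI)
    fix U assume U: "openin B U"
    show "openin ?P {z \<in> topspace ?P. (\<lambda>(t, \<gamma>). \<gamma> t) z \<in> U}"
    proof (subst openin_subopen, intro ballI)
      fix z assume z: "z \<in> {z \<in> topspace ?P. (\<lambda>(t, \<gamma>). \<gamma> t) z \<in> U}"
      obtain t \<gamma> where "z = (t, \<gamma>)" by (cases z)
      with z nbhd[OF U, of t \<gamma>]
      show "\<exists>V. openin ?P V \<and> z \<in> V \<and> V \<subseteq> {z \<in> topspace ?P. (\<lambda>(t, \<gamma>). \<gamma> t) z \<in> U}"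
        by simp
    qed
  qed auto
qed

lemma continuous_map_curry_path:
  assumes h: "continuous_map (prod_topology unit_interval W) B h"
  shows "continuous_map W (mapping_space unit_interval B) (\<lambda>w. restrict (\<lambda>t. h (t, w)) {0..1})"
    (is "continuous_map W _ ?c")
proof -
  have cont: "continuous_map unit_interval B (?c w)" if "w \<in> topspace W" for w
  proof (rule continuous_map_eq)
    show "continuous_map unit_interval B (h \<circ> (\<lambda>t. (t, w)))"
      using that by (intro continuous_map_compose[OF _ h]) (simp add: continuous_map_pairwise o_def)
  qed simp
  show ?thesis
    unfolding mapping_space_def
  proof (rule continuous_on_generated_topo)
    fix S
    assume "S \<in> {{f \<in> extensional (topspace unit_interval). continuous_map unit_interval B f \<and> f ` K \<subseteq> U} |K U.
                   compactin unit_interval K \<and> openin B U}"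
    then obtain K U where K: "compactin unit_interval K" and U: "openin B U" and
      S: "S = {f \<in> extensional (topspace unit_interval). continuous_map unit_interval B f \<and> f ` K \<subseteq> U}"
      by blast
    let ?V = "{z \<in> topspace (prod_topology unit_interval W). h z \<in> U}"
    have V: "openin (prod_topology unit_interval W) ?V"
      using h U openin_continuous_map_preimage by blast
    have K01: "K \<subseteq> {0..1}"
      using K compactin_subset_topspace by fastforce
    have eq: "?c -` S \<inter> topspace W = {w \<in> topspace W. K \<times> {w} \<subseteq> ?V}"
      using cont K01 by (auto simp: S subset_iff)
    show "openin W (?c -` S \<inter> topspace W)"
      unfolding eq
    proof (subst openin_subopen, intro ballI)
      fix w assume "w \<in> {w \<in> topspace W. K \<times> {w} \<subseteq> ?V}"
      then have "w \<in> topspace W" "K \<times> {w} \<subseteq> ?V"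
        by (simp_all del: topspace_prod_topology)
      from tube_lemma_left[OF V K this]
      obtain A C where "openin W C" "K \<subseteq> A" "w \<in> C" "A \<times> C \<subseteq> ?V"
        by (elim exE conjE)
      moreover from \<open>openin W C\<close> have "C \<subseteq> topspace W"
        by (rule openin_subset)
      ultimately have "C \<subseteq> {w \<in> topspace W. K \<times> {w} \<subseteq> ?V}"
        by (auto simp: subset_iff)
      with \<open>openin W C\<close> \<open>w \<in> C\<close>
      show "\<exists>T. openin W T \<and> w \<in> T \<and> T \<subseteq> {w \<in> topspace W. K \<times> {w} \<subseteq> ?V}"
        by (intro exI[of _ C] conjI)
    qed
  next
    show "?c ` topspace W \<subseteq> \<Union>{{f \<in> extensional (topspace unit_interval). continuous_map unit_interval B f \<and> f ` K \<subseteq> U} |K U.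
                   compactin unit_interval K \<and> openin B U}"
    proof -
      have "?c ` topspace W \<subseteq> topspace (mapping_space unit_interval B)"
        using cont unfolding topspace_mapping_space by auto
      then show ?thesis
        unfolding mapping_space_def topology_generated_by_topspace .
    qed
  qed
qed

theorem hurewicz_fibration_lifting:
  fixes W :: "'w topology" and E :: "'e topology" and B :: "'b topology"
  assumes "hurewicz_fibration E B p"
  shows "homotopy_lifting_for W E B p"
  unfolding homotopy_lifting_for_def
proof (intro allI impI, elim conjE)
  fix k :: "'w \<Rightarrow> 'e" and h :: "real \<times> 'w \<Rightarrow> 'b"
  assume k: "continuous_map W E k" and h: "continuous_map (prod_topology unit_interval W) B h"
    and hk: "\<forall>w\<in>topspace W. h (0, w) = p (k w)"
  define P where "P = subtopology (prod_topology E (mapping_space unit_interval B)) {(e, \<gamma>). \<gamma> 0 = p e}"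
  have fstP: "continuous_map P E fst" and sndP: "continuous_map P (mapping_space unit_interval B) snd"
    unfolding P_def by (simp_all add: continuous_map_from_subtopology continuous_map_fst continuous_map_snd)
  have "continuous_map (prod_topology unit_interval P) (prod_topology unit_interval (mapping_space unit_interval B))
          (\<lambda>z. (fst z, snd (snd z)))"
    using continuous_map_compose[OF continuous_map_snd sndP, of unit_interval]
    by (simp add: continuous_map_pairwise o_def continuous_map_fst)
  from continuous_map_compose[OF this continuous_map_path_evaluation]
  have ev: "continuous_map (prod_topology unit_interval P) B (\<lambda>z. snd (snd z) (fst z))"
    by (simp add: o_def)
  have "homotopy_lifting_for P E B p"
    using assms by (simp add: hurewicz_fibration_def)
  moreover have "\<forall>w\<in>topspace P. (\<lambda>z. snd (snd z) (fst z)) (0, w) = p (fst w)"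
    by (auto simp: P_def)
  ultimately have "\<exists>L. continuous_map (prod_topology unit_interval P) E L \<and>
      (\<forall>w\<in>topspace P. L (0, w) = fst w) \<and>
      (\<forall>t\<in>{0..1}. \<forall>w\<in>topspace P. p (L (t, w)) = (\<lambda>z. snd (snd z) (fst z)) (t, w))"
    using fstP ev unfolding homotopy_lifting_for_def by blast
  then obtain L where L: "continuous_map (prod_topology unit_interval P) E L"
    and L0: "\<forall>w\<in>topspace P. L (0, w) = fst w"
    and pL: "\<forall>t\<in>{0..1}. \<forall>w\<in>topspace P. p (L (t, w)) = snd w t"
    by auto
  define c where "c = (\<lambda>w. (k w, restrict (\<lambda>t. h (t, w)) {0..1}))"
  have c: "continuous_map W P c"
    unfolding P_def c_def using k hk continuous_map_curry_path[OF h]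
    by (auto simp: continuous_map_in_subtopology continuous_map_pairwise o_def)
  then have cP: "c w \<in> topspace P" if "w \<in> topspace W" for w
    using that by (auto simp: continuous_map_def)
  show "\<exists>H. continuous_map (prod_topology unit_interval W) E H \<and>
             (\<forall>w\<in>topspace W. H (0, w) = k w) \<and>
             (\<forall>t\<in>{0..1}. \<forall>w\<in>topspace W. p (H (t, w)) = h (t, w))"
  proof (intro exI conjI)
    have "continuous_map (prod_topology unit_interval W) (prod_topology unit_interval P) (\<lambda>z. (fst z, c (snd z)))"
      using continuous_map_compose[OF continuous_map_snd c, of unit_interval]
      by (simp add: continuous_map_pairwise o_def continuous_map_fst)
    from continuous_map_compose[OF this L]
    show "continuous_map (prod_topology unit_interval W) E (\<lambda>z. L (fst z, c (snd z)))"
      by (simp add: o_def)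
  qed (use L0 pL cP in \<open>auto simp: c_def\<close>)
qed

section \<open>Non-degenerate basepoints\<close>

definition homotopy_extension_for :: "'z topology \<Rightarrow> 'a topology \<Rightarrow> 'a set \<Rightarrow> bool" where
  "homotopy_extension_for Z X A \<longleftrightarrow>
     (\<forall>k h. continuous_map X Z k \<and> continuous_map (prod_topology unit_interval (subtopology X A)) Z h \<and>
            (\<forall>a\<in>A. h (0, a) = k a) \<longrightarrow>
        (\<exists>H. continuous_map (prod_topology unit_interval X) Z H \<and>
             (\<forall>x\<in>topspace X. H (0, x) = k x) \<and>
             (\<forall>t\<in>{0..1}. \<forall>a\<in>A. H (t, a) = h (t, a))))"

text \<open>As for fibrations, the target spaces range over the topologies on one type that carries the
  universal example, here the mapping cylinder; see \<open>cofibred_subspace_extension\<close>.\<close>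

definition cofibred_subspace :: "'a topology \<Rightarrow> 'a set \<Rightarrow> bool" where
  "cofibred_subspace X A \<longleftrightarrow>
     A \<subseteq> topspace X \<and> (\<forall>Z :: (real \<times> 'a) topology. homotopy_extension_for Z X A)"

definition nondegenerate_basepoint :: "'a topology \<Rightarrow> 'a \<Rightarrow> bool" where
  "nondegenerate_basepoint X x0 \<longleftrightarrow> x0 \<in> topspace X \<and> cofibred_subspace X {x0}"

theorem cofibred_subspace_extension:
  fixes X :: "'a topology" and Z :: "'z topology"
  assumes "cofibred_subspace X A"
  shows "homotopy_extension_for Z X A"
  unfolding homotopy_extension_for_def
proof (intro allI impI, elim conjE)
  fix k :: "'a \<Rightarrow> 'z" and h :: "real \<times> 'a \<Rightarrow> 'z"
  let ?IA = "prod_topology unit_interval (subtopology X A)"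
  assume k: "continuous_map X Z k" and h: "continuous_map ?IA Z h" and hk: "\<forall>a\<in>A. h (0, a) = k a"
  have AX: "A \<subseteq> topspace X"
    using assms by (simp add: cofibred_subspace_def)
  define S where "S = {0} \<times> topspace X \<union> {0..1::real} \<times> A"
  define op where "op = (\<lambda>U. U \<subseteq> S \<and> openin X {x \<in> topspace X. (0, x) \<in> U} \<and> openin ?IA {z \<in> topspace ?IA. z \<in> U})"
  have "istopology op"
    unfolding istopology_def
  proof (intro conjI allI impI)
    fix U V assume "op U" "op V"
    moreover have "{x \<in> topspace X. (0, x) \<in> U \<inter> V} = {x \<in> topspace X. (0, x) \<in> U} \<inter> {x \<in> topspace X. (0, x) \<in> V}"
      "{z \<in> topspace ?IA. z \<in> U \<inter> V} = {z \<in> topspace ?IA. z \<in> U} \<inter> {z \<in> topspace ?IA. z \<in> V}"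
      by auto
    ultimately show "op (U \<inter> V)"
      unfolding op_def by (metis (no_types, lifting) inf.coboundedI1 openin_Int)
  next
    fix \<U> assume U: "\<forall>U\<in>\<U>. op U"
    have "{x \<in> topspace X. (0, x) \<in> \<Union>\<U>} = (\<Union>U\<in>\<U>. {x \<in> topspace X. (0, x) \<in> U})"
      "{z \<in> topspace ?IA. z \<in> \<Union>\<U>} = (\<Union>U\<in>\<U>. {z \<in> topspace ?IA. z \<in> U})"
      by auto
    then show "op (\<Union>\<U>)"
      using U unfolding op_def by (auto intro!: openin_Union simp del: topspace_prod_topology)
  qed
  define M where "M = topology op"
  have openM: "openin M = op"
    unfolding M_def using \<open>istopology op\<close> by (rule topology_inverse')
  have topM: "topspace M = S"
  proof
    show "topspace M \<subseteq> S"
      unfolding topspace_def openM op_def by blast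
    have "{x \<in> topspace X. (0, x) \<in> S} = topspace X" "{z \<in> topspace ?IA. z \<in> S} = topspace ?IA"
      by (auto simp: S_def)
    then have "op S"
      by (simp add: op_def del: topspace_prod_topology)
    then show "S \<subseteq> topspace M"
      using openM openin_subset by metis
  qed
  have "continuous_map X M (\<lambda>x. (0, x))"
    unfolding continuous_map topM openM by (auto simp: op_def S_def)
  moreover have "continuous_map ?IA M (\<lambda>z. z)"
    unfolding continuous_map topM openM by (auto simp: op_def S_def)
  moreover have "homotopy_extension_for M X A"
    using assms by (simp add: cofibred_subspace_def)
  ultimately obtain R where R: "continuous_map (prod_topology unit_interval X) M R"
    and R0: "\<forall>x\<in>topspace X. R (0, x) = (0, x)"
    and RA: "\<forall>t\<in>{0..1}. \<forall>a\<in>A. R (t, a) = (t, a)"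
    unfolding homotopy_extension_for_def by blast
  define q where "q = (\<lambda>(t, x). if t = 0 then k x else h (t, x))"
  have qA: "q z = h z" if "z \<in> topspace ?IA" for z
    using that hk by (auto simp: q_def split: prod.splits)
  have "continuous_map M Z q"
    unfolding continuous_map
  proof (intro conjI allI impI)
    show "q ` topspace M \<subseteq> topspace Z"
      using k h AX by (auto simp: topM S_def q_def continuous_map_def Pi_iff)
    fix U assume U: "openin Z U"
    let ?V = "{z \<in> topspace M. q z \<in> U}"
    have "{x \<in> topspace X. (0, x) \<in> ?V} = {x \<in> topspace X. k x \<in> U}"
      by (auto simp: topM S_def q_def)
    moreover have "{z \<in> topspace ?IA. z \<in> ?V} = {z \<in> topspace ?IA. h z \<in> U}"
      using qA by (auto simp: topM S_def)
    ultimately show "openin M ?V"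
      unfolding openM op_def
      using openin_continuous_map_preimage[OF k U] openin_continuous_map_preimage[OF h U] topM by auto
  qed
  then have "continuous_map (prod_topology unit_interval X) Z (q \<circ> R)"
    using R continuous_map_compose by blast
  moreover have "\<forall>t\<in>{0..1}. \<forall>a\<in>A. (q \<circ> R) (t, a) = h (t, a)"
    using RA AX qA by auto
  moreover have "\<forall>x\<in>topspace X. (q \<circ> R) (0, x) = k x"
    using R0 by (simp add: q_def)
  ultimately show "\<exists>H. continuous_map (prod_topology unit_interval X) Z H \<and>
             (\<forall>x\<in>topspace X. H (0, x) = k x) \<and>
             (\<forall>t\<in>{0..1}. \<forall>a\<in>A. H (t, a) = h (t, a))"
    by blast
qed

section \<open>Based homotopy and fibre-homotopy equivalence\<close>

definition based_homotopic :: "'a topology \<Rightarrow> 'a \<Rightarrow> 'b topology \<Rightarrow> 'b \<Rightarrow> ('a \<Rightarrow> 'b) \<Rightarrow> ('a \<Rightarrow> 'b) \<Rightarrow> bool" where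
  "based_homotopic X x0 Y y0 f g \<longleftrightarrow> homotopic_with (\<lambda>h. h x0 = y0) X Y f g"

definition fibre_homotopy_equivalent ::
    "'e1 topology \<Rightarrow> 'e1 \<Rightarrow> ('e1 \<Rightarrow> 'b) \<Rightarrow> 'e2 topology \<Rightarrow> 'e2 \<Rightarrow> ('e2 \<Rightarrow> 'b) \<Rightarrow> bool" where
  "fibre_homotopy_equivalent E1 e1 p1 E2 e2 p2 \<longleftrightarrow>
     (\<exists>h k. continuous_map E1 E2 h \<and> h e1 = e2 \<and> (\<forall>x\<in>topspace E1. p2 (h x) = p1 x) \<and>
            continuous_map E2 E1 k \<and> k e2 = e1 \<and> (\<forall>y\<in>topspace E2. p1 (k y) = p2 y) \<and>
            homotopic_with (\<lambda>u. u e1 = e1 \<and> (\<forall>x\<in>topspace E1. p1 (u x) = p1 x)) E1 E1 (k \<circ> h) id \<and>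
            homotopic_with (\<lambda>u. u e2 = e2 \<and> (\<forall>y\<in>topspace E2. p2 (u y) = p2 y)) E2 E2 (h \<circ> k) id)"

end

theory Submission
  imports Defs
begin

text \<open>Let \<open>G\<close> be the based homotopy in \<open>E\<close> from \<open>f\<close> to \<open>g\<close>. Lifting the loops \<open>t \<mapsto> p (G (t, x))\<close> from
  every point \<open>y\<close> of the fibre gives a map \<open>L\<close> on \<open>I \<times> X \<times> Y\<close>, and \<open>h \<mapsto> (x \<mapsto> L (1, x, h x))\<close> carries the
  component of \<open>f\<close> to that of \<open>g\<close>. The reversed loops give a homotopy inverse: a loop followed by its
  reverse contracts along itself, and the contraction lifts. All maps and homotopies are
  compositions with maps on \<open>X \<times> Y\<close>, which are continuous in the compact-open topology as soon as
  \<open>X\<close> is Hausdorff.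

  For the based statement over \<open>Y\<close>, the lift is prescribed to be \<open>G\<close> on the graph of \<open>f\<close> and constant
  on \<open>{x0} \<times> Y\<close>. Such a lift exists because the union of the two is a closed cofibration in \<open>X \<times> Y\<close>,
  and this is where the cell structure of \<open>Y\<close> enters: \<open>f\<close> maps into a finite subcomplex \<open>K\<close>, which is a
  neighbourhood retract in a space of sequences, so that straight lines contract a neighbourhood of
  the graph in \<open>X \<times> K\<close> to the graph; and \<open>K \<subseteq> Y\<close> is a cofibration.\<close>

section \<open>Cylinder retractions and relative lifting\<close>

text \<open>Lifts of a path are not unique: the lift over the constant loop at \<open>x0\<close>
  need not be constant, and the lift from \<open>f x\<close> need not be \<open>G\<close>. For the
  free statement this does no harm, since the end points of two lifts are joined by a homotopy. A
  map over \<open>Y\<close> needs the first property, a based map the second, and the homotopies to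
  the identity need both again. Hence a closed set \<open>A\<close> in \<open>X \<times> Y\<close>
  accompanies the argument: the graph and \<open>{x0} \<times> Y\<close> in the based case, the
  empty set in the free case. A map fixed on the graph keeps the base point of the component, a map
  fixed on \<open>{x0} \<times> Y\<close> commutes with evaluation. With the product topology
  \<open>X \<times> Y\<close> need not be a CW complex, so the cofibration is not read off from
  cells of a product. Cofibrations are handled as retractions of cylinders, which can be combined by
  explicit formulas. Finiteness of \<open>X\<close> makes the image of \<open>f\<close> compact, so
  that a finite subcomplex contains it.\<close>

lemma continuous_map_compose2:
  assumes "continuous_map (prod_topology X Y) Z h" "continuous_map W X f" "continuous_map W Y g"
  shows "continuous_map W Z (\<lambda>w. h (f w, g w))"
  using continuous_map_compose[OF continuous_map_pairedI[OF assms(2,3)] assms(1)]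
  by (simp add: o_def)

lemma continuous_map_real_const: "continuous_map X euclideanreal (\<lambda>_. c)"
  by simp

lemmas continuous_map_real_intros =
  continuous_map_add continuous_map_diff continuous_map_real_mult continuous_map_real_divide
  continuous_map_real_abs continuous_map_real_max continuous_map_real_min
  continuous_map_real_const

lemma continuous_map_unit_interval_iff:
  "continuous_map W unit_interval s \<longleftrightarrow>
     continuous_map W euclideanreal s \<and> (\<forall>w\<in>topspace W. s w \<in> {0..1})"
  by (auto simp: continuous_map_in_subtopology)

abbreviation cylinder :: "'a topology \<Rightarrow> (real \<times> 'a) topology" where
  "cylinder X \<equiv> prod_topology unit_interval X"

lemma continuous_map_cylinder_fst: "continuous_map (cylinder X) euclideanreal fst"
  using continuous_map_fst[of unit_interval X] by (simp add: continuous_map_unit_interval_iff)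

lemma continuous_map_fst_snd: "continuous_map (prod_topology X (prod_topology Y Z)) Y (\<lambda>z. fst (snd z))"
  and continuous_map_snd_snd: "continuous_map (prod_topology X (prod_topology Y Z)) Z (\<lambda>z. snd (snd z))"
  by (rule continuous_map_fst_of[OF continuous_map_snd, unfolded o_def]
      continuous_map_snd_of[OF continuous_map_snd, unfolded o_def])+

lemma continuous_map_closed_Un:
  assumes "closedin X S" "closedin X T" "topspace X \<subseteq> S \<union> T"
    and "continuous_map (subtopology X S) Z h" "continuous_map (subtopology X T) Z h"
  shows "continuous_map X Z h"
  by (rule pasting_lemma_closed[where I="{True,False}" and T="\<lambda>b. if b then S else T" and f="\<lambda>_. h"])
     (use assms in auto)

lemma continuous_map_closed_Un3:
  assumes "closedin X S" "closedin X T" "closedin X R" "topspace X \<subseteq> S \<union> T \<union> R"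
    and "continuous_map (subtopology X S) Z h" "continuous_map (subtopology X T) Z h"
      "continuous_map (subtopology X R) Z h"
  shows "continuous_map X Z h"
proof (rule continuous_map_closed_Un[of X "S \<union> T" R])
  show "continuous_map (subtopology X (S \<union> T)) Z h"
    by (rule continuous_map_closed_Un[of _ S T])
       (use assms in \<open>auto simp: subtopology_subtopology Int_absorb1 Int_absorb2 closedin_subset
          intro!: closedin_subset_topspace\<close>)
qed (use assms in auto)

lemma unit_interval_tube:
  assumes F: "continuous_map (cylinder W) Z F" and U: "openin Z U"
    and w: "w \<in> topspace W" and FU: "\<And>t. t \<in> {0..1} \<Longrightarrow> F (t, w) \<in> U"
  obtains C where "openin W C" "w \<in> C" "\<And>t c. t \<in> {0..1} \<Longrightarrow> c \<in> C \<Longrightarrow> F (t, c) \<in> U"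
proof -
  let ?V = "{z \<in> topspace (cylinder W). F z \<in> U}"
  have V: "openin (cylinder W) ?V"
    using F U by (rule openin_continuous_map_preimage)
  have c: "compactin unit_interval {0..1::real}"
    by (simp add: compactin_subtopology)
  have sub: "{0..1} \<times> {w} \<subseteq> ?V"
    using w FU by auto
  obtain A C where AC: "openin W C" "{0..1} \<subseteq> A" "w \<in> C" "A \<times> C \<subseteq> ?V"
    using tube_lemma_left[OF V c w sub] by (elim exE conjE)
  have "F (t, c) \<in> U" if "t \<in> {0..1}" "c \<in> C" for t c
  proof -
    have "(t, c) \<in> A \<times> C" using that AC(2) by blast
    then have "(t, c) \<in> ?V" using AC(4) by (rule rev_subsetD)
    then show ?thesis by simp
  qed
  with AC that show thesis by blast
qed

text \<open>Parameters such as \<open>t / (2 * v w)\<close> break down where \<open>v\<close>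
  vanishes. \<open>s\<close> may be discontinuous on \<open>P\<close> because \<open>F\<close>
  stands still there: by compactness of the interval a whole tube around such a point goes into a
  given neighbourhood, whatever the value of \<open>s\<close>. In the applications division by zero
  yields \<open>0\<close>, so the parameter stays in the unit interval.\<close>

lemma continuous_map_reparametrize:
  assumes F: "continuous_map (cylinder W) Z F"
    and s: "continuous_map (subtopology W (topspace W - P)) euclideanreal s"
    and s01: "\<And>w. w \<in> topspace W \<Longrightarrow> s w \<in> {0..1}"
    and P: "closedin W P"
    and stationary: "\<And>t w. t \<in> {0..1} \<Longrightarrow> w \<in> P \<Longrightarrow> F (t, w) = F (0, w)"
  shows "continuous_map W Z (\<lambda>w. F (s w, w))"
  unfolding continuous_map
proof (intro conjI allI impI)
  have Fin: "F (t, w) \<in> topspace Z" if "t \<in> {0..1}" "w \<in> topspace W" for t w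
    using F that by (auto simp: continuous_map_def)
  then show "(\<lambda>w. F (s w, w)) ` topspace W \<subseteq> topspace Z"
    using s01 by blast
  fix U assume U: "openin Z U"
  let ?O = "topspace W - P"
  have O: "openin W ?O" using P by blast
  have "continuous_map (subtopology W ?O) unit_interval s"
    using s s01 by (auto simp: continuous_map_unit_interval_iff)
  then have "continuous_map (subtopology W ?O) Z (\<lambda>w. F (s w, w))"
    by (intro continuous_map_compose2[OF F]) auto
  then have "openin (subtopology W ?O) {w \<in> topspace (subtopology W ?O). F (s w, w) \<in> U}"
    using U openin_continuous_map_preimage by blast
  then have 1: "openin W {w \<in> ?O. F (s w, w) \<in> U}"
    using O by (simp add: openin_open_subtopology Int_absorb1 cong: conj_cong)
  show "openin W {w \<in> topspace W. F (s w, w) \<in> U}"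
  proof (subst openin_subopen, intro ballI)
    fix w assume w: "w \<in> {w \<in> topspace W. F (s w, w) \<in> U}"
    show "\<exists>T. openin W T \<and> w \<in> T \<and> T \<subseteq> {w \<in> topspace W. F (s w, w) \<in> U}"
    proof (cases "w \<in> P")
      case False
      with w 1 show ?thesis by (intro exI[of _ "{w \<in> ?O. F (s w, w) \<in> U}"]) auto
    next
      case True
      have "F (t, w) \<in> U" if "t \<in> {0..1}" for t
        using w stationary[OF that True] stationary[OF s01 True, of w] by simp
      with w obtain C where C: "openin W C" "w \<in> C" "\<And>t c. t \<in> {0..1} \<Longrightarrow> c \<in> C \<Longrightarrow> F (t, c) \<in> U"
        using unit_interval_tube[OF F U, of w] by auto
      then have "C \<subseteq> {w \<in> topspace W. F (s w, w) \<in> U}"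
        using openin_subset[OF C(1)] s01 by (simp add: subset_iff)
      with C(1,2) show ?thesis by (intro exI[of _ C]) simp
    qed
  qed
qed

section \<open>Closed cofibrations and their deformations\<close>

definition cylinder_retraction :: "'w topology \<Rightarrow> 'w set \<Rightarrow> (real \<times> 'w \<Rightarrow> real \<times> 'w) \<Rightarrow> bool" where
  "cylinder_retraction W A r \<longleftrightarrow>
     continuous_map (cylinder W) (cylinder W) r \<and>
     (\<forall>t\<in>{0..1}. \<forall>w\<in>topspace W. fst (r (t, w)) = 0 \<or> snd (r (t, w)) \<in> A) \<and>
     (\<forall>w\<in>topspace W. r (0, w) = (0, w)) \<and>
     (\<forall>t\<in>{0..1}. \<forall>a\<in>A. r (t, a) = (t, a))"

text \<open>The retraction is onto \<open>{0} \<times> W \<union> {0..1} \<times> A\<close>; written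
  as a self-map of the cylinder, it spares the union a topology of its own. For closed
  \<open>A\<close> its existence is equivalent to the homotopy extension property.\<close>

definition closed_cofibration :: "'w topology \<Rightarrow> 'w set \<Rightarrow> bool" where
  "closed_cofibration W A \<longleftrightarrow> closedin W A \<and> (\<exists>r. cylinder_retraction W A r)"

lemma cylinder_retractionD:
  assumes "cylinder_retraction W A r"
  shows "continuous_map (cylinder W) (cylinder W) r"
    and "t \<in> {0..1} \<Longrightarrow> w \<in> topspace W \<Longrightarrow> fst (r (t, w)) \<in> {0..1}"
    and "t \<in> {0..1} \<Longrightarrow> w \<in> topspace W \<Longrightarrow> snd (r (t, w)) \<in> topspace W"
    and "t \<in> {0..1} \<Longrightarrow> w \<in> topspace W \<Longrightarrow> fst (r (t, w)) = 0 \<or> snd (r (t, w)) \<in> A"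
    and "w \<in> topspace W \<Longrightarrow> r (0, w) = (0, w)"
    and "t \<in> {0..1} \<Longrightarrow> a \<in> A \<Longrightarrow> r (t, a) = (t, a)"
    and "continuous_map (cylinder W) euclideanreal (fst \<circ> r)"
    and "continuous_map (cylinder W) W (snd \<circ> r)"
proof -
  show c: "continuous_map (cylinder W) (cylinder W) r"
    using assms by (simp add: cylinder_retraction_def)
  have f: "continuous_map (cylinder W) unit_interval (fst \<circ> r)"
    by (rule continuous_map_compose[OF c continuous_map_fst])
  then show "continuous_map (cylinder W) euclideanreal (fst \<circ> r)"
    by (simp add: continuous_map_unit_interval_iff)
  show s: "continuous_map (cylinder W) W (snd \<circ> r)"
    by (rule continuous_map_compose[OF c continuous_map_snd])
  show "fst (r (t, w)) \<in> {0..1}" if "t \<in> {0..1}" "w \<in> topspace W"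
    using f that by (auto simp: continuous_map_def Pi_iff)
  show "snd (r (t, w)) \<in> topspace W" if "t \<in> {0..1}" "w \<in> topspace W"
    using s that by (auto simp: continuous_map_def Pi_iff)
qed (use assms in \<open>auto simp: cylinder_retraction_def\<close>)

text \<open>The usual passage from an NDR pair \<open>(v, D)\<close> to a retraction. A point at
  height \<open>t \<le> 2 * v w\<close> sinks to the bottom and is deformed for part of the time; a
  higher one is deformed completely and keeps the height \<open>t - 2 * v w\<close>. As
  \<open>t\<close> is at most 1, the second case occurs only for \<open>v w < 1/2\<close>, and there
  \<open>D\<close> ends in \<open>A\<close>.\<close>

lemma NDR_cylinder_retraction:
  assumes v: "continuous_map W euclideanreal v" and v0: "\<And>w. w \<in> topspace W \<Longrightarrow> v w \<ge> 0"
    and D: "continuous_map (cylinder W) W D"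
    and D0: "\<And>w. w \<in> topspace W \<Longrightarrow> D (0, w) = w"
    and D1: "\<And>w. w \<in> topspace W \<Longrightarrow> v w \<le> 1/2 \<Longrightarrow> D (1, w) \<in> A"
    and A: "A = {w \<in> topspace W. v w = 0}"
    and DA: "\<And>t a. t \<in> {0..1} \<Longrightarrow> a \<in> A \<Longrightarrow> D (t, a) = a"
  shows "cylinder_retraction W A (\<lambda>(t, w). (max 0 (t - 2 * v w), D (min 1 (t / (2 * v w)), w)))"
    (is "cylinder_retraction W A ?r")
proof -
  let ?IW = "cylinder W"
  note fstc = continuous_map_cylinder_fst
  have vc: "continuous_map ?IW euclideanreal (\<lambda>z. v (snd z))"
    using continuous_map_compose[OF continuous_map_snd v] by (simp add: o_def)
  have A_cl: "closedin ?IW {z \<in> topspace ?IW. v (snd z) \<in> {0}}"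
    by (rule closedin_continuous_map_preimage[OF vc]) simp
  have "continuous_map ?IW W (\<lambda>z. (\<lambda>(s, z). D (s, snd z)) (min 1 (fst z / (2 * v (snd z))), z))"
  proof (rule continuous_map_reparametrize[OF _ _ _ A_cl])
    show "continuous_map (cylinder ?IW) W (\<lambda>(s, z). D (s, snd z))"
      unfolding case_prod_unfold
      by (rule continuous_map_compose2[OF D continuous_map_fst
            continuous_map_snd_snd])
    show "continuous_map (subtopology ?IW (topspace ?IW - {z \<in> topspace ?IW. v (snd z) \<in> {0}})) euclideanreal
       (\<lambda>z. min 1 (fst z / (2 * v (snd z))))"
      by (intro continuous_map_real_intros continuous_map_from_subtopology fstc vc) auto
    show "min 1 (fst z / (2 * v (snd z))) \<in> {0..1}" if "z \<in> topspace ?IW" for z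
      using that v0[of "snd z"] by auto
    show "(\<lambda>(s, z). D (s, snd z)) (t, z) = (\<lambda>(s, z). D (s, snd z)) (0, z)"
      if "t \<in> {0..1}" "z \<in> {z \<in> topspace ?IW. v (snd z) \<in> {0}}" for t z
      using that DA[of t "snd z"] D0 by (auto simp: A)
  qed
  moreover have "continuous_map ?IW unit_interval (\<lambda>z. max 0 (fst z - 2 * v (snd z)))"
    unfolding continuous_map_unit_interval_iff
    by (intro conjI continuous_map_real_intros fstc vc) (auto dest!: v0)
  ultimately have "continuous_map ?IW ?IW ?r"
    by (simp add: case_prod_unfold continuous_map_pairedI)
  moreover have "fst (?r (t, w)) = 0 \<or> snd (?r (t, w)) \<in> A" if "t \<in> {0..1}" "w \<in> topspace W" for t w
  proof (cases "t \<le> 2 * v w")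
    case False
    then have *: "v w \<le> 1/2" "t > 2 * v w" using that by auto
    then have "v w = 0 \<or> min 1 (t / (2 * v w)) = 1"
      using v0[OF that(2)] by (auto simp: min_def le_divide_eq)
    then show ?thesis
      using D1[OF that(2) *(1)] D0[OF that(2)] that by (auto simp: A)
  qed simp
  moreover have "?r (0, w) = (0, w)" if "w \<in> topspace W" for w
    using D0[OF that] v0[OF that] by simp
  moreover have "?r (t, a) = (t, a)" if "t \<in> {0..1}" "a \<in> A" for t a
    using that DA[of 0 a] by (auto simp: A)
  ultimately show ?thesis
    unfolding cylinder_retraction_def by blast
qed

text \<open>Over the compact interval the supremum is attained. The sets \<open>u w > c\<close> are
  open because the projection along the interval is an open map, the sets \<open>u w < c\<close>
  because of the tube lemma.\<close>

lemma continuous_map_Sup_unit_interval: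
  fixes F :: "real \<times> 'w \<Rightarrow> real"
  assumes F: "continuous_map (cylinder W) euclideanreal F"
  defines "u \<equiv> \<lambda>w. SUP t\<in>{0..1}. F (t, w)"
  shows "continuous_map W euclideanreal u"
    and "\<And>t w. t \<in> {0..1} \<Longrightarrow> w \<in> topspace W \<Longrightarrow> F (t, w) \<le> u w"
    and "\<And>w. w \<in> topspace W \<Longrightarrow> \<exists>t\<in>{0..1}. u w = F (t, w)"
proof -
  let ?IW = "cylinder W"
  have attained: "\<exists>t\<in>{0..1}. u w = F (t, w) \<and> (\<forall>t'\<in>{0..1}. F (t', w) \<le> u w)" if "w \<in> topspace W" for w
  proof -
    have "continuous_map unit_interval euclideanreal (\<lambda>t. F (t, w))"
      using that by (intro continuous_map_compose2[OF F]) auto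
    then have "continuous_on {0..1} (\<lambda>t. F (t, w))" by simp
    from continuous_attains_sup[OF compact_Icc _ this]
    obtain t where t: "t \<in> {0..1}" "\<forall>t'\<in>{0..1}. F (t', w) \<le> F (t, w)" by auto
    then have "u w = F (t, w)"
      unfolding u_def by (intro cSup_eq_maximum) auto
    with t show ?thesis by auto
  qed
  then show "\<And>t w. t \<in> {0..1} \<Longrightarrow> w \<in> topspace W \<Longrightarrow> F (t, w) \<le> u w"
    and "\<And>w. w \<in> topspace W \<Longrightarrow> \<exists>t\<in>{0..1}. u w = F (t, w)"
    by blast+
  have above: "openin W {w \<in> topspace W. u w > c}" for c
  proof -
    have "openin ?IW {z \<in> topspace ?IW. F z \<in> {c<..}}"
      by (rule openin_continuous_map_preimage[OF F]) simp
    then have "openin W (snd ` {z \<in> topspace ?IW. F z \<in> {c<..}})"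
      using open_map_snd open_map_def by blast
    also have "snd ` {z \<in> topspace ?IW. F z \<in> {c<..}} = {w \<in> topspace W. u w > c}"
      using attained by (force simp: image_iff)
    finally show ?thesis .
  qed
  have below: "openin W {w \<in> topspace W. u w < c}" for c
  proof -
    show ?thesis
    proof (subst openin_subopen, intro ballI)
      fix w assume w: "w \<in> {w \<in> topspace W. u w < c}"
      then have "F (t, w) \<in> {..<c}" if "t \<in> {0..1}" for t
        using attained[of w] that by force
      with w obtain C where C: "openin W C" "w \<in> C" "\<And>t x. t \<in> {0..1} \<Longrightarrow> x \<in> C \<Longrightarrow> F (t, x) \<in> {..<c}"
        using unit_interval_tube[OF F, of "{..<c}" w] by auto
      have "C \<subseteq> {w \<in> topspace W. u w < c}"
      proof
        fix x assume x: "x \<in> C"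
        then have "x \<in> topspace W" using openin_subset[OF C(1)] by auto
        with attained[OF this] C(3)[OF _ x] show "x \<in> {w \<in> topspace W. u w < c}" by auto
      qed
      with C show "\<exists>T. openin W T \<and> w \<in> T \<and> T \<subseteq> {w \<in> topspace W. u w < c}" by blast
    qed
  qed
  show "continuous_map W euclideanreal u"
    using above below by (simp add: continuous_map_upper_lower_semicontinuous_lt)
qed

text \<open>Strom's function: \<open>u w\<close> is the greatest loss of height
  \<open>t - fst (r (t, w))\<close> under the retraction. Without a loss, \<open>r (t, w)\<close>
  has positive height for every \<open>t > 0\<close>, so its second component lies in
  \<open>A\<close>; as \<open>t\<close> tends to 0 this component tends to \<open>w\<close>, and
  \<open>A\<close> is closed.\<close>

lemma closed_cofibration_zero_set:
  assumes "closed_cofibration W A"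
  obtains u where "continuous_map W unit_interval u" "\<And>w. w \<in> topspace W \<Longrightarrow> u w = 0 \<longleftrightarrow> w \<in> A"
proof -
  obtain r where A: "closedin W A" and r: "cylinder_retraction W A r"
    using assms by (auto simp: closed_cofibration_def)
  note rD = cylinder_retractionD[OF r]
  let ?IW = "cylinder W"
  define F where "F = (\<lambda>z. max 0 (fst z - fst (r z)))"
  note fstc = continuous_map_cylinder_fst
  have F: "continuous_map ?IW euclideanreal F"
    unfolding F_def by (intro continuous_map_real_intros fstc rD(7)[unfolded o_def])
  define u where "u = (\<lambda>w. SUP t\<in>{0..1}. F (t, w))"
  have u: "continuous_map W euclideanreal u"
    and uge: "\<And>t w. t \<in> {0..1} \<Longrightarrow> w \<in> topspace W \<Longrightarrow> F (t, w) \<le> u w"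
    and ueq: "\<And>w. w \<in> topspace W \<Longrightarrow> \<exists>t\<in>{0..1}. u w = F (t, w)"
    unfolding u_def using continuous_map_Sup_unit_interval[OF F] by simp_all
  show thesis
  proof
    show "continuous_map W unit_interval u"
      unfolding continuous_map_unit_interval_iff
    proof (intro conjI ballI u)
      fix w assume "w \<in> topspace W"
      then obtain t where "t \<in> {0..1}" "u w = F (t, w)" using ueq by blast
      then show "u w \<in> {0..1}"
        using rD(2)[of t w] \<open>w \<in> topspace W\<close> by (auto simp: F_def)
    qed
    fix w assume w: "w \<in> topspace W"
    show "u w = 0 \<longleftrightarrow> w \<in> A"
    proof
      assume "w \<in> A"
      obtain t where "t \<in> {0..1}" "u w = F (t, w)" using ueq w by blast
      with \<open>w \<in> A\<close> rD(6)[of t w] show "u w = 0" by (simp add: F_def)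
    next
      assume u0: "u w = 0"
      have "snd (r (t, w)) \<in> A" if "t \<in> {0<..1}" for t
      proof -
        have "F (t, w) \<le> 0" using uge[of t w] u0 w that by simp
        then have "fst (r (t, w)) > 0" using that by (simp add: F_def max_def split: if_splits)
        then show ?thesis using rD(4)[of t w] that w by auto
      qed
      moreover have "continuous_map unit_interval W (\<lambda>t. snd (r (t, w)))"
        using w rD(8) by (intro continuous_map_compose2[of unit_interval W W "\<lambda>z. snd (r z)"]) (auto simp: o_def)
      then have "closedin unit_interval {t \<in> {0..1}. snd (r (t, w)) \<in> A}"
        using closedin_continuous_map_preimage[OF _ A] by fastforce
      then have "closed {t \<in> {0..1}. snd (r (t, w)) \<in> A}"
        by (rule closedin_closed_trans) simp
      ultimately have "closure {0<..1} \<subseteq> {t \<in> {0..1}. snd (r (t, w)) \<in> A}"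
        by (intro closure_minimal) auto
      then have "0 \<in> {t \<in> {0..1}. snd (r (t, w)) \<in> A}"
        by (rule subsetD) (simp add: closure_greaterThanAtMost)
      then show "w \<in> A" using rD(5)[OF w] by simp
    qed
  qed
qed

text \<open>The retraction is joined to the identity of the cylinder by a deformation that fixes the
  bottom and the part over \<open>A\<close>, and this deformation is accelerated so as to be
  finished at time \<open>\<phi>\<close>. Since \<open>\<phi>\<close> vanishes exactly where nothing
  moves, constructions that run for time \<open>\<phi>\<close> are continuous and keep their
  prescribed values there.\<close>

lemma closed_cofibration_clipped_deformation:
  assumes "closed_cofibration W A"
  obtains D \<phi> where
    "continuous_map (cylinder (cylinder W)) (cylinder W) D"
    "continuous_map (cylinder W) euclideanreal \<phi>"
    "\<And>t w. t \<in> {0..1} \<Longrightarrow> w \<in> topspace W \<Longrightarrow> \<phi> (t, w) \<in> {0..1/2}"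
    "\<And>t w. t \<in> {0..1} \<Longrightarrow> w \<in> topspace W \<Longrightarrow> \<phi> (t, w) = 0 \<longleftrightarrow> t = 0 \<or> w \<in> A"
    "\<And>s t w. s \<in> {0..1} \<Longrightarrow> t \<in> {0..1} \<Longrightarrow> w \<in> topspace W \<Longrightarrow> \<phi> (t, w) \<le> s \<Longrightarrow> D (s, t, w) = (t, w)"
    "\<And>t w. t \<in> {0..1} \<Longrightarrow> w \<in> topspace W \<Longrightarrow> fst (D (0, t, w)) = 0 \<or> snd (D (0, t, w)) \<in> A"
proof -
  obtain r where r: "cylinder_retraction W A r"
    using assms by (auto simp: closed_cofibration_def)
  note rD = cylinder_retractionD[OF r]
  obtain u where u: "continuous_map W unit_interval u" and u0: "\<And>w. w \<in> topspace W \<Longrightarrow> u w = 0 \<longleftrightarrow> w \<in> A"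
    using closed_cofibration_zero_set[OF assms] by blast
  have u01: "u w \<in> {0..1}" if "w \<in> topspace W" for w
    using u that by (auto simp: continuous_map_unit_interval_iff)
  let ?IW = "cylinder W"
  let ?IIW = "cylinder ?IW"
  \<comment> \<open>The factor \<open>1/2\<close> keeps \<open>2 * \<phi>\<close> in the unit
    interval; the construction for graphs runs along a path of twice the length
    \<open>\<phi>\<close>.\<close>
  define \<phi> where "\<phi> = (\<lambda>q. fst q * u (snd q) / 2)"
  note fstc = continuous_map_cylinder_fst
  have uc: "continuous_map ?IW euclideanreal (\<lambda>q. u (snd q))"
    using continuous_map_compose[OF continuous_map_snd u, of unit_interval]
    by (simp add: o_def continuous_map_unit_interval_iff)
  have \<phi>: "continuous_map ?IW euclideanreal \<phi>"
    unfolding \<phi>_def by (intro continuous_map_real_intros fstc uc) auto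
  have \<phi>01: "\<phi> (t, w) \<in> {0..1/2}" if "t \<in> {0..1}" "w \<in> topspace W" for t w
    using that u01[OF that(2)] mult_le_one[of t "u w"] by (simp add: \<phi>_def)
  have \<phi>0: "\<phi> (t, w) = 0 \<longleftrightarrow> t = 0 \<or> w \<in> A" if "t \<in> {0..1}" "w \<in> topspace W" for t w
    using u0[OF that(2)] by (simp add: \<phi>_def)
  \<comment> \<open>There are no lines in \<open>W\<close> to follow, so only the height is
    interpolated linearly. The point of \<open>W\<close> is moved by applying \<open>r\<close> at
    the shrinking height \<open>(1 - s) * t\<close>, which ends with
    \<open>r (0, w) = (0, w)\<close>.\<close>
  define D0 where "D0 = (\<lambda>z::real \<times> real \<times> 'a. ((1 - fst z) * fst (r (snd z)) + fst z * fst (snd z),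
      snd (r ((1 - fst z) * fst (snd z), snd (snd z)))))"
  have c1: "continuous_map ?IIW euclideanreal (\<lambda>z. fst (snd z))"
    using continuous_map_compose[OF continuous_map_snd fstc] by (simp add: o_def)
  have c2: "continuous_map ?IIW W (\<lambda>z. snd (snd z))"
    using continuous_map_compose[OF continuous_map_snd continuous_map_snd] by (simp add: o_def)
  have c3: "continuous_map ?IIW euclideanreal (\<lambda>z. fst (r (snd z)))"
    using continuous_map_compose[OF continuous_map_snd rD(7)] by (simp add: o_def)
  have c4: "continuous_map ?IIW unit_interval (\<lambda>z. (1 - fst z) * fst (snd z))"
    unfolding continuous_map_unit_interval_iff
    by (intro conjI continuous_map_real_intros fstc c1) (auto simp: mult_le_one)
  have c5: "continuous_map ?IIW W (\<lambda>z. snd (r ((1 - fst z) * fst (snd z), snd (snd z))))"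
    using continuous_map_compose2[OF rD(8) c4 c2] by (simp add: o_def)
  have c6: "continuous_map ?IIW unit_interval (\<lambda>z. (1 - fst z) * fst (r (snd z)) + fst z * fst (snd z))"
    unfolding continuous_map_unit_interval_iff
  proof (intro conjI continuous_map_real_intros fstc c1 c3 ballI)
    fix z assume "z \<in> topspace ?IIW"
    then have *: "fst z \<in> {0..1}" "fst (snd z) \<in> {0..1}" "fst (r (snd z)) \<in> {0..1}"
      using rD(2)[of "fst (snd z)" "snd (snd z)"] by auto
    then have "(1 - fst z) * fst (r (snd z)) + fst z * fst (snd z) \<le> (1 - fst z) * 1 + fst z * 1"
      by (intro add_mono mult_left_mono) auto
    with * show "(1 - fst z) * fst (r (snd z)) + fst z * fst (snd z) \<in> {0..1}" by auto
  qed
  have D0: "continuous_map ?IIW ?IW D0"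
    unfolding D0_def by (intro continuous_map_pairedI c5 c6)
  have D0r: "D0 (0, t, w) = r (t, w)" for t w by (simp add: D0_def)
  have D01: "D0 (1, t, w) = (t, w)" if "w \<in> topspace W" for t w using rD(5)[OF that] by (simp add: D0_def)
  have D0P: "D0 (s, t, w) = (t, w)" if "s \<in> {0..1}" "t \<in> {0..1}" "w \<in> topspace W" "t = 0 \<or> w \<in> A" for s t w
  proof -
    have "(1 - s) * t \<in> {0..1}" using that by (simp add: mult_le_one)
    from rD(6)[OF this] have "w \<in> A \<Longrightarrow> r ((1 - s) * t, w) = ((1 - s) * t, w)" .
    then show ?thesis
      using that rD(5)[of w] rD(6)[of t w] by (auto simp: D0_def left_diff_distrib)
  qed
  define D where "D = (\<lambda>z. (\<lambda>(\<sigma>, s, q). D0 (\<sigma>, q)) (min 1 (fst z / \<phi> (snd z)), z))"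
  show thesis
  proof
    have \<phi>c: "continuous_map ?IIW euclideanreal (\<lambda>z. \<phi> (snd z))"
      using continuous_map_compose[OF continuous_map_snd \<phi>] by (simp add: o_def)
    show "continuous_map ?IIW ?IW D"
      unfolding D_def
    proof (rule continuous_map_reparametrize)
      show "closedin ?IIW {z \<in> topspace ?IIW. \<phi> (snd z) \<in> {0}}"
        by (rule closedin_continuous_map_preimage[OF \<phi>c]) simp
      show "continuous_map (cylinder ?IIW) ?IW (\<lambda>(\<sigma>, s, q). D0 (\<sigma>, q))"
        unfolding case_prod_unfold
        by (rule continuous_map_compose2[OF D0 continuous_map_fst
              continuous_map_snd_snd])
      show "continuous_map (subtopology ?IIW (topspace ?IIW - {z \<in> topspace ?IIW. \<phi> (snd z) \<in> {0}}))
          euclideanreal (\<lambda>z. min 1 (fst z / \<phi> (snd z)))"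
        by (intro continuous_map_real_intros continuous_map_from_subtopology fstc \<phi>c) auto
      show "min 1 (fst z / \<phi> (snd z)) \<in> {0..1}" if "z \<in> topspace ?IIW" for z
        using that \<phi>01[of "fst (snd z)" "snd (snd z)"] by auto
      show "(case (t, z) of (\<sigma>, s, q) \<Rightarrow> D0 (\<sigma>, q)) = (case (0, z) of (\<sigma>, s, q) \<Rightarrow> D0 (\<sigma>, q))"
        if "t \<in> {0..1}" "z \<in> {z \<in> topspace ?IIW. \<phi> (snd z) \<in> {0}}" for t z
        using that D0P[of t "fst (snd z)" "snd (snd z)"] D0P[of 0 "fst (snd z)" "snd (snd z)"]
          \<phi>0[of "fst (snd z)" "snd (snd z)"] by (auto simp: case_prod_unfold)
    qed
    show "D (s, t, w) = (t, w)" if *: "s \<in> {0..1}" "t \<in> {0..1}" "w \<in> topspace W" "\<phi> (t, w) \<le> s" for s t w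
    proof (cases "\<phi> (t, w) = 0")
      case True
      have "D0 (0, t, w) = (t, w)" using * True \<phi>0[of t w] D0P[of 0 t w] by simp
      with True show ?thesis by (simp add: D_def)
    next
      case False
      with * \<phi>01[of t w] have "min 1 (s / \<phi> (t, w)) = 1" by (simp add: min_def le_divide_eq)
      with * D01 show ?thesis by (simp add: D_def)
    qed
    show "fst (D (0, t, w)) = 0 \<or> snd (D (0, t, w)) \<in> A" if *: "t \<in> {0..1}" "w \<in> topspace W" for t w
      using rD(4)[OF *] by (simp add: D_def D0r)
  qed (use \<phi> \<phi>01 \<phi>0 in auto)
qed

section \<open>Relative homotopy lifting along a closed cofibration\<close>

lemma homotopy_lifting_forE:
  assumes "homotopy_lifting_for W E B p" "continuous_map W E k"
    "continuous_map (cylinder W) B h"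
    "\<And>w. w \<in> topspace W \<Longrightarrow> h (0, w) = p (k w)"
  obtains H where "continuous_map (cylinder W) E H"
    "\<And>w. w \<in> topspace W \<Longrightarrow> H (0, w) = k w"
    "\<And>t w. t \<in> {0..1} \<Longrightarrow> w \<in> topspace W \<Longrightarrow> p (H (t, w)) = h (t, w)"
  using assms(1)[unfolded homotopy_lifting_for_def, rule_format, of k h] assms(2-) by auto

text \<open>Strom's argument: lift along the deformation \<open>D\<close> and stop the lift at time \<open>\<phi>\<close>, where \<open>D\<close> has
  become the identity.\<close>

lemma hurewicz_fibration_relative_lifting:
  assumes fib: "hurewicz_fibration E B p" and cof: "closed_cofibration W A"
    and h: "continuous_map (cylinder W) B h"
    and k: "continuous_map W E k"
    and l: "continuous_map (cylinder (subtopology W A)) E l"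
    and hk: "\<And>w. w \<in> topspace W \<Longrightarrow> p (k w) = h (0, w)"
    and hl: "\<And>t a. t \<in> {0..1} \<Longrightarrow> a \<in> A \<Longrightarrow> p (l (t, a)) = h (t, a)"
    and lk: "\<And>a. a \<in> A \<Longrightarrow> l (0, a) = k a"
  obtains L where "continuous_map (cylinder W) E L"
    "\<And>w. w \<in> topspace W \<Longrightarrow> L (0, w) = k w"
    "\<And>t a. t \<in> {0..1} \<Longrightarrow> a \<in> A \<Longrightarrow> L (t, a) = l (t, a)"
    "\<And>t w. t \<in> {0..1} \<Longrightarrow> w \<in> topspace W \<Longrightarrow> p (L (t, w)) = h (t, w)"
proof -
  let ?IW = "cylinder W"
  let ?IIW = "cylinder ?IW"
  have A: "closedin W A" using cof by (simp add: closed_cofibration_def)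
  then have AW: "A \<subseteq> topspace W" by (rule closedin_subset)
  obtain D \<phi> where D: "continuous_map ?IIW ?IW D" and \<phi>: "continuous_map ?IW euclideanreal \<phi>"
    and \<phi>01: "\<And>t w. t \<in> {0..1} \<Longrightarrow> w \<in> topspace W \<Longrightarrow> \<phi> (t, w) \<in> {0..1/2}"
    and \<phi>0: "\<And>t w. t \<in> {0..1} \<Longrightarrow> w \<in> topspace W \<Longrightarrow> \<phi> (t, w) = 0 \<longleftrightarrow> t = 0 \<or> w \<in> A"
    and Dq: "\<And>s t w. s \<in> {0..1} \<Longrightarrow> t \<in> {0..1} \<Longrightarrow> w \<in> topspace W \<Longrightarrow> \<phi> (t, w) \<le> s \<Longrightarrow> D (s, t, w) = (t, w)"
    and D0: "\<And>t w. t \<in> {0..1} \<Longrightarrow> w \<in> topspace W \<Longrightarrow> fst (D (0, t, w)) = 0 \<or> snd (D (0, t, w)) \<in> A"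
    using closed_cofibration_clipped_deformation[OF cof] by blast
  \<comment> \<open>\<open>D (0, q)\<close> lies on the bottom or over \<open>A\<close>, so
    \<open>k\<close> and \<open>l\<close> together provide a start of the lift; by \<open>lk\<close>
    they agree where the two closed pieces meet.\<close>
  define k' where "k' = (\<lambda>q. if fst q = 0 then k (snd q) else l q)"
  have D0c: "continuous_map ?IW ?IW (\<lambda>q. D (0, q))"
    by (rule continuous_map_compose2[OF D]) auto
  have k'c: "continuous_map ?IW E (\<lambda>q. k' (D (0, q)))"
  proof (rule continuous_map_closed_Un)
    let ?S = "{q \<in> topspace ?IW. (fst \<circ> (\<lambda>q. D (0, q))) q \<in> {0}}"
    let ?T = "{q \<in> topspace ?IW. (snd \<circ> (\<lambda>q. D (0, q))) q \<in> A}"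
    show "closedin ?IW ?S"
      by (rule closedin_continuous_map_preimage[OF continuous_map_fst_of[OF D0c]]) simp
    show "closedin ?IW ?T"
      by (rule closedin_continuous_map_preimage[OF continuous_map_snd_of[OF D0c] A])
    show "topspace ?IW \<subseteq> ?S \<union> ?T"
    proof
      fix q assume "q \<in> topspace ?IW"
      then show "q \<in> ?S \<union> ?T" using D0[of "fst q" "snd q"] by auto
    qed
    have "continuous_map ?IW E (\<lambda>q. k (snd (D (0, q))))"
      using continuous_map_compose[OF continuous_map_snd_of[OF D0c] k] by (simp add: o_def)
    then show "continuous_map (subtopology ?IW ?S) E (\<lambda>q. k' (D (0, q)))"
      by (rule continuous_map_eq[OF continuous_map_from_subtopology]) (auto simp: k'_def)
    have "continuous_map (subtopology ?IW ?T) (cylinder (subtopology W A)) (\<lambda>q. D (0, q))"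
      unfolding continuous_map_pairwise
      using continuous_map_from_subtopology[OF continuous_map_fst_of[OF D0c]]
        continuous_map_from_subtopology[OF continuous_map_snd_of[OF D0c]]
      by (auto simp: continuous_map_in_subtopology o_def)
    from continuous_map_compose[OF this l]
    show "continuous_map (subtopology ?IW ?T) E (\<lambda>q. k' (D (0, q)))"
    proof (rule continuous_map_eq)
      fix q assume q: "q \<in> topspace (subtopology ?IW ?T)"
      then show "(l \<circ> (\<lambda>q. D (0, q))) q = k' (D (0, q))"
        using lk[of "snd (D (0, q))"] by (cases "D (0, q)") (auto simp: k'_def)
    qed
  qed
  have hD: "continuous_map ?IIW B (h \<circ> D)"
    by (rule continuous_map_compose[OF D h])
  have eq: "(h \<circ> D) (0, q) = p (k' (D (0, q)))" if "q \<in> topspace ?IW" for q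
  proof -
    from that have q: "fst q \<in> {0..1}" "snd q \<in> topspace W" by auto
    have "D (0, q) \<in> topspace ?IW"
      using D0c that by (auto simp: continuous_map_def)
    then show ?thesis
      using D0[OF q] hk[of "snd (D (0, q))"] hl[of "fst (D (0, q))" "snd (D (0, q))"]
      by (cases "D (0, q)") (auto simp: k'_def)
  qed
  obtain H where H: "continuous_map ?IIW E H"
    and H0: "\<And>q. q \<in> topspace ?IW \<Longrightarrow> H (0, q) = k' (D (0, q))"
    and pH: "\<And>s q. s \<in> {0..1} \<Longrightarrow> q \<in> topspace ?IW \<Longrightarrow> p (H (s, q)) = (h \<circ> D) (s, q)"
    using homotopy_lifting_forE[OF hurewicz_fibration_lifting[OF fib] k'c hD eq] by metis
  show thesis
  proof
    have "continuous_map ?IW unit_interval \<phi>"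
      unfolding continuous_map_unit_interval_iff using \<phi> \<phi>01 by fastforce
    then show "continuous_map ?IW E (\<lambda>q. H (\<phi> q, q))"
      by (intro continuous_map_compose2[OF H]) auto
    \<comment> \<open>On the bottom and over \<open>A\<close> the stopping time is 0, so the lift
      has not left its start.\<close>
    show "H (\<phi> (0, w), 0, w) = k w" if "w \<in> topspace W" for w
      using that \<phi>0[of 0 w] H0 Dq[of 0 0 w] by (simp add: k'_def)
    show "H (\<phi> (t, a), t, a) = l (t, a)" if "t \<in> {0..1}" "a \<in> A" for t a
    proof -
      have "a \<in> topspace W" using that AW by blast
      then show ?thesis using that \<phi>0[of t a] H0 Dq[of 0 t a] lk[of a] by (auto simp: k'_def)
    qed
    show "p (H (\<phi> (t, w), t, w)) = h (t, w)" if "t \<in> {0..1}" "w \<in> topspace W" for t w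
      using that \<phi>01[of t w] pH Dq[of "\<phi> (t, w)" t w] by auto
  qed
qed

section \<open>Closed cofibrations in products\<close>

lemma closed_cofibration_Times:
  assumes "closed_cofibration W1 A1" "closed_cofibration W2 A2"
  shows "closed_cofibration (prod_topology W1 W2) (A1 \<times> topspace W2 \<union> topspace W1 \<times> A2)"
proof -
  let ?IW = "cylinder W1"
  let ?IIW = "cylinder ?IW"
  let ?V = "cylinder (prod_topology W1 W2)"
  have A1: "closedin W1 A1" using assms by (simp add: closed_cofibration_def)
  then have AW1: "A1 \<subseteq> topspace W1" by (rule closedin_subset)
  obtain D \<phi> where D: "continuous_map ?IIW ?IW D" and \<phi>: "continuous_map ?IW euclideanreal \<phi>"
    and \<phi>01: "\<And>t w. t \<in> {0..1} \<Longrightarrow> w \<in> topspace W1 \<Longrightarrow> \<phi> (t, w) \<in> {0..1/2}"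
    and \<phi>0: "\<And>t w. t \<in> {0..1} \<Longrightarrow> w \<in> topspace W1 \<Longrightarrow> \<phi> (t, w) = 0 \<longleftrightarrow> t = 0 \<or> w \<in> A1"
    and Dq: "\<And>s t w. s \<in> {0..1} \<Longrightarrow> t \<in> {0..1} \<Longrightarrow> w \<in> topspace W1 \<Longrightarrow> \<phi> (t, w) \<le> s \<Longrightarrow> D (s, t, w) = (t, w)"
    and D0: "\<And>t w. t \<in> {0..1} \<Longrightarrow> w \<in> topspace W1 \<Longrightarrow> fst (D (0, t, w)) = 0 \<or> snd (D (0, t, w)) \<in> A1"
    using closed_cofibration_clipped_deformation[OF assms(1)] by blast
  obtain r where A2: "closedin W2 A2" and r: "cylinder_retraction W2 A2 r"
    using assms by (auto simp: closed_cofibration_def)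
  have AW2: "A2 \<subseteq> topspace W2" using A2 by (rule closedin_subset)
  note rD = cylinder_retractionD[OF r]
  have Din: "D (s, t, w) \<in> {0..1} \<times> topspace W1" if "s \<in> {0..1}" "t \<in> {0..1}" "w \<in> topspace W1" for s t w
    using D that by (auto simp: continuous_map_def Pi_iff)
  define q where "q = (\<lambda>z::real \<times> 'a \<times> 'b. (fst z, fst (snd z)))"
  \<comment> \<open>The second retraction is started at height \<open>\<phi>\<close> instead of
    \<open>t\<close>. If some height is left over, the second component has reached
    \<open>A2\<close>; if none is left, \<open>D (0, q)\<close> has reached the bottom or
    \<open>A1\<close>. Where \<open>\<phi>\<close> vanishes nothing moves, and over
    \<open>A2\<close> the whole height \<open>\<phi>\<close> is left, at which \<open>D\<close> is
    the identity.\<close>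
  define z2 where "z2 = (\<lambda>z. r (\<phi> (q z), snd (snd z)))"
  have qc: "continuous_map ?V ?IW q"
    unfolding q_def
    by (intro continuous_map_pairedI continuous_map_fst
        continuous_map_fst_snd)
  have \<phi>q: "continuous_map ?V unit_interval (\<lambda>z. \<phi> (q z))"
    using continuous_map_compose[OF qc \<phi>] \<phi>01
    unfolding continuous_map_unit_interval_iff by (fastforce simp: o_def q_def)
  have z2c: "continuous_map ?V (cylinder W2) z2"
    unfolding z2_def
    by (intro continuous_map_compose2[OF rD(1)] \<phi>q continuous_map_snd_snd)
  have Dc: "continuous_map ?V ?IW (\<lambda>z. D (fst (z2 z), q z))"
    by (intro continuous_map_compose2[OF D] qc continuous_map_fst_of[OF z2c, unfolded o_def])
  define \<rho> where "\<rho> = (\<lambda>z. (fst (D (fst (z2 z), q z)), (snd (D (fst (z2 z), q z)), snd (z2 z))))"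
  have "cylinder_retraction (prod_topology W1 W2) (A1 \<times> topspace W2 \<union> topspace W1 \<times> A2) \<rho>"
    unfolding cylinder_retraction_def
  proof (intro conjI ballI)
    show "continuous_map ?V ?V \<rho>"
      unfolding \<rho>_def
      by (intro continuous_map_pairedI continuous_map_fst_of[OF Dc, unfolded o_def]
          continuous_map_snd_of[OF Dc, unfolded o_def] continuous_map_snd_of[OF z2c, unfolded o_def])
    fix t :: real and w assume t: "t \<in> {0..1}" and "w \<in> topspace (prod_topology W1 W2)"
    then obtain w1 w2 where w: "w = (w1, w2)" "w1 \<in> topspace W1" "w2 \<in> topspace W2" by auto
    note * = \<phi>01[OF t w(2)]
    then have \<phi>1: "\<phi> (t, w1) \<in> {0..1}" by auto
    show "fst (\<rho> (t, w)) = 0 \<or> snd (\<rho> (t, w)) \<in> A1 \<times> topspace W2 \<union> topspace W1 \<times> A2"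
      using rD(2-4)[OF \<phi>1 w(3)] D0[OF t w(2)] Din[OF rD(2)[OF \<phi>1 w(3)] t w(2)]
      by (auto simp: \<rho>_def z2_def q_def w mem_Times_iff)
  next
    fix w assume "w \<in> topspace (prod_topology W1 W2)"
    then show "\<rho> (0, w) = (0, w)"
      using Dq[of 0 0 "fst w"] \<phi>0[of 0 "fst w"] rD(5)[of "snd w"] by (auto simp: \<rho>_def z2_def q_def)
  next
    fix t :: real and a assume t: "t \<in> {0..1}" and a: "a \<in> A1 \<times> topspace W2 \<union> topspace W1 \<times> A2"
    then have aa: "fst a \<in> topspace W1" "snd a \<in> topspace W2" using AW1 AW2 by auto
    have \<phi>1: "\<phi> (t, fst a) \<in> {0..1}" using \<phi>01[OF t aa(1)] by auto
    show "\<rho> (t, a) = (t, a)"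
    proof (cases "snd a \<in> A2")
      case True
      then show ?thesis
        using rD(6)[OF \<phi>1 True] Dq[OF \<phi>1 t aa(1)] by (simp add: \<rho>_def z2_def q_def)
    next
      case False
      with a have "\<phi> (t, fst a) = 0" using \<phi>0[OF t aa(1)] by auto
      then show ?thesis
        using rD(5)[OF aa(2)] Dq[of 0 t "fst a"] t aa(1) by (simp add: \<rho>_def z2_def q_def)
    qed
  qed
  moreover have "closedin (prod_topology W1 W2) (A1 \<times> topspace W2 \<union> topspace W1 \<times> A2)"
    using A1 A2 by (intro closedin_Un) (auto simp: closedin_prod_Times_iff)
  ultimately show ?thesis unfolding closed_cofibration_def by blast
qed

text \<open>Cofibrations compose: \<open>r\<close> first brings \<open>Y\<close> to
  \<open>K\<close>, and \<open>s\<close> is run at the height that is left. At height 0 the map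
  \<open>s\<close> is the identity, which makes the two clauses of \<open>s'\<close> agree over
  \<open>K\<close>. The component \<open>x\<close> is carried along unchanged, because joining the
  graph to \<open>{x0} \<times> Y\<close> calls for a retraction over \<open>X\<close>.\<close>

lemma cylinder_retraction_section_compose:
  assumes r: "cylinder_retraction Y K r" and K: "closedin Y K"
    and f: "f ` topspace X \<subseteq> K"
    and s: "cylinder_retraction (prod_topology X (subtopology Y K)) ((\<lambda>x. (x, f x)) ` topspace X) s"
    and sX: "\<And>t x y. t \<in> {0..1} \<Longrightarrow> x \<in> topspace X \<Longrightarrow> y \<in> K \<Longrightarrow> fst (snd (s (t, x, y))) = x"
  obtains s' where "cylinder_retraction (prod_topology X Y) ((\<lambda>x. (x, f x)) ` topspace X) s'"
    "\<And>t x y. t \<in> {0..1} \<Longrightarrow> x \<in> topspace X \<Longrightarrow> y \<in> topspace Y \<Longrightarrow> fst (snd (s' (t, x, y))) = x"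
proof -
  note rD = cylinder_retractionD[OF r] and sD = cylinder_retractionD[OF s]
  have KY: "K \<subseteq> topspace Y" using K by (rule closedin_subset)
  let ?V = "cylinder (prod_topology X Y)"
  let ?VK = "cylinder (prod_topology X (subtopology Y K))"
  define z where "z = (\<lambda>v::real \<times> 'b \<times> 'a. r (fst v, snd (snd v)))"
  define s' where "s' = (\<lambda>v. if fst (z v) = 0 then (0, (fst (snd v), snd (z v))) else s (fst (z v), (fst (snd v), snd (z v))))"
  have zc: "continuous_map ?V (cylinder Y) z"
    unfolding z_def by (intro continuous_map_compose2[OF rD(1)] continuous_map_fst
        continuous_map_snd_snd)
  have xc: "continuous_map ?V X (\<lambda>v. fst (snd v))"
    by (rule continuous_map_fst_snd)
  note zc1 = continuous_map_fst_of[OF zc] and zc2 = continuous_map_snd_of[OF zc]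
  have s'K: "s' v = s (fst (z v), (fst (snd v), snd (z v)))" if "v \<in> topspace ?V" "snd (z v) \<in> K" for v
    using that sD(5)[of "(fst (snd v), snd (z v))"] KY by (auto simp: s'_def)
  have "continuous_map ?V ?V s'"
  proof (rule continuous_map_closed_Un)
    let ?S = "{v \<in> topspace ?V. (fst \<circ> z) v \<in> {0}}" and ?T = "{v \<in> topspace ?V. (snd \<circ> z) v \<in> K}"
    show "closedin ?V ?S" by (rule closedin_continuous_map_preimage[OF zc1]) simp
    show "closedin ?V ?T" by (rule closedin_continuous_map_preimage[OF zc2 K])
    show "topspace ?V \<subseteq> ?S \<union> ?T"
    proof
      fix v assume "v \<in> topspace ?V"
      then show "v \<in> ?S \<union> ?T" using rD(4)[of "fst v" "snd (snd v)"] by (auto simp: z_def)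
    qed
    have "continuous_map ?V ?V (\<lambda>v. (0, (fst (snd v), snd (z v))))"
      by (intro continuous_map_pairedI xc zc2[unfolded o_def]) simp
    then show "continuous_map (subtopology ?V ?S) ?V s'"
      by (rule continuous_map_eq[OF continuous_map_from_subtopology]) (auto simp: s'_def)
    have "continuous_map (subtopology ?V ?T) ?VK (\<lambda>v. (fst (z v), (fst (snd v), snd (z v))))"
      by (intro continuous_map_pairedI continuous_map_into_subtopology
          continuous_map_from_subtopology[OF zc1, unfolded o_def] continuous_map_from_subtopology[OF xc]
          continuous_map_from_subtopology[OF zc2, unfolded o_def]) auto
    from continuous_map_compose[OF this sD(1)]
    have "continuous_map (subtopology ?V ?T) ?VK (\<lambda>v. s (fst (z v), (fst (snd v), snd (z v))))"
      by (simp add: o_def)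
    then have "continuous_map (subtopology ?V ?T) ?VK s'"
      by (rule continuous_map_eq) (auto simp: s'K simp del: topspace_prod_topology)
    then show "continuous_map (subtopology ?V ?T) ?V s'"
      by (auto simp: continuous_map_pairwise continuous_map_in_subtopology)
  qed
  have zin: "fst (z (t, x, y)) \<in> {0..1} \<and> snd (z (t, x, y)) \<in> topspace Y \<and>
      (fst (z (t, x, y)) = 0 \<or> snd (z (t, x, y)) \<in> K)"
    if "t \<in> {0..1}" "y \<in> topspace Y" for t x y
    using rD(2-4)[OF that] by (simp add: z_def)
  show thesis
  proof
    show "cylinder_retraction (prod_topology X Y) ((\<lambda>x. (x, f x)) ` topspace X) s'"
      unfolding cylinder_retraction_def
    proof (intro conjI ballI)
      fix t :: real and w assume t: "t \<in> {0..1}" and "w \<in> topspace (prod_topology X Y)"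
      then obtain x y where w: "w = (x, y)" "x \<in> topspace X" "y \<in> topspace Y" by auto
      show "fst (s' (t, w)) = 0 \<or> snd (s' (t, w)) \<in> (\<lambda>x. (x, f x)) ` topspace X"
        using zin[OF t w(3)] sD(4)[of "fst (z (t, x, y))" "(x, snd (z (t, x, y)))"] w
        by (auto simp: s'_def)
    next
      fix w assume "w \<in> topspace (prod_topology X Y)"
      then show "s' (0, w) = (0, w)" using rD(5)[of "snd w"] by (auto simp: s'_def z_def)
    next
      fix t :: real and a assume t: "t \<in> {0..1}" and a: "a \<in> (\<lambda>x. (x, f x)) ` topspace X"
      then have "f (fst a) \<in> K" using f by auto
      with t a show "s' (t, a) = (t, a)"
        using rD(6)[of t "f (fst a)"] sD(6)[of t a] by (auto simp: s'_def z_def)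
    qed fact
    show "fst (snd (s' (t, x, y))) = x" if "t \<in> {0..1}" "x \<in> topspace X" "y \<in> topspace Y" for t x y
      using zin[OF that(1,3), of x] sX[of "fst (z (t, x, y))" x "snd (z (t, x, y))"] that
      by (auto simp: s'_def)
  qed
qed

text \<open>For a point \<open>q\<close> of the cylinder over \<open>x\<close>, retracted to \<open>q'\<close>, a path joins \<open>(q', f x)\<close> to
  \<open>(q, f x)\<close>: up to time \<open>\<phi>\<close> it runs into the graph over \<open>q'\<close>, and up to time \<open>2\<phi>\<close> back along the
  graph. Running the fibrewise retraction \<open>s\<close> for time \<open>2\<phi>\<close> extends this to all of \<open>X \<times> Y\<close>, and
  nothing moves over \<open>x0\<close>, where \<open>\<phi>\<close> vanishes.\<close>

lemma closed_cofibration_section_Un: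
  fixes X :: "'a topology" and Y :: "'b topology"
  assumes X: "closed_cofibration X {x0}" and Y: "Hausdorff_space Y" and f: "continuous_map X Y f"
    and s: "cylinder_retraction (prod_topology X Y) ((\<lambda>x. (x, f x)) ` topspace X) s"
    and sX: "\<And>t x y. t \<in> {0..1} \<Longrightarrow> x \<in> topspace X \<Longrightarrow> y \<in> topspace Y \<Longrightarrow> fst (snd (s (t, x, y))) = x"
  shows "closed_cofibration (prod_topology X Y) ((\<lambda>x. (x, f x)) ` topspace X \<union> {x0} \<times> topspace Y)"
proof -
  let ?G = "(\<lambda>x. (x, f x)) ` topspace X"
  let ?IX = "cylinder X"
  let ?IIX = "cylinder ?IX"
  let ?V = "cylinder (prod_topology X Y)"
  have x0c: "closedin X {x0}" using X by (simp add: closed_cofibration_def)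
  then have x0: "x0 \<in> topspace X" using closedin_subset by blast
  have G_eq: "?G = {w \<in> topspace (prod_topology X Y). f (fst w) = snd w}"
    using f by (auto simp: continuous_map_def Pi_iff)
  have Gc: "closedin (prod_topology X Y) ?G"
    unfolding G_eq using closedin_continuous_maps_eq[OF Y continuous_map_compose[OF continuous_map_fst f] continuous_map_snd]
    by (simp add: o_def)
  obtain D \<phi> where D: "continuous_map ?IIX ?IX D" and \<phi>: "continuous_map ?IX euclideanreal \<phi>"
    and \<phi>01: "\<And>t x. t \<in> {0..1} \<Longrightarrow> x \<in> topspace X \<Longrightarrow> \<phi> (t, x) \<in> {0..1/2}"
    and \<phi>0: "\<And>t x. t \<in> {0..1} \<Longrightarrow> x \<in> topspace X \<Longrightarrow> \<phi> (t, x) = 0 \<longleftrightarrow> t = 0 \<or> x \<in> {x0}"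
    and Dq: "\<And>s t x. s \<in> {0..1} \<Longrightarrow> t \<in> {0..1} \<Longrightarrow> x \<in> topspace X \<Longrightarrow> \<phi> (t, x) \<le> s \<Longrightarrow> D (s, t, x) = (t, x)"
    and D0: "\<And>t x. t \<in> {0..1} \<Longrightarrow> x \<in> topspace X \<Longrightarrow> fst (D (0, t, x)) = 0 \<or> snd (D (0, t, x)) \<in> {x0}"
    using closed_cofibration_clipped_deformation[OF X] by blast
  note sD = cylinder_retractionD[OF s]
  have Din: "D (s, t, x) \<in> {0..1} \<times> topspace X" if "s \<in> {0..1}" "t \<in> {0..1}" "x \<in> topspace X" for s t x
    using D that by (auto simp: continuous_map_def Pi_iff)
  have fin: "f x \<in> topspace Y" if "x \<in> topspace X" for x
    using f that by (auto simp: continuous_map_def)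
  define q where "q = (\<lambda>v::real \<times> 'a \<times> 'b. (fst v, fst (snd v)))"
  define z where "z = (\<lambda>v. s (2 * \<phi> (q v), snd v))"
  \<comment> \<open>The height \<open>\<tau> = fst (z v)\<close> left over by \<open>s\<close> is
    the position on the path, now read from the far end. The fold
    \<open>\<bar>\<tau> - \<phi>\<bar>\<close> falls from \<open>\<phi>\<close> to 0 and rises
    again, so \<open>D (\<sigma>, q)\<close> moves from \<open>q\<close> to \<open>D (0, q)\<close>
    and returns to \<open>q\<close>.\<close>
  define \<sigma> where "\<sigma> = (\<lambda>v. \<bar>fst (z v) - \<phi> (q v)\<bar>)"
  define q\<sigma> where "q\<sigma> = (\<lambda>v. D (\<sigma> v, q v))"
  \<comment> \<open>\<open>F1\<close> and \<open>F2\<close> begin with a value of \<open>D\<close>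
    at time 0, hence lie on the bottom or over \<open>x0\<close>; \<open>F3\<close> lies over the
    graph. The formulas agree where the closed pieces meet, at \<open>\<tau> = 0\<close> and at
    \<open>\<tau> = \<phi>\<close>.\<close>
  define F1 where "F1 = (\<lambda>v. (fst (D (0, q v)), (snd (D (0, q v)), snd (snd (z v)))))"
  define F2 where "F2 = (\<lambda>v. (fst (D (0, q\<sigma> v)), (snd (D (0, q\<sigma> v)), f (snd (q\<sigma> v)))))"
  define F3 where "F3 = (\<lambda>v. (fst (q\<sigma> v), (snd (q\<sigma> v), f (snd (q\<sigma> v)))))"
  define R where "R = (\<lambda>v. if fst (z v) = 0 then F1 v else if fst (z v) \<le> \<phi> (q v) then F2 v else F3 v)"
  have z01: "fst (z v) \<in> {0..1}" and zX: "fst (snd (z v)) = fst (snd v)" and zY: "snd (snd (z v)) \<in> topspace Y"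
    and z_or: "fst (z v) = 0 \<or> snd (snd (z v)) = f (fst (snd v))" and \<sigma>01: "\<sigma> v \<in> {0..1}"
    and q01: "fst (q v) \<in> {0..1}" "snd (q v) \<in> topspace X" and \<phi>q: "\<phi> (q v) \<in> {0..1/2}"
    if v: "v \<in> topspace ?V" for v
  proof -
    show q: "fst (q v) \<in> {0..1}" "snd (q v) \<in> topspace X" using v by (auto simp: q_def)
    from \<phi>01[OF q] show \<phi>q: "\<phi> (q v) \<in> {0..1/2}" by simp
    then have *: "2 * \<phi> (q v) \<in> {0..1}" "snd v \<in> topspace (prod_topology X Y)" using v by auto
    show z1: "fst (z v) \<in> {0..1}" using sD(2)[OF *] by (simp add: z_def)
    show "\<sigma> v \<in> {0..1}" using z1 \<phi>q by (auto simp: \<sigma>_def)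
    show x: "fst (snd (z v)) = fst (snd v)" using sX[OF *(1), of "fst (snd v)" "snd (snd v)"] v by (auto simp: z_def)
    show "snd (snd (z v)) \<in> topspace Y" using sD(3)[OF *] by (auto simp: z_def)
    show "fst (z v) = 0 \<or> snd (snd (z v)) = f (fst (snd v))" using sD(4)[OF *] x by (auto simp: z_def)
  qed
  have Dq0: "D (0, q') = q'" if "fst q' \<in> {0..1}" "snd q' \<in> topspace X" "fst q' = 0 \<or> snd q' = x0" for q'
    using that \<phi>0[of "fst q'" "snd q'"] Dq[of 0 "fst q'" "snd q'"] by simp
  have D00: "D (0, D (0, q v)) = D (0, q v)" if "v \<in> topspace ?V" for v
  proof (rule Dq0)
    have "D (0, q v) \<in> {0..1} \<times> topspace X" using Din[of 0 "fst (q v)" "snd (q v)"] q01[OF that] by simp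
    then show "fst (D (0, q v)) \<in> {0..1}" "snd (D (0, q v)) \<in> topspace X" by auto
    show "fst (D (0, q v)) = 0 \<or> snd (D (0, q v)) = x0" using D0[of "fst (q v)" "snd (q v)"] q01[OF that] by simp
  qed
  have Dqv: "D (s', q v) = q v" if "v \<in> topspace ?V" "s' \<in> {0..1}" "\<phi> (q v) \<le> s'" for v s'
    using Dq[of s' "fst (q v)" "snd (q v)"] q01[OF that(1)] that by simp
  have qc: "continuous_map ?V ?IX q"
    unfolding q_def by (intro continuous_map_pairedI continuous_map_fst
        continuous_map_fst_snd)
  have \<phi>qc: "continuous_map ?V euclideanreal (\<lambda>v. \<phi> (q v))"
    using continuous_map_compose[OF qc \<phi>] by (simp add: o_def)
  have "continuous_map ?V unit_interval (\<lambda>v. 2 * \<phi> (q v))"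
    unfolding continuous_map_unit_interval_iff
    by (intro conjI continuous_map_real_intros \<phi>qc ballI) (use \<phi>q in fastforce)
  then have zc: "continuous_map ?V ?V z"
    unfolding z_def by (intro continuous_map_compose2[OF sD(1)] continuous_map_snd)
  have z1c: "continuous_map ?V euclideanreal (\<lambda>v. fst (z v))"
    using continuous_map_fst_of[OF zc] by (simp add: continuous_map_unit_interval_iff o_def)
  have z2c: "continuous_map ?V Y (\<lambda>v. snd (snd (z v)))"
    using continuous_map_snd_of[OF continuous_map_snd_of[OF zc]] by (simp add: o_def)
  have \<sigma>c: "continuous_map ?V unit_interval \<sigma>"
    unfolding continuous_map_unit_interval_iff
  proof (intro conjI ballI \<sigma>01)
    show "continuous_map ?V euclideanreal \<sigma>"
      unfolding \<sigma>_def by (intro continuous_map_real_intros z1c \<phi>qc)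
  qed
  have D0qc: "continuous_map ?V ?IX (\<lambda>v. D (0, q v))"
    by (intro continuous_map_compose2[OF D] qc) simp
  have q\<sigma>c: "continuous_map ?V ?IX q\<sigma>"
    unfolding q\<sigma>_def by (intro continuous_map_compose2[OF D] qc \<sigma>c)
  have D0q\<sigma>c: "continuous_map ?V ?IX (\<lambda>v. D (0, q\<sigma> v))"
    by (intro continuous_map_compose2[OF D] q\<sigma>c) simp
  have fq\<sigma>c: "continuous_map ?V Y (\<lambda>v. f (snd (q\<sigma> v)))"
    using continuous_map_compose[OF continuous_map_snd_of[OF q\<sigma>c] f] by (simp add: o_def)
  have F1c: "continuous_map ?V ?V F1" and F2c: "continuous_map ?V ?V F2" and F3c: "continuous_map ?V ?V F3"
    unfolding F1_def F2_def F3_def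
    by (intro continuous_map_pairedI z2c fq\<sigma>c continuous_map_fst_of[OF D0qc, unfolded o_def]
        continuous_map_snd_of[OF D0qc, unfolded o_def] continuous_map_fst_of[OF D0q\<sigma>c, unfolded o_def]
        continuous_map_snd_of[OF D0q\<sigma>c, unfolded o_def] continuous_map_fst_of[OF q\<sigma>c, unfolded o_def]
        continuous_map_snd_of[OF q\<sigma>c, unfolded o_def])+
  have Rc: "continuous_map ?V ?V R"
  proof (rule continuous_map_closed_Un3)
    let ?E = "{v \<in> topspace ?V. snd (snd (z v)) = f (fst (snd v))}"
    let ?S1 = "{v \<in> topspace ?V. fst (z v) \<in> {0}}"
    let ?S2 = "?E \<inter> {v \<in> topspace ?V. fst (z v) - \<phi> (q v) \<in> {..0}}"
    let ?S3 = "?E \<inter> {v \<in> topspace ?V. fst (z v) - \<phi> (q v) \<in> {0..}}"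
    have "continuous_map ?V Y (\<lambda>v. f (fst (snd v)))"
      using continuous_map_compose[OF continuous_map_fst_of[OF continuous_map_snd] f] by (simp add: o_def)
    then have E: "closedin ?V ?E"
      by (rule closedin_continuous_maps_eq[OF Y z2c])
    have dc: "continuous_map ?V euclideanreal (\<lambda>v. fst (z v) - \<phi> (q v))"
      by (intro continuous_map_real_intros z1c \<phi>qc)
    show "closedin ?V ?S1"
      by (rule closedin_continuous_map_preimage[OF z1c]) simp
    show "closedin ?V ?S2" "closedin ?V ?S3"
      by (intro closedin_Int E closedin_continuous_map_preimage[OF dc]; simp)+
    show "topspace ?V \<subseteq> ?S1 \<union> ?S2 \<union> ?S3"
    proof
      fix v assume "v \<in> topspace ?V"
      then show "v \<in> ?S1 \<union> ?S2 \<union> ?S3" using z_or[of v] by (auto simp del: topspace_prod_topology)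
    qed
    show "continuous_map (subtopology ?V ?S1) ?V R"
      by (rule continuous_map_eq[OF continuous_map_from_subtopology[OF F1c]]) (simp add: R_def)
    have R2: "F2 v = R v" if "v \<in> ?S2" for v
    proof (cases "fst (z v) = 0")
      case True
      have v: "v \<in> topspace ?V" using that by blast
      have "q\<sigma> v = q v" using Dqv[OF v \<sigma>01[OF v]] True by (simp add: q\<sigma>_def \<sigma>_def)
      then show ?thesis using True that by (simp add: R_def F1_def F2_def q_def)
    qed (use that in \<open>simp add: R_def\<close>)
    show "continuous_map (subtopology ?V ?S2) ?V R"
      by (rule continuous_map_eq[OF continuous_map_from_subtopology[OF F2c]]) (use R2 in auto)
    have R3: "F3 v = R v" if "v \<in> ?S3" for v
    proof -
      have v: "v \<in> topspace ?V" using that by blast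
      have le: "\<phi> (q v) \<le> fst (z v)" using that by simp
      consider "fst (z v) = 0" | "fst (z v) \<noteq> 0" "fst (z v) = \<phi> (q v)" | "fst (z v) \<noteq> 0" "fst (z v) > \<phi> (q v)"
        using le by linarith
      then show ?thesis
      proof cases
        \<comment> \<open>Height 0 in the third piece forces \<open>\<phi> = 0\<close>, so that
          nothing moves and the first and third formulas coincide.\<close>
        case 1
        then have p0: "\<phi> (q v) = 0" using that \<phi>q[OF v] by auto
        then have "q\<sigma> v = q v" "D (0, q v) = q v"
          using Dqv[OF v \<sigma>01[OF v]] Dqv[OF v, of 0] by (simp_all add: q\<sigma>_def \<sigma>_def)
        then show ?thesis using 1 that by (simp add: R_def F1_def F3_def q_def)
      next
        case 2
        then have "q\<sigma> v = D (0, q v)" by (simp add: q\<sigma>_def \<sigma>_def)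
        then show ?thesis using 2 D00[OF v] by (simp add: R_def F2_def F3_def)
      qed (simp add: R_def)
    qed
    show "continuous_map (subtopology ?V ?S3) ?V R"
      by (rule continuous_map_eq[OF continuous_map_from_subtopology[OF F3c]]) (use R3 in auto)
  qed
  have q\<sigma>in: "snd (q\<sigma> v) \<in> topspace X" "fst (q\<sigma> v) \<in> {0..1}" if "v \<in> topspace ?V" for v
    using Din[of "\<sigma> v" "fst (q v)" "snd (q v)"] q01[OF that] \<sigma>01[OF that] by (auto simp: q\<sigma>_def)
  have "cylinder_retraction (prod_topology X Y) (?G \<union> {x0} \<times> topspace Y) R"
    unfolding cylinder_retraction_def
  proof (intro conjI ballI)
    fix t :: real and w assume t: "t \<in> {0..1}" and w: "w \<in> topspace (prod_topology X Y)"
    then have v: "(t, w) \<in> topspace ?V" by simp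
    have 1: "fst (F1 (t, w)) = 0 \<or> snd (F1 (t, w)) \<in> {x0} \<times> topspace Y"
      using D0[of "fst (q (t, w))" "snd (q (t, w))"] q01[OF v] zY[OF v] by (auto simp: F1_def)
    have 2: "fst (F2 (t, w)) = 0 \<or> snd (F2 (t, w)) \<in> {x0} \<times> topspace Y"
      using D0[of "fst (q\<sigma> (t, w))" "snd (q\<sigma> (t, w))"] q\<sigma>in[OF v] fin by (auto simp: F2_def)
    have 3: "snd (F3 (t, w)) \<in> ?G"
      using q\<sigma>in[OF v] by (auto simp: F3_def)
    show "fst (R (t, w)) = 0 \<or> snd (R (t, w)) \<in> ?G \<union> {x0} \<times> topspace Y"
      using 1 2 3 by (simp add: R_def) blast
  next
    fix w assume w: "w \<in> topspace (prod_topology X Y)"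
    then have v: "(0, w) \<in> topspace ?V" by simp
    have "\<phi> (q (0, w)) = 0" "q (0, w) = (0, fst w)" using \<phi>0[of 0 "fst w"] w by (auto simp: q_def)
    then show "R (0, w) = (0, w)"
      using Dq0[of "q (0, w)"] q01[OF v] sD(5)[OF w] by (simp add: R_def F1_def z_def)
  next
    fix t :: real and a assume t: "t \<in> {0..1}" and a: "a \<in> ?G \<union> {x0} \<times> topspace Y"
    then have aw: "a \<in> topspace (prod_topology X Y)" using x0 fin by auto
    then have v: "(t, a) \<in> topspace ?V" using t by simp
    show "R (t, a) = (t, a)"
    proof (cases "\<phi> (q (t, a)) = 0")
      case True
      then have "D (0, q (t, a)) = (t, fst a)" using Dqv[OF v, of 0] by (simp add: q_def)
      with True show ?thesis using sD(5)[OF aw] by (simp add: R_def F1_def z_def)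
    next
      case False
      then have "a \<in> ?G" using a \<phi>0[OF t, of "fst a"] x0 by (auto simp: q_def)
      moreover have "2 * \<phi> (q (t, a)) \<in> {0..1}" using \<phi>q[OF v] by auto
      ultimately have z: "z (t, a) = (2 * \<phi> (q (t, a)), a)" using sD(6) by (simp add: z_def)
      then have "\<sigma> (t, a) = \<phi> (q (t, a))" using \<phi>q[OF v] by (simp add: \<sigma>_def)
      then have "q\<sigma> (t, a) = (t, fst a)" using Dqv[OF v \<sigma>01[OF v]] by (simp add: q\<sigma>_def q_def)
      then show ?thesis using z False \<phi>q[OF v] \<open>a \<in> ?G\<close> by (auto simp: R_def F3_def)
    qed
  qed fact
  moreover have "closedin (prod_topology X Y) (?G \<union> {x0} \<times> topspace Y)"
    using Gc x0c by (intro closedin_Un) (auto simp: closedin_prod_Times_iff)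
  ultimately show ?thesis unfolding closed_cofibration_def by blast
qed

section \<open>Cancelling a lift against a lift of the reversed path\<close>

lemma closed_cofibration_empty: "closed_cofibration W {}"
proof -
  have "cylinder_retraction W {} (\<lambda>z. (0, snd z))"
    unfolding cylinder_retraction_def
    by (intro conjI continuous_map_pairedI continuous_map_snd) auto
  then show ?thesis by (auto simp: closed_cofibration_def)
qed

lemma closed_cofibration_interval_ends: "closed_cofibration unit_interval {0, 1}"
proof -
  let ?II = "cylinder unit_interval"
  \<comment> \<open>Doubling the distance from \<open>1/2\<close> takes every point within
    \<open>1/4\<close> of an end to that end. With \<open>v = 2 * min w (1 - w)\<close> these are
    the points with \<open>v \<le> 1/2\<close>.\<close>
  let ?D = "\<lambda>z::real \<times> real. max 0 (min 1 (snd z + fst z * (snd z - 1/2)))"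
  have "continuous_map ?II euclideanreal fst" "continuous_map ?II euclideanreal snd"
    using continuous_map_fst[of unit_interval unit_interval] continuous_map_snd[of unit_interval unit_interval]
    by (simp_all add: continuous_map_unit_interval_iff)
  then have D: "continuous_map ?II unit_interval ?D"
    unfolding continuous_map_unit_interval_iff by (intro conjI continuous_map_real_intros) auto
  have "cylinder_retraction unit_interval {0, 1}
     (\<lambda>(t, w). (max 0 (t - 2 * (2 * min w (1 - w))), ?D (min 1 (t / (2 * (2 * min w (1 - w)))), w)))"
  proof (rule NDR_cylinder_retraction[OF _ _ D])
    show "continuous_map unit_interval euclideanreal (\<lambda>w. 2 * min w (1 - w))"
      by (intro continuous_map_real_intros) auto
    fix w :: real assume "w \<in> topspace unit_interval"
    then have w: "0 \<le> w" "w \<le> 1" by auto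
    show "0 \<le> 2 * min w (1 - w)" using w by simp
    show "?D (0, w) = w" using w by simp
    assume "2 * min w (1 - w) \<le> 1/2"
    then have "w \<le> 1/4 \<or> w \<ge> 3/4" by (simp add: min_def split: if_splits)
    then show "?D (1, w) \<in> {0, 1}" using w by auto
  next
    show "{0, 1} = {w \<in> topspace unit_interval. 2 * min w (1 - w) = 0}"
      by (auto simp: min_def)
    show "?D (t, a) = a" if "t \<in> {0..1}" "a \<in> {0, 1}" for t a
      using that by auto
  qed
  then show ?thesis
    unfolding closed_cofibration_def by (auto intro: closedin_subset_topspace)
qed

text \<open>Stacking \<open>M\<close> after \<open>L\<close> gives lifts of the loops that run along \<open>p \<circ> L\<close> and back. These loops
  contract along themselves, and a lift of the contraction moves the end points over the base.\<close>

lemma hurewicz_fibration_cancel: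
  fixes W :: "'w topology"
  assumes fib: "hurewicz_fibration E B p" and cof: "closed_cofibration W A"
    and L: "continuous_map (cylinder W) E L"
    and M: "continuous_map (cylinder W) E M"
    and LM: "\<And>w. w \<in> topspace W \<Longrightarrow> M (0, w) = L (1, w)"
    and p: "\<And>t w. t \<in> {0..1} \<Longrightarrow> w \<in> topspace W \<Longrightarrow> p (M (t, w)) = p (L (1 - t, w))"
    and MA: "\<And>t a. t \<in> {0..1} \<Longrightarrow> a \<in> A \<Longrightarrow> M (t, a) = L (1 - t, a)"
  obtains H where "continuous_map (cylinder W) E H"
    "\<And>w. w \<in> topspace W \<Longrightarrow> H (0, w) = M (1, w)"
    "\<And>w. w \<in> topspace W \<Longrightarrow> H (1, w) = L (0, w)"
    "\<And>s a. s \<in> {0..1} \<Longrightarrow> a \<in> A \<Longrightarrow> H (s, a) = L (0, a)"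
    "\<And>s w. s \<in> {0..1} \<Longrightarrow> w \<in> topspace W \<Longrightarrow> p (H (s, w)) = p (L (0, w))"
proof -
  let ?W = "cylinder W"
  let ?A = "{0, 1} \<times> topspace W \<union> topspace unit_interval \<times> A"
  let ?I2 = "cylinder ?W"
  let ?IA = "cylinder (subtopology ?W ?A)"
  have AW: "A \<subseteq> topspace W" using cof by (auto simp: closed_cofibration_def dest: closedin_subset)
  have cof': "closed_cofibration ?W ?A"
    by (rule closed_cofibration_Times[OF closed_cofibration_interval_ends cof])
  have cp: "continuous_map E B p" using fib by (simp add: hurewicz_fibration_def)
  \<comment> \<open>A tent: \<open>\<mu>\<close> runs from 0 to 1 and back, so for
    \<open>s = 0\<close> the path \<open>N\<close> goes out along \<open>L\<close> and returns, and
    it shrinks to a constant as \<open>s\<close> grows to 1. It lies in \<open>E\<close>, but its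
    image in \<open>B\<close> is lifted anew.\<close>
  define \<mu> where "\<mu> = (\<lambda>t::real. min (2 * t) (2 - 2 * t))"
  have \<mu>01: "\<mu> t \<in> {0..1}" if "t \<in> {0..1}" for t using that by (auto simp: \<mu>_def)
  have N01: "\<mu> t * (1 - s) \<in> {0..1}" if "t \<in> {0..1}" "s \<in> {0..1}" for t s
    using \<mu>01[OF that(1)] that(2) by (auto simp: mult_le_one)
  define N where "N = (\<lambda>v::real \<times> real \<times> 'w. L (\<mu> (fst v) * (1 - fst (snd v)), snd (snd v)))"
  define K where "K = (\<lambda>v::real \<times> real \<times> 'w. if fst v \<le> 1/2 then L (2 * fst v, snd (snd v)) else M (2 * fst v - 1, snd (snd v)))"
  \<comment> \<open>Prescribed are the concatenation \<open>K\<close> at \<open>s = 0\<close> and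
    the contraction \<open>N\<close> at \<open>s = 1\<close> and over \<open>A\<close>. Over
    \<open>A\<close> the two agree at \<open>s = 0\<close>, because there \<open>M\<close> retraces
    \<open>L\<close>.\<close>
  define l where "l = (\<lambda>v. if fst (snd v) = 0 then K v else N v)"
  note fstc = continuous_map_cylinder_fst
  have c1: "continuous_map ?I2 euclideanreal (\<lambda>v. fst (snd v))"
    using continuous_map_compose[OF continuous_map_snd fstc] by (simp add: o_def)
  have c2: "continuous_map ?I2 W (\<lambda>v. snd (snd v))"
    by (rule continuous_map_snd_snd)
  have "continuous_map ?I2 unit_interval (\<lambda>v. \<mu> (fst v) * (1 - fst (snd v)))"
    unfolding continuous_map_unit_interval_iff
  proof (intro conjI ballI)
    show "continuous_map ?I2 euclideanreal (\<lambda>v. \<mu> (fst v) * (1 - fst (snd v)))"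
      unfolding \<mu>_def by (intro continuous_map_real_intros fstc c1)
    show "\<mu> (fst v) * (1 - fst (snd v)) \<in> {0..1}" if "v \<in> topspace ?I2" for v
      using that by (intro N01) auto
  qed
  then have Nc: "continuous_map ?I2 E N"
    unfolding N_def by (intro continuous_map_compose2[OF L] c2)
  have Kc: "continuous_map ?I2 E K"
    unfolding K_def
  proof (rule continuous_map_cases_le[OF fstc continuous_map_real_const])
    show "continuous_map (subtopology ?I2 {x \<in> topspace ?I2. fst x \<le> 1/2}) E (\<lambda>v. L (2 * fst v, snd (snd v)))"
      by (intro continuous_map_compose2[OF L] continuous_map_from_subtopology[OF c2])
         (auto simp: continuous_map_unit_interval_iff intro!: continuous_map_real_intros continuous_map_from_subtopology[OF fstc])
    show "continuous_map (subtopology ?I2 {x \<in> topspace ?I2. 1/2 \<le> fst x}) E (\<lambda>v. M (2 * fst v - 1, snd (snd v)))"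
      by (intro continuous_map_compose2[OF M] continuous_map_from_subtopology[OF c2])
         (auto simp: continuous_map_unit_interval_iff intro!: continuous_map_real_intros continuous_map_from_subtopology[OF fstc])
    show "L (2 * fst v, snd (snd v)) = M (2 * fst v - 1, snd (snd v))" if "v \<in> topspace ?I2" "fst v = 1/2" for v
    proof -
      have "2 * fst v = 1" using that by simp
      with that(1) LM[of "snd (snd v)"] show ?thesis by auto
    qed
  qed
  have pK: "p (K v) = p (N v)" if "v \<in> topspace ?I2" "fst (snd v) = 0" for v
    using that p[of "2 * fst v - 1" "snd (snd v)"] by (auto simp: K_def N_def \<mu>_def min_def)
  have KN: "K v = N v" if "v \<in> topspace ?I2" "fst (snd v) = 0" "snd (snd v) \<in> A" for v
    using that MA[of "2 * fst v - 1" "snd (snd v)"] by (auto simp: K_def N_def \<mu>_def min_def)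
  have IA: "?IA = subtopology ?I2 ({0..1} \<times> ?A)"
    by (simp add: prod_topology_subtopology(2))
  have lc: "continuous_map ?IA E l"
  proof (rule continuous_map_closed_Un)
    let ?S = "{v \<in> topspace ?IA. fst (snd v) \<in> {0}}"
    let ?T1 = "{v \<in> topspace ?IA. fst (snd v) \<in> {1}}" and ?T2 = "{v \<in> topspace ?IA. snd (snd v) \<in> A}"
    have c1': "continuous_map ?IA euclideanreal (\<lambda>v. fst (snd v))"
      unfolding IA by (rule continuous_map_from_subtopology[OF c1])
    have c2': "continuous_map ?IA W (\<lambda>v. snd (snd v))"
      unfolding IA by (rule continuous_map_from_subtopology[OF c2])
    show "closedin ?IA ?S" by (rule closedin_continuous_map_preimage[OF c1']) simp
    have "closedin ?IA ?T1" by (rule closedin_continuous_map_preimage[OF c1']) simp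
    moreover have "closedin ?IA ?T2"
      using cof by (intro closedin_continuous_map_preimage[OF c2']) (simp add: closed_cofibration_def)
    ultimately show "closedin ?IA (?T1 \<union> ?T2)" by (rule closedin_Un)
    show "topspace ?IA \<subseteq> ?S \<union> (?T1 \<union> ?T2)" by auto
    show "continuous_map (subtopology ?IA ?S) E l"
      unfolding IA subtopology_subtopology
      by (rule continuous_map_eq[OF continuous_map_from_subtopology[OF Kc]]) (auto simp: l_def)
    have lN: "N v = l v" if "v \<in> ?T1 \<union> ?T2" for v
      using that KN[of v] by (auto simp: l_def IA)
    show "continuous_map (subtopology ?IA (?T1 \<union> ?T2)) E l"
      unfolding IA subtopology_subtopology
      by (rule continuous_map_eq[OF continuous_map_from_subtopology[OF Nc]]) (use lN in \<open>auto simp: IA\<close>)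
  qed
  have L0c: "continuous_map ?W E (\<lambda>w. L (0, snd w))"
    by (intro continuous_map_compose2[OF L] continuous_map_snd) simp
  obtain H where H: "continuous_map ?I2 E H"
    and HA: "\<And>t a. t \<in> {0..1} \<Longrightarrow> a \<in> ?A \<Longrightarrow> H (t, a) = l (t, a)"
    and pH: "\<And>t w. t \<in> {0..1} \<Longrightarrow> w \<in> topspace ?W \<Longrightarrow> p (H (t, w)) = (p \<circ> N) (t, w)"
  proof (rule hurewicz_fibration_relative_lifting[OF fib cof' continuous_map_compose[OF Nc cp] L0c lc])
    show "p (L (0, snd w)) = (p \<circ> N) (0, w)" for w
      by (simp add: N_def \<mu>_def)
    show "p (l (t, a)) = (p \<circ> N) (t, a)" if "t \<in> {0..1}" "a \<in> ?A" for t a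
      using that AW pK[of "(t, a)"] by (auto simp: l_def)
    show "l (0, a) = L (0, snd a)" if "a \<in> ?A" for a
      by (simp add: l_def K_def N_def \<mu>_def)
  qed auto
  show thesis
  proof
    \<comment> \<open>Only the end \<open>t = 1\<close> of the lift is kept. There
      \<open>\<mu>\<close> vanishes, so it lies over \<open>p (L (0, w))\<close> for every
      \<open>s\<close>.\<close>
    show "continuous_map ?W E (\<lambda>w. H (1, w))"
      by (intro continuous_map_compose2[OF H]) auto
    show "H (1, 0, w) = M (1, w)" if "w \<in> topspace W" for w
      using that HA[of 1 "(0, w)"] by (simp add: l_def K_def)
    show "H (1, 1, w) = L (0, w)" if "w \<in> topspace W" for w
      using that HA[of 1 "(1, w)"] by (simp add: l_def N_def)
    show "H (1, s, a) = L (0, a)" if "s \<in> {0..1}" "a \<in> A" for s a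
      using that AW HA[of 1 "(s, a)"] MA[of 1 a] by (auto simp: l_def N_def K_def \<mu>_def)
    show "p (H (1, s, w)) = p (L (0, w))" if "s \<in> {0..1}" "w \<in> topspace W" for s w
      using that pH[of 1 "(s, w)"] by (simp add: N_def \<mu>_def)
  qed
qed

section \<open>Composition in mapping spaces\<close>

definition postcompose :: "'a topology \<Rightarrow> ('a \<times> 'b \<Rightarrow> 'c) \<Rightarrow> ('a \<Rightarrow> 'b) \<Rightarrow> 'a \<Rightarrow> 'c" where
  "postcompose X F h = restrict (\<lambda>x. F (x, h x)) (topspace X)"

lemma topspace_mapping_spaceD:
  assumes "h \<in> topspace (mapping_space X Y)"
  shows "continuous_map X Y h" "h \<in> extensional (topspace X)"
  using assms by (simp_all add: topspace_mapping_space)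

lemma openin_prod_topologyE:
  assumes "openin (prod_topology X Y) W" "(x, y) \<in> W"
  obtains U V where "openin X U" "openin Y V" "x \<in> U" "y \<in> V" "U \<times> V \<subseteq> W"
  using assms unfolding openin_prod_topology_alt by metis

text \<open>If \<open>X\<close> is not locally compact, evaluation on the product of
  \<open>X\<close> with the mapping space need not be continuous, so the map is not a composition
  through evaluation. Subbasic sets are treated directly: around each point of \<open>K\<close> the
  condition on \<open>H\<close> holds on a product neighbourhood, and \<open>K\<close> is covered by
  finitely many compact pieces \<open>C x\<close>, each of which \<open>h\<close> maps into an open
  \<open>V x\<close>.\<close>

lemma continuous_map_postcompose_homotopy:
  assumes X: "Hausdorff_space X"
    and H: "continuous_map (cylinder (prod_topology X Y)) Z H"
  shows "continuous_map (cylinder (mapping_space X Y)) (mapping_space X Z)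
           (\<lambda>(t, h). postcompose X (\<lambda>w. H (t, w)) h)"
    (is "continuous_map ?IM _ ?c")
proof -
  let ?\<S> = "{{f \<in> extensional (topspace X). continuous_map X Z f \<and> f ` K \<subseteq> U} |K U.
                   compactin X K \<and> openin Z U}"
  have cont: "continuous_map X Z (?c (t, h))" if t: "t \<in> {0..1}" and h: "continuous_map X Y h" for t h
  proof (rule continuous_map_eq)
    show "continuous_map X Z (\<lambda>x. H (t, (x, h x)))"
      using t by (intro continuous_map_compose2[OF H] continuous_map_pairedI h) auto
  qed (simp add: postcompose_def)
  have nbhd: "\<exists>T. openin ?IM T \<and> (t, h) \<in> T \<and> (\<forall>z\<in>T. ?c z ` K \<subseteq> U)"
    if t: "t \<in> {0..1}" and h: "h \<in> topspace (mapping_space X Y)"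
      and K: "compactin X K" and U: "openin Z U" and sub: "?c (t, h) ` K \<subseteq> U" for t h K U
  proof -
    have KX: "K \<subseteq> topspace X" using K compactin_subset_topspace by blast
    have hc: "continuous_map X Y h" using h by (rule topspace_mapping_spaceD)
    define R where "R = (\<lambda>x T C V G. openin unit_interval T \<and> t \<in> T \<and> compactin X C \<and> openin Y V \<and> h ` C \<subseteq> V \<and>
            openin X G \<and> x \<in> G \<and> G \<inter> K \<subseteq> C \<and> (\<forall>t'\<in>T. \<forall>x'\<in>C. \<forall>y\<in>V. H (t', (x', y)) \<in> U))"
    have "\<exists>T C V G. R x T C V G"
      if x: "x \<in> K" for x
    proof -
      let ?P = "{z \<in> topspace (cylinder (prod_topology X Y)). H z \<in> U}"
      have xX: "x \<in> topspace X" using x KX by blast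
      have hx: "h x \<in> topspace Y" using hc xX by (auto simp: continuous_map_def)
      have P: "openin (cylinder (prod_topology X Y)) ?P"
        by (rule openin_continuous_map_preimage[OF H U])
      have "H (t, (x, h x)) \<in> U" using sub x xX by (auto simp: postcompose_def)
      then have tx: "(t, (x, h x)) \<in> ?P" using t xX hx by simp
      obtain T Q where T: "openin unit_interval T" and Q: "openin (prod_topology X Y) Q"
        and "t \<in> T" "(x, h x) \<in> Q" and TQ: "T \<times> Q \<subseteq> ?P"
        by (rule openin_prod_topologyE[OF P tx])
      obtain S V where S: "openin X S" and V: "openin Y V" and "x \<in> S" "h x \<in> V" and SV: "S \<times> V \<subseteq> Q"
        by (rule openin_prod_topologyE[OF Q \<open>(x, h x) \<in> Q\<close>])
      have "openin X {x' \<in> topspace X. h x' \<in> V}" by (rule openin_continuous_map_preimage[OF hc V])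
      then have SV': "openin X (S \<inter> {x' \<in> topspace X. h x' \<in> V})" using S by blast
      let ?XK = "subtopology X K"
      \<comment> \<open>The piece \<open>C\<close> is sought inside \<open>K\<close>, which is
        regular as a compact Hausdorff space; closed in \<open>K\<close>, it is compact.\<close>
      have "regular_space ?XK"
        using X K by (intro compact_Hausdorff_imp_regular_space compact_space_subtopology Hausdorff_space_subtopology)
      then have "neighbourhood_base_of (closedin ?XK) ?XK" by (simp add: neighbourhood_base_of_closedin)
      moreover have "openin ?XK (K \<inter> (S \<inter> {x' \<in> topspace X. h x' \<in> V}))"
        using SV' by (rule openin_subtopology_Int2)
      moreover have "x \<in> K \<inter> (S \<inter> {x' \<in> topspace X. h x' \<in> V})" using x xX \<open>x \<in> S\<close> \<open>h x \<in> V\<close> by simp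
      ultimately obtain G C where G: "openin ?XK G" "x \<in> G" "G \<subseteq> C" and C: "closedin ?XK C"
        "C \<subseteq> K \<inter> (S \<inter> {x' \<in> topspace X. h x' \<in> V})"
        unfolding neighbourhood_base_of by meson
      have "compact_space ?XK" using K by (rule compact_space_subtopology)
      then have "compactin X C"
        using C(1) closedin_compact_space compactin_subtopology by metis
      moreover obtain G' where "openin X G'" "G = G' \<inter> K" using G(1) by (auto simp: openin_subtopology)
      moreover have "H (t', (x', y)) \<in> U" if "t' \<in> T" "x' \<in> C" "y \<in> V" for t' x' y
      proof -
        have "x' \<in> S" using that(2) C(2) by blast
        then have "(x', y) \<in> Q" using that(3) SV by blast
        with that(1) TQ have "(t', (x', y)) \<in> ?P" by blast
        then show ?thesis by simp
      qed
      moreover have "h ` C \<subseteq> V" using C(2) by blast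
      ultimately show ?thesis using T \<open>t \<in> T\<close> V G(2,3) unfolding R_def by (intro exI[of _ T] exI[of _ C] exI[of _ V] exI[of _ G']) auto
    qed
    then obtain T C V G where "\<And>x. x \<in> K \<Longrightarrow> R x (T x) (C x) (V x) (G x)"
      by metis
    then have TCV: "\<And>x. x \<in> K \<Longrightarrow> openin unit_interval (T x)" "\<And>x. x \<in> K \<Longrightarrow> t \<in> T x"
      "\<And>x. x \<in> K \<Longrightarrow> compactin X (C x)" "\<And>x. x \<in> K \<Longrightarrow> openin Y (V x)" "\<And>x. x \<in> K \<Longrightarrow> h ` C x \<subseteq> V x"
      "\<And>x. x \<in> K \<Longrightarrow> openin X (G x)" "\<And>x. x \<in> K \<Longrightarrow> x \<in> G x" "\<And>x. x \<in> K \<Longrightarrow> G x \<inter> K \<subseteq> C x"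
      "\<And>x t' x' y. x \<in> K \<Longrightarrow> t' \<in> T x \<Longrightarrow> x' \<in> C x \<Longrightarrow> y \<in> V x \<Longrightarrow> H (t', (x', y)) \<in> U"
      unfolding R_def by blast+
    have "\<exists>\<F>. finite \<F> \<and> \<F> \<subseteq> G ` K \<and> K \<subseteq> \<Union>\<F>"
      using compactinD[OF K, of "G ` K"] TCV(6,7) by blast
    then obtain J where J: "finite J" "J \<subseteq> K" "K \<subseteq> (\<Union>x\<in>J. G x)"
      by (metis finite_subset_image)
    define A where "A = (\<lambda>x. {f \<in> extensional (topspace X). continuous_map X Y f \<and> f ` C x \<subseteq> V x})"
    have A: "openin (mapping_space X Y) (A x)" if "x \<in> K" for x
      unfolding mapping_space_def A_def using TCV(3,4)[OF that] by (intro topology_generated_by_Basis) blast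
    let ?T = "(topspace unit_interval \<inter> (\<Inter>x\<in>J. T x)) \<times> (topspace (mapping_space X Y) \<inter> (\<Inter>x\<in>J. A x))"
    have "openin unit_interval (topspace unit_interval \<inter> (\<Inter>x\<in>J. T x))"
      using J TCV(1) openin_INT[of J unit_interval T] by (simp add: Int_commute subset_iff)
    moreover have "openin (mapping_space X Y) (topspace (mapping_space X Y) \<inter> (\<Inter>x\<in>J. A x))"
      using J A openin_INT[of J "mapping_space X Y" A] by (simp add: Int_commute subset_iff)
    ultimately have oT: "openin ?IM ?T" by (simp add: openin_prod_Times_iff)
    have memT: "(t, h) \<in> ?T"
    proof -
      have "h \<in> A x" "t \<in> T x" if "x \<in> J" for x
        using h J(2) that TCV(2,5)[of x] by (auto simp: A_def topspace_mapping_space subset_iff)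
      with t h show ?thesis by simp
    qed
    have subT: "?c z ` K \<subseteq> U" if z: "z \<in> ?T" for z
    proof
      fix u assume "u \<in> ?c z ` K"
      then obtain x' where x': "x' \<in> K" "u = ?c z x'" by blast
      then obtain x where x: "x \<in> J" "x' \<in> G x" using J by blast
      then have "x \<in> K" "x' \<in> C x" using J x' TCV(8) by blast+
      moreover have "fst z \<in> T x" "snd z \<in> A x" using z x(1) by auto
      moreover have "snd z ` C x \<subseteq> V x" using \<open>snd z \<in> A x\<close> by (simp add: A_def)
      ultimately have "H (fst z, (x', snd z x')) \<in> U" using TCV(9) by blast
      then show "u \<in> U" using x' KX by (auto simp: postcompose_def case_prod_unfold)
    qed
    show ?thesis by (rule exI[of _ ?T]) (intro conjI ballI oT memT subT)
  qed
  show ?thesis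
    unfolding mapping_space_def[of X Z]
  proof (rule continuous_on_generated_topo)
    fix S assume "S \<in> ?\<S>"
    then obtain K U where K: "compactin X K" and U: "openin Z U"
      and S: "S = {f \<in> extensional (topspace X). continuous_map X Z f \<and> f ` K \<subseteq> U}"
      by blast
    show "openin ?IM (?c -` S \<inter> topspace ?IM)"
    proof (subst openin_subopen, intro ballI)
      fix z assume z: "z \<in> ?c -` S \<inter> topspace ?IM"
      obtain t h where th: "z = (t, h)" by (cases z)
      have t: "t \<in> {0..1}" and h: "h \<in> topspace (mapping_space X Y)" and sub: "?c (t, h) ` K \<subseteq> U"
        using z by (auto simp: th S)
      obtain T where T: "openin ?IM T" "(t, h) \<in> T" "\<And>z. z \<in> T \<Longrightarrow> ?c z ` K \<subseteq> U"
        using nbhd[OF t h K U sub] by blast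
      have "T \<subseteq> ?c -` S \<inter> topspace ?IM"
      proof
        fix v assume v: "v \<in> T"
        then have vI: "v \<in> topspace ?IM" using openin_subset[OF T(1)] by blast
        then have "?c v \<in> S"
          using T(3)[OF v] cont[of "fst v" "snd v"]
          by (auto simp: S case_prod_unfold topspace_mapping_space) (simp add: postcompose_def)
        with vI show "v \<in> ?c -` S \<inter> topspace ?IM" by blast
      qed
      with T(1,2) th show "\<exists>T. openin ?IM T \<and> z \<in> T \<and> T \<subseteq> ?c -` S \<inter> topspace ?IM" by blast
    qed
  next
    have "?c ` topspace ?IM \<subseteq> topspace (mapping_space X Z)"
      using cont by (auto simp: topspace_mapping_space) (simp add: postcompose_def)
    then show "?c ` topspace ?IM \<subseteq> \<Union>?\<S>"
      unfolding mapping_space_def topology_generated_by_topspace .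
  qed
qed

lemma continuous_map_postcompose:
  assumes X: "Hausdorff_space X" and F: "continuous_map (prod_topology X Y) Z F"
  shows "continuous_map (mapping_space X Y) (mapping_space X Z) (postcompose X F)"
proof -
  have "continuous_map (cylinder (prod_topology X Y)) Z (\<lambda>z. F (snd z))"
    using continuous_map_compose[OF continuous_map_snd F] by (simp add: o_def)
  from continuous_map_compose2[OF continuous_map_postcompose_homotopy[OF X this],
      of "mapping_space X Y" "\<lambda>_. 0" "\<lambda>h. h"]
  show ?thesis by simp
qed

lemma path_component_of_postcompose:
  assumes X: "Hausdorff_space X"
    and H: "continuous_map (cylinder (prod_topology X Y)) Z H"
    and h: "h \<in> topspace (mapping_space X Y)" and s: "s \<in> {0..1}" and t: "t \<in> {0..1}"
  shows "path_component_of (mapping_space X Z) (postcompose X (\<lambda>w. H (s, w)) h) (postcompose X (\<lambda>w. H (t, w)) h)"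
proof -
  have "continuous_map unit_interval (mapping_space X Z) (\<lambda>t. postcompose X (\<lambda>w. H (t, w)) h)"
    using h continuous_map_compose2[OF continuous_map_postcompose_homotopy[OF X H],
      of unit_interval "\<lambda>t. t" "\<lambda>_. h"] by simp
  from path_component_of_continuous_image[OF this, of s t]
  have "path_component_of unit_interval s t \<Longrightarrow> ?thesis" .
  moreover have "path_connected_space unit_interval"
    using convex_imp_path_connected[of "{0..1::real}"] path_connectedin_def[of euclideanreal "{0..1}"]
    by simp
  ultimately show ?thesis
    using s t by (simp add: path_connected_space_iff_path_component)
qed

lemma mapping_component_postcompose:
  assumes X: "Hausdorff_space X" and F: "continuous_map (prod_topology X Y) Z F"
    and fg: "path_component_of (mapping_space X Z) (postcompose X F (mapping_point X f)) (mapping_point X g)"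
  shows "continuous_map (mapping_component X Y f) (mapping_component X Z g) (postcompose X F)"
proof -
  have c: "continuous_map (mapping_space X Y) (mapping_space X Z) (postcompose X F)"
    by (rule continuous_map_postcompose[OF X F])
  have "path_component_of (mapping_space X Z) (mapping_point X g) (postcompose X F h)"
    if "path_component_of (mapping_space X Y) (mapping_point X f) h" for h
    using path_component_of_continuous_image[OF c that] fg path_component_of_sym path_component_of_trans by metis
  then show ?thesis
    unfolding mapping_component_def continuous_map_in_subtopology
    using continuous_map_from_subtopology[OF c] by auto
qed

text \<open>\<open>Q\<close> is left open, so that free homotopies and homotopies that are based and
  over \<open>Y\<close> come from one argument. The component is preserved because at time 1 the
  homotopy is the identity: the track of \<open>h\<close> is a path that ends at
  \<open>h\<close>.\<close>

lemma mapping_component_homotopic_id: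
  assumes X: "Hausdorff_space X"
    and H: "continuous_map (cylinder (prod_topology X Y)) Y H"
    and H0: "\<And>x y. x \<in> topspace X \<Longrightarrow> y \<in> topspace Y \<Longrightarrow> H (0, (x, y)) = G (x, F (x, y))"
    and H1: "\<And>x y. x \<in> topspace X \<Longrightarrow> y \<in> topspace Y \<Longrightarrow> H (1, (x, y)) = y"
    and Q: "\<And>t. t \<in> {0..1} \<Longrightarrow> Q (postcompose X (\<lambda>w. H (t, w)))"
    and Q_cong: "\<And>h k. (\<And>x. x \<in> topspace (mapping_component X Y f) \<Longrightarrow> h x = k x) \<Longrightarrow> Q h \<longleftrightarrow> Q k"
  shows "homotopic_with Q (mapping_component X Y f) (mapping_component X Y f)
           (postcompose X G \<circ> postcompose X F) id"
proof -
  let ?M = "mapping_space X Y" and ?C = "mapping_component X Y f"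
  let ?c = "\<lambda>(t, h). postcompose X (\<lambda>w. H (t, w)) h"
  have C: "h \<in> topspace ?M \<and> path_component_of ?M (mapping_point X f) h" if "h \<in> topspace ?C" for h
    using that by (auto simp: mapping_component_def)
  have in_Y: "h x \<in> topspace Y" if "h \<in> topspace ?M" "x \<in> topspace X" for h x
    using topspace_mapping_spaceD(1)[OF that(1)] that(2) by (auto simp: continuous_map_def)
  have c0: "?c (0, h) = (postcompose X G \<circ> postcompose X F) h" if "h \<in> topspace ?M" for h
    using in_Y[OF that] H0 by (auto simp: postcompose_def intro!: ext)
  have c1: "?c (1, h) = h" if "h \<in> topspace ?M" for h
    using in_Y[OF that] H1 topspace_mapping_spaceD(2)[OF that]
    by (auto simp: postcompose_def extensional_def intro!: ext)
  have cc: "continuous_map (cylinder ?M) ?M ?c"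
    by (rule continuous_map_postcompose_homotopy[OF X H])
  have "continuous_map (cylinder ?C) ?C ?c"
    unfolding mapping_component_def continuous_map_in_subtopology
  proof (intro conjI)
    show "continuous_map (cylinder (subtopology ?M (path_component_of_set ?M (mapping_point X f)))) ?M ?c"
      unfolding prod_topology_subtopology(2) by (rule continuous_map_from_subtopology[OF cc])
    have "path_component_of ?M (mapping_point X f) (?c (t, h))" if "t \<in> {0..1}" "h \<in> topspace ?C" for t h
    proof -
      have "path_component_of ?M (?c (1, h)) (?c (t, h))"
        using path_component_of_postcompose[OF X H, of h 1 t] C[OF that(2)] that(1) by simp
      then show ?thesis
        using c1 C[OF that(2)] path_component_of_trans by metis
    qed
    then show "?c \<in> topspace (cylinder (subtopology ?M (path_component_of_set ?M (mapping_point X f)))) \<rightarrow>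
        path_component_of_set ?M (mapping_point X f)"
      by (auto simp: mapping_component_def)
  qed
  then show ?thesis
    using C c0 c1 Q by (subst homotopic_with[OF Q_cong]) (auto intro!: exI[of _ ?c])
qed

section \<open>Neighbourhood retracts and cells\<close>

definition seq_line :: "(nat \<Rightarrow> real) \<Rightarrow> (nat \<Rightarrow> real) \<Rightarrow> real \<Rightarrow> nat \<Rightarrow> real" where
  "seq_line a b s = (\<lambda>i. a i + s * (b i - a i))"

lemma seq_line_simps [simp]: "seq_line a b 0 = a" "seq_line a b 1 = b" "seq_line a a s = a"
  by (auto simp: seq_line_def)

lemma continuous_map_seq_iff:
  fixes f :: "'z \<Rightarrow> nat \<Rightarrow> real"
  shows "continuous_map W euclidean f \<longleftrightarrow> (\<forall>i. continuous_map W euclideanreal (\<lambda>w. f w i))"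
  using continuous_map_componentwise_UNIV[of W "\<lambda>_. euclideanreal" f]
  by (simp add: euclidean_product_topology)

lemma continuous_map_seq_coordinate:
  fixes f :: "'z \<Rightarrow> nat \<Rightarrow> real"
  shows "continuous_map W euclidean f \<Longrightarrow> continuous_map W euclideanreal (\<lambda>w. f w i)"
  by (simp add: continuous_map_seq_iff)

lemma continuous_map_seq_line:
  assumes "continuous_map W euclidean a" "continuous_map W euclidean b" "continuous_map W euclideanreal s"
  shows "continuous_map W euclidean (\<lambda>w. seq_line (a w) (b w) (s w))"
  using assms unfolding continuous_map_seq_iff seq_line_def
  by (intro allI continuous_map_real_intros) auto

lemma continuous_map_dist_seq:
  fixes a b :: "'z \<Rightarrow> nat \<Rightarrow> real"
  assumes "continuous_map W euclidean a" "continuous_map W euclidean b"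
  shows "continuous_map W euclideanreal (\<lambda>w. dist (a w) (b w))"
proof -
  have "continuous_map (prod_topology euclidean euclidean) euclideanreal (\<lambda>z::(nat \<Rightarrow> real) \<times> (nat \<Rightarrow> real). dist (fst z) (snd z))"
    by (simp add: continuous_on_dist continuous_on_fst continuous_on_snd)
  from continuous_map_compose2[OF this assms] show ?thesis by simp
qed

text \<open>Sequences serve as one ambient space for all dimensions, with room for a further cell
  in the odd coordinates.\<close>

definition neighbourhood_retract :: "'z topology \<Rightarrow> ('z \<Rightarrow> nat \<Rightarrow> real) \<Rightarrow> (nat \<Rightarrow> real) set \<Rightarrow> ((nat \<Rightarrow> real) \<Rightarrow> 'z) \<Rightarrow> bool" where
  "neighbourhood_retract Z \<iota> Q \<rho> \<longleftrightarrow>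
     continuous_map Z euclidean \<iota> \<and> open Q \<and> \<iota> ` topspace Z \<subseteq> Q \<and>
     continuous_map (top_of_set Q) Z \<rho> \<and> (\<forall>z\<in>topspace Z. \<rho> (\<iota> z) = z)"

text \<open>Segments that leave \<open>Q\<close> form a compact set of triples. On it the end points
  differ, since a constant segment stays at a point of \<open>K\<close>; so their distance has a
  positive minimum, which serves as \<open>\<delta>\<close>. If no segment leaves \<open>Q\<close>,
  any \<open>\<delta>\<close> will do.\<close>

lemma compact_seq_line_neighbourhood:
  fixes K Q :: "(nat \<Rightarrow> real) set"
  assumes K: "compact K" and Q: "open Q" and KQ: "K \<subseteq> Q"
  obtains \<delta> where "\<delta> > 0" "\<And>a b s. a \<in> K \<Longrightarrow> b \<in> K \<Longrightarrow> dist a b < \<delta> \<Longrightarrow> s \<in> {0..1} \<Longrightarrow> seq_line a b s \<in> Q"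
proof -
  define S where "S = {0..1::real} \<times> (K \<times> K)"
  define C where "C = S \<inter> {z. seq_line (fst (snd z)) (snd (snd z)) (fst z) \<in> - Q}"
  have S: "compact S" unfolding S_def by (intro compact_Times K compact_Icc)
  have "continuous_on UNIV (\<lambda>z::real \<times> (nat \<Rightarrow> real) \<times> (nat \<Rightarrow> real). seq_line (fst (snd z)) (snd (snd z)) (fst z))"
    using continuous_map_seq_line[of euclidean "\<lambda>z::real \<times> (nat \<Rightarrow> real) \<times> (nat \<Rightarrow> real). fst (snd z)"
        "\<lambda>z. snd (snd z)" fst]
    by (simp add: continuous_on_fst continuous_on_snd)
  then have "closed {z. seq_line (fst (snd z)) (snd (snd z)) (fst z) \<in> - Q}"
    using Q by (intro closed_vimage[unfolded vimage_def]) auto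
  then have C: "compact C" unfolding C_def using S by blast
  show thesis
  proof (cases "C = {}")
    case True
    have "seq_line a b s \<in> Q" if "a \<in> K" "b \<in> K" "s \<in> {0..1}" for a b s
    proof (rule ccontr)
      assume "seq_line a b s \<notin> Q"
      then have "(s, (a, b)) \<in> C" using that by (simp add: C_def S_def)
      with True show False by simp
    qed
    then show thesis using that[of 1] by simp
  next
    case False
    have "continuous_on C (\<lambda>z. dist (fst (snd z)) (snd (snd z)))"
      by (intro continuous_intros)
    from continuous_attains_inf[OF C False this] obtain z
      where z: "z \<in> C" "\<And>y. y \<in> C \<Longrightarrow> dist (fst (snd z)) (snd (snd z)) \<le> dist (fst (snd y)) (snd (snd y))"
      by blast
    have "fst (snd z) \<noteq> snd (snd z)"
      using z(1) KQ by (auto simp: C_def S_def)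
    then have pos: "dist (fst (snd z)) (snd (snd z)) > 0" by simp
    have "seq_line a b s \<in> Q" if "a \<in> K" "b \<in> K" "dist a b < dist (fst (snd z)) (snd (snd z))" "s \<in> {0..1}" for a b s
    proof (rule ccontr)
      assume "seq_line a b s \<notin> Q"
      then have "(s, (a, b)) \<in> C" using that by (simp add: C_def S_def)
      from z(2)[OF this] that(3) show False by simp
    qed
    with pos show thesis using that by blast
  qed
qed

lemma neighbourhood_retract_section:
  assumes Z: "neighbourhood_retract Z \<iota> Q \<rho>" "compact_space Z" and f: "continuous_map X Z f"
  obtains s where "cylinder_retraction (prod_topology X Z) ((\<lambda>x. (x, f x)) ` topspace X) s"
    "\<And>t x z. fst (snd (s (t, x, z))) = x"
proof -
  have \<iota>: "continuous_map Z euclidean \<iota>" and Q: "open Q" "\<iota> ` topspace Z \<subseteq> Q"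
    and \<rho>: "continuous_map (top_of_set Q) Z \<rho>" and \<rho>\<iota>: "\<And>z. z \<in> topspace Z \<Longrightarrow> \<rho> (\<iota> z) = z"
    using Z by (auto simp: neighbourhood_retract_def)
  have "compact (\<iota> ` topspace Z)"
    using image_compactin[OF _ \<iota>] Z(2) by (simp add: compact_space_def)
  from compact_seq_line_neighbourhood[OF this Q]
  obtain \<delta> where \<delta>: "\<delta> > 0" and seg: "\<And>a b s. a \<in> \<iota> ` topspace Z \<Longrightarrow> b \<in> \<iota> ` topspace Z \<Longrightarrow> dist a b < \<delta> \<Longrightarrow> s \<in> {0..1} \<Longrightarrow> seq_line a b s \<in> Q"
    by blast
  let ?W = "prod_topology X Z"
  let ?G = "(\<lambda>x. (x, f x)) ` topspace X"
  let ?IW = "cylinder ?W"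
  have fin: "f x \<in> topspace Z" if "x \<in> topspace X" for x
    using f that by (auto simp: continuous_map_def)
  define v where "v = (\<lambda>w. dist (\<iota> (snd w)) (\<iota> (f (fst w))) / \<delta>)"
  \<comment> \<open>The cutoff is 1 for \<open>v \<le> 1/2\<close>, where points have to reach the
    graph, and 0 for \<open>v \<ge> 1\<close>, where the segment might leave \<open>Q\<close> and
    the point stays.\<close>
  define m where "m = (\<lambda>z::real \<times> _. fst z * min 1 (max 0 (2 - 2 * v (snd z))))"
  define \<gamma> where "\<gamma> = (\<lambda>z. seq_line (\<iota> (snd (snd z))) (\<iota> (f (fst (snd z)))) (m z))"
  define D where "D = (\<lambda>z. (fst (snd z), \<rho> (\<gamma> z)))"
  have \<iota>1: "continuous_map ?W euclidean (\<lambda>w. \<iota> (snd w))"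
    using continuous_map_compose[OF continuous_map_snd \<iota>] by (simp add: o_def)
  have \<iota>2: "continuous_map ?W euclidean (\<lambda>w. \<iota> (f (fst w)))"
    using continuous_map_compose[OF continuous_map_compose[OF continuous_map_fst f] \<iota>] by (simp add: o_def)
  have vc: "continuous_map ?W euclideanreal v"
    unfolding v_def using \<delta> by (intro continuous_map_real_intros continuous_map_dist_seq \<iota>1 \<iota>2) auto
  note fstc = continuous_map_cylinder_fst
  have mc: "continuous_map ?IW euclideanreal m"
    unfolding m_def using continuous_map_compose[OF continuous_map_snd vc]
    by (intro continuous_map_real_intros fstc) (simp add: o_def)
  have \<gamma>c: "continuous_map ?IW euclidean \<gamma>"
    unfolding \<gamma>_def
    using continuous_map_compose[OF continuous_map_snd \<iota>1] continuous_map_compose[OF continuous_map_snd \<iota>2]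
    by (intro continuous_map_seq_line mc) (simp_all add: o_def)
  have m01: "m (t, w) \<in> {0..1}" if "t \<in> {0..1}" for t w
    using that by (auto simp: m_def mult_le_one)
  have \<gamma>Q: "\<gamma> (t, x, z) \<in> Q" if "t \<in> {0..1}" "x \<in> topspace X" "z \<in> topspace Z" for t x z
  proof (cases "v (x, z) < 1")
    case True
    then have "dist (\<iota> z) (\<iota> (f x)) < \<delta>" using \<delta> by (simp add: v_def)
    then show ?thesis using seg[OF _ _ _ m01[OF that(1)], of "\<iota> z" "\<iota> (f x)" "(x, z)"] that fin by (simp add: \<gamma>_def)
  next
    case False
    then show ?thesis using Q(2) that by (auto simp: \<gamma>_def m_def)
  qed
  have "continuous_map ?IW (top_of_set Q) \<gamma>"
    using \<gamma>c \<gamma>Q by (auto simp: continuous_map_in_subtopology)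
  from continuous_map_compose[OF this \<rho>] have Dc: "continuous_map ?IW ?W D"
    unfolding D_def
    by (intro continuous_map_pairedI continuous_map_fst_snd)
       (simp add: o_def)
  have v0: "v w \<ge> 0" for w using \<delta> by (simp add: v_def)
  have \<iota>_eq: "\<iota> z = \<iota> z' \<longleftrightarrow> z = z'" if "z \<in> topspace Z" "z' \<in> topspace Z" for z z'
    using \<rho>\<iota> that by metis
  have G: "?G = {w \<in> topspace ?W. v w = 0}"
    using \<delta> fin \<iota>_eq by (auto simp: v_def)
  have "cylinder_retraction ?W ?G (\<lambda>(t, w). (max 0 (t - 2 * v w), D (min 1 (t / (2 * v w)), w)))"
  proof (rule NDR_cylinder_retraction[OF vc v0 Dc _ _ G])
    show "D (0, w) = w" if "w \<in> topspace ?W" for w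
      using that \<rho>\<iota> by (auto simp: D_def \<gamma>_def m_def)
    show "D (1, w) \<in> ?G" if "w \<in> topspace ?W" "v w \<le> 1/2" for w
      using that \<rho>\<iota> fin by (auto simp: D_def \<gamma>_def m_def)
    show "D (t, a) = a" if "t \<in> {0..1}" "a \<in> ?G" for t a
      using that \<rho>\<iota> fin by (auto simp: D_def \<gamma>_def)
  qed
  then show thesis by (rule that) (simp add: D_def)
qed

section \<open>Discs and maps out of a space with a cell attached\<close>

definition disc_norm :: "nat \<Rightarrow> (nat \<Rightarrow> real) \<Rightarrow> real" where
  "disc_norm n x = sqrt (\<Sum>i<n. (x i)\<^sup>2)"

text \<open>The radial retraction of Euclidean space onto the unit disc. Clearing the coordinates
  from \<open>n\<close> on lets it accept any sequence.\<close>

definition disc_clip :: "nat \<Rightarrow> (nat \<Rightarrow> real) \<Rightarrow> nat \<Rightarrow> real" where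
  "disc_clip n x = (\<lambda>i. if i < n then x i / max 1 (disc_norm n x) else 0)"

lemma topspace_disc: "topspace (disc n) = {x. (\<forall>i\<ge>n. x i = 0) \<and> disc_norm n x \<le> 1}"
  by (auto simp: disc_def topspace_Euclidean_space disc_norm_def)

lemma open_disc_eq: "open_disc n = {x. (\<forall>i\<ge>n. x i = 0) \<and> disc_norm n x < 1}"
  by (auto simp: open_disc_def topspace_disc disc_norm_def)

lemma boundary_sphere_eq: "boundary_sphere n = {x. (\<forall>i\<ge>n. x i = 0) \<and> disc_norm n x = 1}"
  by (auto simp: boundary_sphere_def topspace_disc disc_norm_def)

lemma disc_eq: "disc n = top_of_set (topspace (disc n))"
  by (simp add: disc_def Euclidean_space_def euclidean_product_topology subtopology_subtopology)

lemma continuous_map_into_disc: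
  "continuous_map W (disc n) f \<longleftrightarrow>
     (\<forall>i. continuous_map W euclideanreal (\<lambda>w. f w i)) \<and> f ` topspace W \<subseteq> topspace (disc n)"
  by (subst disc_eq) (auto simp: continuous_map_in_subtopology continuous_map_seq_iff)

lemma continuous_map_disc_coordinate: "continuous_map (disc n) euclideanreal (\<lambda>x. x i)"
proof -
  have "continuous_map (disc n) (disc n) (\<lambda>x. x)" by simp
  then show ?thesis unfolding continuous_map_into_disc by blast
qed

lemma disc_norm_nonneg [simp]: "disc_norm n x \<ge> 0"
  by (simp add: disc_norm_def sum_nonneg)

lemma disc_norm_scale: "disc_norm n (\<lambda>i. c * x i) = \<bar>c\<bar> * disc_norm n x"
  by (simp add: disc_norm_def power_mult_distrib real_sqrt_mult flip: sum_distrib_left)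

lemma disc_norm_clip: "disc_norm n (disc_clip n x) = min 1 (disc_norm n x)"
proof -
  have "disc_norm n (disc_clip n x) = disc_norm n (\<lambda>i. (1 / max 1 (disc_norm n x)) * x i)"
    unfolding disc_norm_def disc_clip_def by (intro arg_cong[where f=sqrt] sum.cong) auto
  then show ?thesis
    by (simp only: disc_norm_scale) (auto simp: max_def min_def)
qed

lemma disc_clip_in_disc: "disc_clip n x \<in> topspace (disc n)"
  unfolding topspace_disc using disc_norm_clip[of n x] by (simp add: disc_clip_def)

lemma disc_clip_eq: "x \<in> topspace (disc n) \<Longrightarrow> disc_clip n x = x"
  by (auto simp: topspace_disc disc_clip_def max_def)

lemma disc_clip_sphere:
  assumes "x \<in> boundary_sphere n" "c \<ge> 1"
  shows "disc_clip n (\<lambda>i. c * x i) = x"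
proof -
  have "max 1 (disc_norm n (\<lambda>i. c * x i)) = c"
    using assms by (simp add: boundary_sphere_eq disc_norm_scale)
  then show ?thesis using assms by (auto simp: disc_clip_def boundary_sphere_eq)
qed

lemma disc_clip_boundary:
  assumes "disc_norm n x \<ge> 1"
  shows "disc_clip n x \<in> boundary_sphere n"
  using assms disc_norm_clip[of n x] by (simp add: boundary_sphere_eq disc_clip_def)

lemma continuous_map_disc_norm:
  assumes "\<And>i. continuous_map W euclideanreal (\<lambda>w. f w i)"
  shows "continuous_map W euclideanreal (\<lambda>w. disc_norm n (f w))"
  unfolding disc_norm_def
  by (intro continuous_map_sqrt continuous_map_sum continuous_map_real_pow assms) auto

lemma continuous_map_disc_clip:
  assumes "\<And>i. continuous_map W euclideanreal (\<lambda>w. f w i)"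
  shows "continuous_map W (disc n) (\<lambda>w. disc_clip n (f w))"
  unfolding continuous_map_into_disc
proof (intro conjI allI)
  show "continuous_map W euclideanreal (\<lambda>w. disc_clip n (f w) i)" for i
  proof (cases "i < n")
    case True
    have "continuous_map W euclideanreal (\<lambda>w. f w i / max 1 (disc_norm n (f w)))"
      by (intro continuous_map_real_intros assms continuous_map_disc_norm) (auto simp: max_def)
    with True show ?thesis by (simp add: disc_clip_def)
  qed (simp add: disc_clip_def)
qed (use disc_clip_in_disc in auto)

lemma compact_space_disc: "compact_space (disc n)"
proof -
  let ?P = "PiE UNIV (\<lambda>i::nat. {-1..1::real})"
  have "compactin (product_topology (\<lambda>_. euclideanreal) UNIV) ?P"
    by (subst compactin_PiE) auto
  then have P: "compact ?P" by (simp add: euclidean_product_topology)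
  have "continuous_map euclidean euclideanreal (disc_norm n)"
    using continuous_map_disc_norm[of euclidean "\<lambda>x. x" n]
    using continuous_map_seq_iff[of euclidean "\<lambda>x. x"] by simp
  then have "closedin euclidean {x \<in> topspace euclidean. disc_norm n x \<in> {..1}}"
    by (rule closedin_continuous_map_preimage) simp
  then have 1: "closed {x. disc_norm n x \<le> 1}" by simp
  have "closed {x::nat \<Rightarrow> real. x i = 0}" for i
    using closed_Collect_eq[of "\<lambda>x::nat \<Rightarrow> real. x i" "\<lambda>_. 0"] by simp
  then have 2: "closed {x::nat \<Rightarrow> real. \<forall>i\<ge>n. x i = 0}"
    by (intro closed_Collect_all closed_Collect_imp) auto
  have "topspace (disc n) = ?P \<inter> ({x. \<forall>i\<ge>n. x i = 0} \<inter> {x. disc_norm n x \<le> 1})" (is "_ = ?P \<inter> ?R")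
  proof -
    have "x \<in> ?P" if x: "x \<in> topspace (disc n)" for x
    proof -
      have "\<bar>x i\<bar> \<le> 1" for i
      proof (cases "i < n")
        case True
        then have "(x i)\<^sup>2 \<le> (\<Sum>i<n. (x i)\<^sup>2)" by (intro member_le_sum) auto
        also have "\<dots> \<le> 1" using x by (simp add: topspace_disc disc_norm_def)
        finally show ?thesis by (simp add: abs_square_le_1)
      qed (use x in \<open>simp add: topspace_disc\<close>)
      then show ?thesis by (auto simp: abs_le_iff minus_le_iff)
    qed
    moreover have "topspace (disc n) = ?R" by (auto simp: topspace_disc)
    ultimately show ?thesis by blast
  qed
  then have "compact (topspace (disc n))"
    using P 1 2 by (simp add: compact_Int_closed closed_Int)
  then show ?thesis
    by (subst disc_eq) (simp add: compact_space_subtopology)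
qed

text \<open>A continuous map from a compact space onto a Hausdorff space is a quotient map. Hence
  continuity on a closed cell, or on the cylinder over it, may be tested on the disc.\<close>

lemma continuous_map_on_compact_image:
  assumes q: "continuous_map S V q" and S: "compact_space S" and V: "Hausdorff_space V"
    and G: "continuous_map S T (G \<circ> q)"
  shows "continuous_map (subtopology V (q ` topspace S)) T G"
proof (rule continuous_compose_quotient_map[OF _ G])
  have "q ` topspace S \<subseteq> topspace V" using q by (auto simp: continuous_map_def)
  then show "quotient_map S (subtopology V (q ` topspace S)) q"
    using q S V
    by (intro continuous_imp_quotient_map Hausdorff_space_subtopology)
       (auto simp: continuous_map_in_subtopology)
qed

lemma continuous_map_attach_cell:
  assumes V: "Hausdorff_space V" and K: "closedin V K" and \<Phi>: "continuous_map (disc n) V \<Phi>"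
    and cover: "topspace V \<subseteq> K \<union> \<Phi> ` topspace (disc n)"
    and GK: "continuous_map (subtopology V K) T G" and G\<Phi>: "continuous_map (disc n) T (\<lambda>x. G (\<Phi> x))"
  shows "continuous_map V T G"
proof (rule continuous_map_closed_Un[OF K _ cover GK])
  have "compactin V (\<Phi> ` topspace (disc n))"
    using compact_space_disc[of n] \<Phi> by (intro image_compactin) (auto simp: compact_space_def)
  then show "closedin V (\<Phi> ` topspace (disc n))" by (rule compactin_imp_closedin[OF V])
  show "continuous_map (subtopology V (\<Phi> ` topspace (disc n))) T G"
    by (rule continuous_map_on_compact_image[OF \<Phi> compact_space_disc V]) (use G\<Phi> in \<open>simp add: o_def\<close>)
qed

lemma subtopology_cylinder:
  "subtopology (cylinder V) ({0..1} \<times> S) = cylinder (subtopology V S)"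
  by (subst prod_topology_subtopology(2)) simp

lemma continuous_map_cylinder_cell:
  assumes V: "Hausdorff_space V" and \<Phi>: "continuous_map (disc n) V \<Phi>"
    and G\<Phi>: "continuous_map (cylinder (disc n)) T (\<lambda>z. G (fst z, \<Phi> (snd z)))"
  shows "continuous_map (cylinder (subtopology V (\<Phi> ` topspace (disc n)))) T G"
proof -
  let ?ID = "cylinder (disc n)"
  let ?q = "\<lambda>z. (fst z, \<Phi> (snd z))"
  have "continuous_map ?ID (cylinder V) ?q"
    using continuous_map_compose[OF continuous_map_snd \<Phi>]
    by (intro continuous_map_pairedI continuous_map_fst) (simp add: o_def)
  moreover have "compact_space ?ID"
    by (simp add: compact_space_prod_topology compact_space_disc compact_space_subtopology)
  moreover have "Hausdorff_space (cylinder V)"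
    using V by (simp add: Hausdorff_space_prod_topology Hausdorff_space_subtopology)
  ultimately have "continuous_map (subtopology (cylinder V) (?q ` topspace ?ID)) T G"
    by (rule continuous_map_on_compact_image) (use G\<Phi> in \<open>simp add: o_def\<close>)
  moreover have "?q ` topspace ?ID = {0..1} \<times> \<Phi> ` topspace (disc n)"
    by (force simp: image_iff)
  ultimately show ?thesis by (simp add: subtopology_cylinder)
qed

lemma continuous_map_cylinder_attach_cell:
  assumes V: "Hausdorff_space V" and K: "closedin V K" and \<Phi>: "continuous_map (disc n) V \<Phi>"
    and cover: "topspace V \<subseteq> K \<union> \<Phi> ` topspace (disc n)"
    and GK: "continuous_map (cylinder (subtopology V K)) T G"
    and G\<Phi>: "continuous_map (cylinder (disc n)) T (\<lambda>z. G (fst z, \<Phi> (snd z)))"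
  shows "continuous_map (cylinder V) T G"
proof (rule continuous_map_closed_Un)
  let ?IV = "cylinder V"
  let ?D = "\<Phi> ` topspace (disc n)"
  have "compactin V ?D"
    using compact_space_disc[of n] \<Phi> by (intro image_compactin) (auto simp: compact_space_def)
  then have D: "closedin V ?D" by (rule compactin_imp_closedin[OF V])
  show "closedin ?IV ({0..1} \<times> K)" "closedin ?IV ({0..1} \<times> ?D)"
    using K D by (simp_all add: closedin_prod_Times_iff)
  show "topspace ?IV \<subseteq> {0..1} \<times> K \<union> {0..1} \<times> ?D" using cover by auto
  show "continuous_map (subtopology ?IV ({0..1} \<times> K)) T G" unfolding subtopology_cylinder by (rule GK)
  show "continuous_map (subtopology ?IV ({0..1} \<times> ?D)) T G"
    unfolding subtopology_cylinder by (rule continuous_map_cylinder_cell[OF V \<Phi> G\<Phi>])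
qed

lemma openin_unit_interval_Ball:
  assumes F: "continuous_map (cylinder W) Z F" and U: "openin Z U"
  shows "openin W {w \<in> topspace W. \<forall>t\<in>{0..1}. F (t, w) \<in> U}"
proof (subst openin_subopen, intro ballI)
  fix w assume "w \<in> {w \<in> topspace W. \<forall>t\<in>{0..1}. F (t, w) \<in> U}"
  then obtain C where C: "openin W C" "w \<in> C" "\<And>t c. t \<in> {0..1} \<Longrightarrow> c \<in> C \<Longrightarrow> F (t, c) \<in> U"
    using unit_interval_tube[OF F U, of w] by auto
  then have "C \<subseteq> {w \<in> topspace W. \<forall>t\<in>{0..1}. F (t, w) \<in> U}"
    using openin_subset[OF C(1)] by auto
  with C show "\<exists>T. openin W T \<and> w \<in> T \<and> T \<subseteq> {w \<in> topspace W. \<forall>t\<in>{0..1}. F (t, w) \<in> U}" by blast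
qed

lemma topspace_disc_Un: "topspace (disc n) = open_disc n \<union> boundary_sphere n"
  by (auto simp: topspace_disc open_disc_eq boundary_sphere_eq)

lemma closed_point_dist_pos:
  fixes a :: "'z :: metric_space"
  assumes "closed S" "a \<notin> S"
  obtains \<epsilon> where "\<epsilon> > 0" "\<And>y. y \<in> S \<Longrightarrow> \<epsilon> \<le> dist a y"
proof -
  obtain \<epsilon> where "\<epsilon> > 0" "ball a \<epsilon> \<subseteq> - S"
    using assms openE[of "- S" a] by auto
  then show thesis using that[of \<epsilon>] by (force simp: subset_iff not_less)
qed

text \<open>The embedding \<open>J\<close> extends \<open>\<iota>\<close> over the cell in the even coordinates; the odd ones record a point
  \<open>x\<close> of the cell as its height \<open>\<eta> = 1 - |x|\<close> and as \<open>\<eta> x\<close>. A vector \<open>w\<close> of positive height thus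
  suggests a point \<open>c w\<close> of the cell, and \<open>\<kappa> w\<close> is its distance from \<open>J (c w)\<close> relative to the height.
  As \<open>\<kappa>\<close> grows from 0 to 1 the retraction pushes \<open>c w\<close> into \<open>K\<close> along \<open>P\<close>; from 1 to 2 it changes
  over to \<open>\<rho>\<close> of the even coordinates along a line.\<close>

lemma neighbourhood_retract_attach_cell:
  assumes Z: "compact_space Z" "Hausdorff_space Z" and K: "closedin Z K"
    and nr: "neighbourhood_retract (subtopology Z K) \<iota> Q \<rho>"
    and \<Phi>: "continuous_map (disc n) Z \<Phi>" and inj: "inj_on \<Phi> (open_disc n)"
    and im: "\<Phi> ` open_disc n = topspace Z - K" and bd: "\<Phi> ` boundary_sphere n \<subseteq> K"
  shows "\<exists>\<iota>' Q' \<rho>'. neighbourhood_retract Z \<iota>' Q' \<rho>'"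
proof -
  have KZ: "K \<subseteq> topspace Z" using K by (rule closedin_subset)
  then have topK: "topspace (subtopology Z K) = K" by auto
  have \<iota>: "continuous_map (subtopology Z K) euclidean \<iota>" and Q: "open Q" and \<iota>Q: "\<And>z. z \<in> K \<Longrightarrow> \<iota> z \<in> Q"
    and \<rho>K: "continuous_map (top_of_set Q) (subtopology Z K) \<rho>" and \<rho>\<iota>: "\<And>z. z \<in> K \<Longrightarrow> \<rho> (\<iota> z) = z"
    using nr unfolding neighbourhood_retract_def topK by auto
  have \<rho>: "continuous_map (top_of_set Q) Z \<rho>" and \<rho>_in_K: "\<And>q. q \<in> Q \<Longrightarrow> \<rho> q \<in> K"
    using \<rho>K by (auto simp: continuous_map_in_subtopology)
  have cover: "topspace Z \<subseteq> K \<union> \<Phi> ` topspace (disc n)"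
    unfolding topspace_disc_Un image_Un using im by blast
  have \<Phi>Z: "\<Phi> x \<in> topspace Z" if "x \<in> topspace (disc n)" for x
    using \<Phi> that by (auto simp: continuous_map_def)
  define \<theta> where "\<theta> = inv_into (open_disc n) \<Phi>"
  have \<theta>: "\<theta> (\<Phi> x) = x" if "x \<in> open_disc n" for x
    using that inj by (simp add: \<theta>_def)
  have cell: "\<theta> z \<in> open_disc n \<and> \<Phi> (\<theta> z) = z" if "z \<in> topspace Z" "z \<notin> K" for z
    using that im by (metis DiffI \<theta> imageE)
  have \<Phi>K: "\<Phi> x \<in> K \<longleftrightarrow> x \<in> boundary_sphere n" if "x \<in> topspace (disc n)" for x
    using that bd im by (auto simp: topspace_disc_Un)
  define \<eta> where "\<eta> = (\<lambda>z. if z \<in> K then 0 else 1 - disc_norm n (\<theta> z))"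
  have \<eta>\<Phi>: "\<eta> (\<Phi> x) = 1 - disc_norm n x" if "x \<in> topspace (disc n)" for x
    using that \<Phi>K[OF that] \<theta>[of x] by (auto simp: \<eta>_def topspace_disc_Un boundary_sphere_eq)
  have \<eta>0: "\<eta> z \<ge> 0" "\<eta> z = 0 \<longleftrightarrow> z \<in> K" if "z \<in> topspace Z" for z
    using cell[OF that] by (auto simp: \<eta>_def open_disc_eq)
  have \<eta>c: "continuous_map Z euclideanreal \<eta>"
  proof (rule continuous_map_attach_cell[OF Z(2) K \<Phi> cover])
    show "continuous_map (subtopology Z K) euclideanreal \<eta>"
      by (rule continuous_map_eq[of _ _ "\<lambda>_. 0"]) (auto simp: \<eta>_def)
    have "continuous_map (disc n) euclideanreal (\<lambda>x. 1 - disc_norm n x)"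
      by (intro continuous_map_real_intros continuous_map_disc_norm continuous_map_disc_coordinate)
    then show "continuous_map (disc n) euclideanreal (\<lambda>x. \<eta> (\<Phi> x))"
      by (rule continuous_map_eq) (simp add: \<eta>\<Phi>)
  qed
  \<comment> \<open>In general \<open>\<theta>\<close> has no continuous extension to
    \<open>K\<close>; the factor, which is the height \<open>\<eta>\<close>, makes the product tend
    to 0 there.\<close>
  define \<xi> where "\<xi> = (\<lambda>z i. if z \<in> K then 0 else (1 - disc_norm n (\<theta> z)) * \<theta> z i)"
  have \<xi>\<Phi>: "\<xi> (\<Phi> x) i = (1 - disc_norm n x) * x i" if "x \<in> topspace (disc n)" for x i
    using that \<Phi>K[OF that] \<theta>[of x] by (auto simp: \<xi>_def topspace_disc_Un boundary_sphere_eq)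
  have \<xi>c: "continuous_map Z euclideanreal (\<lambda>z. \<xi> z i)" for i
  proof (rule continuous_map_attach_cell[OF Z(2) K \<Phi> cover])
    show "continuous_map (subtopology Z K) euclideanreal (\<lambda>z. \<xi> z i)"
      by (rule continuous_map_eq[of _ _ "\<lambda>_. 0"]) (auto simp: \<xi>_def)
    have "continuous_map (disc n) euclideanreal (\<lambda>x. (1 - disc_norm n x) * x i)"
      by (intro continuous_map_real_intros continuous_map_disc_norm continuous_map_disc_coordinate)
    then show "continuous_map (disc n) euclideanreal (\<lambda>x. \<xi> (\<Phi> x) i)"
      by (rule continuous_map_eq) (simp add: \<xi>\<Phi>)
  qed
  \<comment> \<open>A radial push by the factor \<open>1 + t\<close>. At time 1 the radius is
    doubled, so every point of height at most \<open>1/2\<close> arrives in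
    \<open>K\<close>.\<close>
  define P where "P = (\<lambda>w. if snd w \<in> K then snd w else \<Phi> (disc_clip n (\<lambda>i. (1 + fst w) * \<theta> (snd w) i)))"
  have P\<Phi>: "P (t, \<Phi> x) = \<Phi> (disc_clip n (\<lambda>i. (1 + t) * x i))" if "x \<in> topspace (disc n)" "t \<ge> 0" for x t
    using that \<Phi>K[OF that(1)] \<theta>[of x] by (auto simp: P_def topspace_disc_Un disc_clip_sphere)
  have Pc: "continuous_map (cylinder Z) Z P"
  proof (rule continuous_map_cylinder_attach_cell[OF Z(2) K \<Phi> cover])
    have "continuous_map (cylinder (subtopology Z K)) Z snd"
      using continuous_map_snd[of unit_interval "subtopology Z K"] by (simp add: continuous_map_in_subtopology)
    then show "continuous_map (cylinder (subtopology Z K)) Z P"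
      by (rule continuous_map_eq) (auto simp: P_def)
    let ?ID = "cylinder (disc n)"
    have "continuous_map ?ID euclideanreal (\<lambda>z. (1 + fst z) * snd z i)" for i
      by (intro continuous_map_real_intros continuous_map_cylinder_fst
          continuous_map_compose[OF continuous_map_snd continuous_map_disc_coordinate, unfolded o_def])
    from continuous_map_compose[OF continuous_map_disc_clip[OF this] \<Phi>]
    have "continuous_map ?ID Z (\<lambda>z. \<Phi> (disc_clip n (\<lambda>i. (1 + fst z) * snd z i)))"
      by (simp add: o_def)
    then show "continuous_map ?ID Z (\<lambda>z. P (fst z, \<Phi> (snd z)))"
      by (rule continuous_map_eq) (auto simp: P\<Phi>)
  qed
  have P0: "P (0, z) = z" if "z \<in> topspace Z" for z
  proof (cases "z \<in> K")
    case False
    with cell[OF that] have "\<theta> z \<in> topspace (disc n)" "\<Phi> (\<theta> z) = z" by (auto simp: topspace_disc_Un)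
    with P\<Phi>[of "\<theta> z" 0] show ?thesis by (simp add: disc_clip_eq)
  qed (simp add: P_def)
  have PK: "P (t, z) = z" if "z \<in> K" for t z using that by (simp add: P_def)
  have P1: "P (1, z) \<in> K" if "z \<in> topspace Z" "\<eta> z \<le> 1/2" for z
  proof (cases "z \<in> K")
    case False
    with cell[OF that(1)] have x: "\<theta> z \<in> topspace (disc n)" "\<Phi> (\<theta> z) = z" by (auto simp: topspace_disc_Un)
    have "disc_norm n (\<lambda>i. 2 * \<theta> z i) \<ge> 1"
      using that(2) False by (simp add: disc_norm_scale \<eta>_def)
    then have "\<Phi> (disc_clip n (\<lambda>i. 2 * \<theta> z i)) \<in> K"
      using bd disc_clip_boundary by blast
    with P\<Phi>[OF x(1), of 1] x(2) show ?thesis by simp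
  qed (simp add: P_def)
  \<comment> \<open>Tietze extends \<open>\<iota>\<close> coordinatewise to all of \<open>Z\<close>.
    Off \<open>K\<close> the extension \<open>\<psi>\<close> need not map into \<open>Q\<close>;
    this is why \<open>F\<close> uses it at \<open>P (1, z)\<close>, which lies in \<open>K\<close>
    for points \<open>z\<close> of small height.\<close>
  have "\<exists>g. continuous_map Z euclideanreal g \<and> (\<forall>z\<in>K. g z = \<iota> z i)" for i
  proof -
    have "normal_space Z" using Z compact_Hausdorff_or_regular_imp_normal_space by blast
    then obtain g where "continuous_map Z euclideanreal g" "\<And>z. z \<in> K \<Longrightarrow> g z = \<iota> z i"
      using Tietze_extension_realinterval[OF _ K is_interval_univ UNIV_not_empty
          continuous_map_seq_coordinate[OF \<iota>, of i] subset_UNIV] by metis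
    then show ?thesis by blast
  qed
  then obtain g where g: "\<And>i. continuous_map Z euclideanreal (g i)" "\<And>i z. z \<in> K \<Longrightarrow> g i z = \<iota> z i"
    by metis
  define \<psi> where "\<psi> = (\<lambda>z i. g i z)"
  have \<psi>c: "continuous_map Z euclidean \<psi>" using g(1) by (simp add: \<psi>_def continuous_map_seq_iff)
  have \<psi>\<iota>: "\<psi> z = \<iota> z" if "z \<in> K" for z using g(2)[OF that] by (simp add: \<psi>_def)
  define ev where "ev = (\<lambda>w::nat \<Rightarrow> real. \<lambda>i. w (2 * i))"
  define J where "J = (\<lambda>z i. if even i then \<psi> z (i div 2) else if i = 1 then \<eta> z else \<xi> z ((i - 3) div 2))"
  have ev_J: "ev (J z) = \<psi> z" and J1: "J z 1 = \<eta> z" and J3: "J z (2 * i + 3) = \<xi> z i" for z i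
    by (auto simp: ev_def J_def)
  have J1': "J z (Suc 0) = \<eta> z" for z using J1 by simp
  have Jc: "continuous_map Z euclidean J"
    unfolding continuous_map_seq_iff J_def
  proof
    fix i show "continuous_map Z euclideanreal (\<lambda>z. if even i then \<psi> z (i div 2) else if i = 1 then \<eta> z else \<xi> z ((i - 3) div 2))"
      using continuous_map_seq_coordinate[OF \<psi>c, of "i div 2"] \<eta>c \<xi>c by simp
  qed
  have coord: "continuous_map (top_of_set S) euclideanreal (\<lambda>w::nat \<Rightarrow> real. w i)" for i S
    using continuous_map_seq_coordinate[of "top_of_set S" "\<lambda>w. w"] by simp
  have evc: "continuous_map (top_of_set S) euclidean ev" for S
    unfolding continuous_map_seq_iff ev_def using coord by simp
  define U where "U = {w::nat \<Rightarrow> real. 0 < w 1}"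
  have U: "open U"
    unfolding U_def by (intro open_Collect_less) (auto intro!: continuous_on_product_then_coordinatewise)
  \<comment> \<open>Dividing by the height recovers \<open>\<theta> z\<close> from
    \<open>J z\<close>; clipping turns the quotient into a point of the disc for every vector of
    positive height.\<close>
  define c where "c = (\<lambda>w::nat \<Rightarrow> real. \<Phi> (disc_clip n (\<lambda>i. w (2 * i + 3) / w 1)))"
  have cc: "continuous_map (top_of_set U) Z c"
  proof -
    have "continuous_map (top_of_set U) euclideanreal (\<lambda>w. w (2 * i + 3) / w 1)" for i
      by (intro continuous_map_real_intros coord) (auto simp: U_def)
    from continuous_map_compose[OF continuous_map_disc_clip[OF this] \<Phi>]
    show ?thesis by (simp add: o_def c_def)
  qed
  have cZ: "c w \<in> topspace Z" for w
    unfolding c_def by (intro \<Phi>Z disc_clip_in_disc)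
  \<comment> \<open>Measured against the height, the condition \<open>\<kappa> w \<le> 2\<close>
    confines \<open>w\<close> to a region that closes in on the image of \<open>J\<close> as the
    height tends to 0. Near a vector of height 0 outside this image only
    \<open>\<rho> (ev w)\<close> remains, and near one in the image all clauses of \<open>R\<close>
    have close values.\<close>
  define \<kappa> where "\<kappa> = (\<lambda>w::nat \<Rightarrow> real. dist w (J (c w)) / w 1)"
  have \<kappa>0: "\<kappa> w \<ge> 0" if "w \<in> U" for w using that by (simp add: \<kappa>_def U_def)
  have \<kappa>c: "continuous_map (top_of_set U) euclideanreal \<kappa>"
    unfolding \<kappa>_def
    using continuous_map_compose[OF cc Jc]
    by (intro continuous_map_real_intros coord continuous_map_dist_seq) (auto simp: U_def o_def)
  define F where "F = (\<lambda>(s, z, q). seq_line (\<psi> (P (1, z))) q s)"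
  have Fc: "continuous_map (cylinder (prod_topology Z euclidean)) euclidean F"
  proof -
    let ?V = "cylinder (prod_topology Z (euclidean :: (nat \<Rightarrow> real) topology))"
    have "continuous_map ?V Z (\<lambda>v. fst (snd v))"
      by (rule continuous_map_fst_snd)
    then have "continuous_map ?V Z (\<lambda>v. P (1, fst (snd v)))"
      by (intro continuous_map_compose2[OF Pc]) auto
    from continuous_map_compose[OF this \<psi>c]
    have 1: "continuous_map ?V euclidean (\<lambda>v. \<psi> (P (1, fst (snd v))))" by (simp add: o_def)
    have 2: "continuous_map ?V euclidean (\<lambda>v. snd (snd v))"
      by (rule continuous_map_snd_snd)
    show ?thesis unfolding F_def case_prod_unfold by (rule continuous_map_seq_line[OF 1 2 continuous_map_cylinder_fst])
  qed
  have FU: "continuous_map (top_of_set S) euclidean (\<lambda>w. F (s w, c w, ev w))"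
    if "S \<subseteq> U" "continuous_map (top_of_set S) unit_interval s" for S s
    using that continuous_map_from_subtopology_mono[OF cc that(1)]
    by (intro continuous_map_compose2[OF Fc] continuous_map_pairedI evc)
  \<comment> \<open>The clauses match. At \<open>\<kappa> w = 1\<close> the segment starts at
    \<open>\<psi> (P (1, c w))\<close>, which \<open>\<rho>\<close> takes back to
    \<open>P (1, c w)\<close> if this point lies in \<open>K\<close>; from
    \<open>\<kappa> w = 2\<close> on it has arrived at \<open>ev w\<close>.\<close>
  define R where "R = (\<lambda>w. if w \<notin> U then \<rho> (ev w) else if \<kappa> w \<le> 1 then P (min 1 (\<kappa> w), c w)
      else \<rho> (F (min 1 (max 0 (\<kappa> w - 1)), c w, ev w)))"
  \<comment> \<open>On \<open>A\<close> only \<open>P\<close> occurs, on \<open>C\<close> only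
    \<open>\<rho> (ev w)\<close>. The transition takes place in \<open>B\<close>, where the small
    height of \<open>c w\<close> brings \<open>P (1, c w)\<close> into \<open>K\<close> and the
    whole segment stays in \<open>Q\<close>.\<close>
  define A where "A = {w \<in> U. \<kappa> w \<in> {..<1}}"
  define B where "B = {w \<in> U. \<eta> (c w) \<in> {..<1/2}} \<inter> {w \<in> U. \<forall>s\<in>{0..1}. F (s, c w, ev w) \<in> Q}"
  define C where "C = {w \<in> U. \<kappa> w \<in> {2<..}} \<inter> {w \<in> U. ev w \<in> Q}"
  define Q' where "Q' = A \<union> B \<union> C \<union> {w. w \<notin> U \<and> ev w \<in> Q}"
  have opU: "open {w \<in> U. G w \<in> S}" if "continuous_map (top_of_set U) T G" "openin T S" for T and G :: "_ \<Rightarrow> 't" and S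
    using openin_continuous_map_preimage[OF that] U by (simp add: openin_open_eq)
  have A: "open A" unfolding A_def by (rule opU[OF \<kappa>c]) simp
  have B: "open B"
    unfolding B_def
  proof (intro open_Int)
    show "open {w \<in> U. \<eta> (c w) \<in> {..<1/2}}"
      using opU[OF continuous_map_compose[OF cc \<eta>c], of "{..<1/2}"] by simp
    have "continuous_map (cylinder (top_of_set U)) (prod_topology Z euclidean) (\<lambda>v. (c (snd v), ev (snd v)))"
      by (intro continuous_map_pairedI continuous_map_compose[OF continuous_map_snd cc, unfolded o_def]
          continuous_map_compose[OF continuous_map_snd evc, unfolded o_def])
    from continuous_map_compose2[OF Fc continuous_map_fst this]
    have "continuous_map (cylinder (top_of_set U)) euclidean (\<lambda>v. F (fst v, c (snd v), ev (snd v)))" .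
    from openin_unit_interval_Ball[OF this, of Q] Q U
    show "open {w \<in> U. \<forall>s\<in>{0..1}. F (s, c w, ev w) \<in> Q}"
      by (simp add: openin_open_eq)
  qed
  have C: "open C"
    unfolding C_def
  proof (intro open_Int)
    show "open {w \<in> U. \<kappa> w \<in> {2<..}}" by (rule opU[OF \<kappa>c]) simp
    show "open {w \<in> U. ev w \<in> Q}" by (rule opU[OF evc]) (simp add: Q)
  qed
  have around: "\<exists>T. open T \<and> w \<in> T \<and> T \<subseteq> Q' \<and> (\<forall>w\<in>T. R w \<in> N)"
    if "open S" "S \<subseteq> Q'" "continuous_map (top_of_set S) Z R" "w \<in> S" "openin Z N" "R w \<in> N" for S w N
  proof (intro exI conjI)
    show "open {w \<in> S. R w \<in> N}"
      using openin_continuous_map_preimage[OF that(3,5)] that(1) by (simp add: openin_open_eq)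
  qed (use that in auto)
  have RA: "continuous_map (top_of_set A) Z R"
  proof -
    have AU: "A \<subseteq> U" by (auto simp: A_def)
    have "continuous_map (top_of_set A) unit_interval (\<lambda>w. min 1 (\<kappa> w))"
      unfolding continuous_map_unit_interval_iff
      using continuous_map_from_subtopology_mono[OF \<kappa>c AU] \<kappa>0
      by (intro conjI continuous_map_real_intros) (auto simp: A_def)
    then have "continuous_map (top_of_set A) Z (\<lambda>w. P (min 1 (\<kappa> w), c w))"
      by (intro continuous_map_compose2[OF Pc] continuous_map_from_subtopology_mono[OF cc AU])
    then show ?thesis
      by (rule continuous_map_eq) (auto simp: R_def A_def)
  qed
  have RC: "continuous_map (top_of_set C) Z R"
  proof -
    have "continuous_map (top_of_set C) (top_of_set Q) ev"
      using evc by (auto simp: continuous_map_in_subtopology C_def)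
    from continuous_map_compose[OF this \<rho>] have "continuous_map (top_of_set C) Z (\<lambda>w. \<rho> (ev w))"
      by (simp add: o_def)
    then show ?thesis
      by (rule continuous_map_eq) (auto simp: R_def C_def F_def)
  qed
  have RB: "continuous_map (top_of_set B) Z R"
  proof -
    have BU: "B \<subseteq> U" by (auto simp: B_def)
    have \<kappa>B: "continuous_map (top_of_set B) euclideanreal \<kappa>"
      by (rule continuous_map_from_subtopology_mono[OF \<kappa>c BU])
    have "continuous_map (top_of_set B) unit_interval (\<lambda>w. min 1 (\<kappa> w))"
      unfolding continuous_map_unit_interval_iff
      using \<kappa>0 BU by (intro conjI continuous_map_real_intros \<kappa>B) auto
    then have 1: "continuous_map (top_of_set B) Z (\<lambda>w. P (min 1 (\<kappa> w), c w))"
      by (intro continuous_map_compose2[OF Pc] continuous_map_from_subtopology_mono[OF cc BU])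
    have "continuous_map (top_of_set B) unit_interval (\<lambda>w. min 1 (max 0 (\<kappa> w - 1)))"
      unfolding continuous_map_unit_interval_iff by (intro conjI continuous_map_real_intros \<kappa>B) auto
    from FU[OF BU this]
    have "continuous_map (top_of_set B) (top_of_set Q) (\<lambda>w. F (min 1 (max 0 (\<kappa> w - 1)), c w, ev w))"
      by (auto simp: continuous_map_in_subtopology B_def)
    from continuous_map_compose[OF this \<rho>]
    have 2: "continuous_map (top_of_set B) Z (\<lambda>w. \<rho> (F (min 1 (max 0 (\<kappa> w - 1)), c w, ev w)))"
      by (simp add: o_def)
    have "continuous_map (top_of_set B) Z (\<lambda>w. if \<kappa> w \<le> 1 then P (min 1 (\<kappa> w), c w)
        else \<rho> (F (min 1 (max 0 (\<kappa> w - 1)), c w, ev w)))"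
    proof (rule continuous_map_cases_le[OF \<kappa>B continuous_map_real_const])
      fix w assume w: "w \<in> topspace (top_of_set B)" "\<kappa> w = 1"
      then have "P (1, c w) \<in> K" using P1[OF cZ, of w] by (simp add: B_def)
      then show "P (min 1 (\<kappa> w), c w) = \<rho> (F (min 1 (max 0 (\<kappa> w - 1)), c w, ev w))"
        using w(2) by (simp add: F_def \<psi>\<iota> \<rho>\<iota>)
    qed (use 1 2 in \<open>auto intro: continuous_map_from_subtopology\<close>)
    then show ?thesis
      by (rule continuous_map_eq) (use BU in \<open>auto simp: R_def\<close>)
  qed
  have cJ: "\<eta> z > 0" "c (J z) = z" if z: "z \<in> topspace Z" "z \<notin> K" for z
  proof -
    show pos: "\<eta> z > 0" using \<eta>0[OF z(1)] z(2) by simp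
    have x: "\<theta> z \<in> topspace (disc n)" "\<Phi> (\<theta> z) = z" using cell[OF z] by (auto simp: topspace_disc_Un)
    have "(\<lambda>i. J z (2 * i + 3) / J z 1) = \<theta> z"
      using pos z(2) unfolding J3 J1 by (auto simp: \<xi>_def \<eta>_def)
    then show "c (J z) = z" unfolding c_def using x by (simp add: disc_clip_eq)
  qed
  have RJ: "R (J z) = z" and JQ': "J z \<in> Q'" if z: "z \<in> topspace Z" for z
  proof -
    have "R (J z) = z \<and> J z \<in> Q'"
    proof (cases "z \<in> K")
      case True
      then show ?thesis using \<eta>0[OF z] by (simp add: R_def Q'_def U_def J1' ev_J \<psi>\<iota> \<rho>\<iota> \<iota>Q)
    next
      case False
      with cJ[OF z] P0[OF z] show ?thesis by (simp add: R_def Q'_def A_def U_def J1' \<kappa>_def)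
    qed
    then show "R (J z) = z" "J z \<in> Q'" by simp_all
  qed
  have J_closed: "closed (J ` S)" if "closedin Z S" for S
  proof -
    have "compactin Z S" by (rule closedin_compact_space[OF Z(1) that])
    then show ?thesis using image_compactin[OF _ Jc] by (simp add: compact_imp_closed)
  qed
  \<comment> \<open>The distance from \<open>w0\<close> to \<open>J (c w)\<close> is less than
    \<open>\<epsilon> / 2 + 2 * (\<epsilon> / 4)\<close>, the second term being a bound for
    \<open>\<kappa> w\<close> times the height. The neighbourhoods \<open>E\<close> are cut out by
    these two fractions.\<close>
  have near: "c w \<notin> S" if "\<And>y. y \<in> J ` S \<Longrightarrow> \<epsilon> \<le> dist w0 y" "dist w0 w < \<epsilon> / 2" "w 1 < \<epsilon> / 4" "w \<in> U" "\<kappa> w \<le> 2"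
    for S \<epsilon> w0 w
  proof
    assume "c w \<in> S"
    then have "\<epsilon> \<le> dist w0 (J (c w))" using that(1) by blast
    also have "\<dots> \<le> dist w0 w + dist w (J (c w))" by (rule dist_triangle)
    also have "dist w (J (c w)) = \<kappa> w * w 1" using that(4) by (simp add: \<kappa>_def U_def)
    also have "\<dots> \<le> 2 * w 1" using that(4,5) by (intro mult_right_mono) (auto simp: U_def)
    finally show False using that(2,3) by simp
  qed
  have boundary: "\<exists>T. open T \<and> w0 \<in> T \<and> T \<subseteq> Q' \<and> (\<forall>w\<in>T. R w \<in> N)"
    if w0: "w0 \<notin> U" "ev w0 \<in> Q" and N: "openin Z N" "R w0 \<in> N" for w0 N
  proof -
    define QN where "QN = {q \<in> Q. \<rho> q \<in> N}"
    have QN: "open QN"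
      unfolding QN_def using openin_continuous_map_preimage[OF \<rho> N(1)] Q by (simp add: openin_open_eq)
    have w0N: "ev w0 \<in> QN" using N(2) w0 by (simp add: QN_def R_def)
    define E where "E = (\<lambda>V \<epsilon>. {w. ev w \<in> V} \<inter> ball w0 (\<epsilon> / 2) \<inter> {w. w 1 < \<epsilon> / 4})"
    have E: "open (E V \<epsilon>)" if "open V" for V \<epsilon>
      unfolding E_def
    proof (intro open_Int)
      show "open {w. ev w \<in> V}"
        using openin_continuous_map_preimage[OF evc, of V UNIV] that by simp
      show "open {w::nat \<Rightarrow> real. w 1 < \<epsilon> / 4}"
        by (intro open_Collect_less) (auto intro!: continuous_on_product_then_coordinatewise)
    qed simp
    have w0E: "w0 \<in> E V \<epsilon>" if "ev w0 \<in> V" "\<epsilon> > 0" for V \<epsilon>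
      using that w0(1) by (simp add: E_def U_def)
    have far: "w \<in> Q' \<and> R w \<in> N" if "ev w \<in> QN" "w \<notin> U \<or> \<kappa> w > 2" for w
      using that by (auto simp: QN_def Q'_def C_def R_def F_def)
    show ?thesis
    proof (cases "w0 \<in> J ` topspace Z")
      \<comment> \<open>All vectors of positive height near \<open>w0\<close> have
        \<open>\<kappa> w > 2\<close>, so \<open>R\<close> is \<open>\<rho> (ev w)\<close> around
        \<open>w0\<close>.\<close>
      case False
      obtain \<epsilon> where \<epsilon>: "\<epsilon> > 0" "\<And>y. y \<in> J ` topspace Z \<Longrightarrow> \<epsilon> \<le> dist w0 y"
        using closed_point_dist_pos[OF J_closed[OF closedin_topspace] False] by metis
      have "w \<in> Q' \<and> R w \<in> N" if w: "w \<in> E QN \<epsilon>" for w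
      proof (rule far)
        show "w \<notin> U \<or> \<kappa> w > 2"
          using near[OF \<epsilon>(2)] cZ[of w] w by (force simp: E_def)
      qed (use w in \<open>simp add: E_def\<close>)
      then show ?thesis using E[OF QN, of \<epsilon>] w0E[OF w0N \<epsilon>(1)] by blast
    next
      \<comment> \<open>Now \<open>w0 = J \<zeta>\<close> with \<open>\<zeta>\<close> in
        \<open>K\<close>, a point that \<open>P\<close> fixes. A nearby vector of positive height
        with \<open>\<kappa> w \<le> 2\<close> has \<open>c w\<close> close to
        \<open>\<zeta>\<close>; therefore it lies in \<open>B\<close>, and both the push and the
        segment lead into \<open>N\<close>.\<close>
      case True
      then obtain \<zeta> where \<zeta>: "\<zeta> \<in> topspace Z" "w0 = J \<zeta>" by blast
      then have \<zeta>K: "\<zeta> \<in> K" using w0(1) \<eta>0[OF \<zeta>(1)] by (simp add: U_def J1')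
      have ev0: "ev w0 = \<psi> \<zeta>" using \<zeta>(2) ev_J by simp
      have \<zeta>N: "\<zeta> \<in> N" using N(2) RJ \<zeta> by simp
      obtain G where G: "openin (prod_topology Z euclidean) G" "(\<zeta>, \<psi> \<zeta>) \<in> G"
        "\<And>s g. s \<in> {0..1} \<Longrightarrow> g \<in> G \<Longrightarrow> F (s, g) \<in> QN"
      proof (rule unit_interval_tube[OF Fc, of QN "(\<zeta>, \<psi> \<zeta>)"])
        show "F (t, \<zeta>, \<psi> \<zeta>) \<in> QN" for t using w0N by (simp add: F_def PK[OF \<zeta>K] ev0)
      qed (use QN \<zeta> in auto)
      obtain N1 V1 where N1: "openin Z N1" and V1: "openin euclidean V1" and "\<zeta> \<in> N1" "\<psi> \<zeta> \<in> V1" and NV: "N1 \<times> V1 \<subseteq> G"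
        using G(1,2) unfolding openin_prod_topology_alt by metis
      obtain N2 where N2: "openin Z N2" "\<zeta> \<in> N2" "\<And>s z. s \<in> {0..1} \<Longrightarrow> z \<in> N2 \<Longrightarrow> P (s, z) \<in> N"
      proof (rule unit_interval_tube[OF Pc N(1) \<zeta>(1)])
        show "P (t, \<zeta>) \<in> N" for t using \<zeta>N by (simp add: PK[OF \<zeta>K])
      qed auto
      define N3 where "N3 = {z \<in> topspace Z. \<eta> z \<in> {..<1/2}}"
      have N3: "openin Z N3" unfolding N3_def by (rule openin_continuous_map_preimage[OF \<eta>c]) simp
      have \<zeta>3: "\<zeta> \<in> N3" using \<zeta>(1) \<zeta>K \<eta>0(2)[OF \<zeta>(1)] by (simp add: N3_def)
      define N' where "N' = N1 \<inter> N2 \<inter> N3"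
      have N': "openin Z N'" unfolding N'_def by (intro openin_Int N1 N2(1) N3)
      have w0J: "w0 \<notin> J ` (topspace Z - N')"
        using \<zeta> \<open>\<zeta> \<in> N1\<close> N2(2) \<zeta>3 RJ by (auto simp: N'_def) metis+
      have clJ: "closed (J ` (topspace Z - N'))" using N' by (intro J_closed) auto
      obtain \<epsilon> where \<epsilon>: "\<epsilon> > 0" "\<And>y. y \<in> J ` (topspace Z - N') \<Longrightarrow> \<epsilon> \<le> dist w0 y"
        using closed_point_dist_pos[OF clJ w0J] by metis
      have "w \<in> Q' \<and> R w \<in> N" if w: "w \<in> E (V1 \<inter> QN) \<epsilon>" for w
      proof (cases "w \<notin> U \<or> \<kappa> w > 2")
        case True
        then show ?thesis using far w by (simp add: E_def)
      next
        case False
        then have wU: "w \<in> U" "\<kappa> w \<le> 2" by auto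
        then have cN: "c w \<in> N'"
          using near[OF \<epsilon>(2)] cZ[of w] w by (simp add: E_def) blast
        have "(c w, ev w) \<in> G" using cN NV w by (auto simp: N'_def E_def)
        then have FQ: "F (s, c w, ev w) \<in> QN" if "s \<in> {0..1}" for s using G(3) that by blast
        have "w \<in> B" using wU cN FQ by (auto simp: B_def N'_def N3_def QN_def)
        moreover have "R w \<in> N"
        proof (cases "\<kappa> w \<le> 1")
          case True
          then show ?thesis using N2(3)[of "min 1 (\<kappa> w)" "c w"] cN \<kappa>0[OF wU(1)] wU(1) by (simp add: R_def N'_def)
        next
          case False
          then show ?thesis using FQ[of "min 1 (max 0 (\<kappa> w - 1))"] wU(1) by (simp add: R_def QN_def)
        qed
        ultimately show ?thesis by (simp add: Q'_def)
      qed
      moreover have "open (E (V1 \<inter> QN) \<epsilon>)" using V1 QN by (intro E open_Int) auto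
      moreover have "w0 \<in> E (V1 \<inter> QN) \<epsilon>" using w0E[of "V1 \<inter> QN" \<epsilon>] \<open>\<psi> \<zeta> \<in> V1\<close> w0N \<epsilon>(1) ev0 by simp
      ultimately show ?thesis by blast
    qed
  qed
  \<comment> \<open>With \<open>N\<close> the whole space this gives openness of \<open>Q'\<close>,
    with arbitrary \<open>N\<close> continuity of \<open>R\<close>.\<close>
  have all: "\<exists>T. open T \<and> w \<in> T \<and> T \<subseteq> Q' \<and> (\<forall>w\<in>T. R w \<in> N)" if "w \<in> Q'" "openin Z N" "R w \<in> N" for w N
  proof -
    consider "w \<in> A" | "w \<in> B" | "w \<in> C" | "w \<notin> U" "ev w \<in> Q" using \<open>w \<in> Q'\<close> by (auto simp: Q'_def)
    then show ?thesis
    proof cases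
      case 1 then show ?thesis by (intro around[OF A _ RA] that) (auto simp: Q'_def)
    next
      case 2 then show ?thesis by (intro around[OF B _ RB] that) (auto simp: Q'_def)
    next
      case 3 then show ?thesis by (intro around[OF C _ RC] that) (auto simp: Q'_def)
    next
      case 4 then show ?thesis by (intro boundary that)
    qed
  qed
  have RZ: "R w \<in> topspace Z" if "w \<in> Q'" for w
  proof -
    have "w \<in> A \<or> w \<in> B \<or> w \<in> C \<or> (w \<notin> U \<and> ev w \<in> Q)" using that by (auto simp: Q'_def)
    moreover have "R w \<in> topspace Z" if "continuous_map (top_of_set S) Z R" "w \<in> S" for S
      using continuous_map_image_subset_topspace[OF that(1)] that(2) by auto
    moreover have "R w \<in> topspace Z" if "w \<notin> U" "ev w \<in> Q"
      using \<rho>_in_K[OF that(2)] KZ that(1) by (auto simp: R_def)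
    ultimately show ?thesis using RA RB RC by blast
  qed
  have "open Q'"
    using all[OF _ openin_topspace RZ] by (subst open_subopen) blast
  moreover have "continuous_map (top_of_set Q') Z R"
    unfolding continuous_map
  proof (intro conjI allI impI)
    show "R ` topspace (top_of_set Q') \<subseteq> topspace Z" using RZ by auto
    fix N assume N: "openin Z N"
    have "open {w \<in> Q'. R w \<in> N}"
    proof (subst open_subopen, intro ballI)
      fix w assume "w \<in> {w \<in> Q'. R w \<in> N}"
      then obtain T where "open T" "w \<in> T" "T \<subseteq> Q'" "\<forall>w\<in>T. R w \<in> N" using all[OF _ N, of w] by auto
      then show "\<exists>T. open T \<and> w \<in> T \<and> T \<subseteq> {w \<in> Q'. R w \<in> N}" by (intro exI[of _ T]) auto
    qed
    then show "openin (top_of_set Q') {x \<in> topspace (top_of_set Q'). R x \<in> N}"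
      by (auto intro: open_subset)
  qed
  ultimately have "neighbourhood_retract Z J Q' R"
    unfolding neighbourhood_retract_def using Jc JQ' RJ by auto
  then show ?thesis by blast
qed

section \<open>Subcomplexes of CW complexes\<close>

text \<open>The NDR data are the height \<open>1 - disc_norm n x\<close> and the clipped radial
  expansion: doubling the radius takes points of norm at least \<open>1/2\<close> to the
  sphere.\<close>

lemma disc_cylinder_retraction: "\<exists>r. cylinder_retraction (disc n) (boundary_sphere n) r"
proof -
  let ?ID = "cylinder (disc n)"
  let ?v = "\<lambda>x. 1 - disc_norm n x"
  let ?D = "\<lambda>z::real \<times> (nat \<Rightarrow> real). disc_clip n (\<lambda>i. (1 + fst z) * snd z i)"
  have v: "continuous_map (disc n) euclideanreal ?v"
    by (intro continuous_map_real_intros continuous_map_disc_norm continuous_map_disc_coordinate)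
  have D: "continuous_map ?ID (disc n) ?D"
    by (intro continuous_map_disc_clip continuous_map_real_intros continuous_map_cylinder_fst
        continuous_map_compose[OF continuous_map_snd continuous_map_disc_coordinate, unfolded o_def])
  have "cylinder_retraction (disc n) (boundary_sphere n)
     (\<lambda>(t, x). (max 0 (t - 2 * ?v x), ?D (min 1 (t / (2 * ?v x)), x)))"
  proof (rule NDR_cylinder_retraction[OF v _ D])
    show "?v x \<ge> 0" if "x \<in> topspace (disc n)" for x using that by (simp add: topspace_disc)
    show "?D (0, x) = x" if "x \<in> topspace (disc n)" for x using that by (simp add: disc_clip_eq)
    show "?D (1, x) \<in> boundary_sphere n" if "x \<in> topspace (disc n)" "?v x \<le> 1/2" for x
      using that by (intro disc_clip_boundary) (simp add: disc_norm_scale)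
    show "boundary_sphere n = {x \<in> topspace (disc n). ?v x = 0}"
      by (auto simp: boundary_sphere_eq topspace_disc)
    show "?D (t, x) = x" if "t \<in> {0..1}" "x \<in> boundary_sphere n" for t x
      using that by (simp add: disc_clip_sphere)
  qed
  then show ?thesis by blast
qed

lemma closedin_boundary_sphere: "closedin (disc n) (boundary_sphere n)"
proof -
  have "closedin (disc n) {x \<in> topspace (disc n). disc_norm n x \<in> {1}}"
    by (rule closedin_continuous_map_preimage[OF continuous_map_disc_norm[OF continuous_map_disc_coordinate]]) simp
  also have "{x \<in> topspace (disc n). disc_norm n x \<in> {1}} = boundary_sphere n"
    by (auto simp: boundary_sphere_eq topspace_disc)
  finally show ?thesis .
qed

section \<open>Cell complexes with chosen characteristic maps\<close>

locale cell_complex =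
  fixes Y :: "'a topology" and \<E> :: "'a set set" and d :: "'a set \<Rightarrow> nat"
    and \<Phi> :: "'a set \<Rightarrow> (nat \<Rightarrow> real) \<Rightarrow> 'a"
  assumes Hausdorff: "Hausdorff_space Y"
    and disjoint_cells: "disjoint \<E>" and Union_cells: "\<Union>\<E> = topspace Y"
    and char_cont: "\<And>e. e \<in> \<E> \<Longrightarrow> continuous_map (disc (d e)) Y (\<Phi> e)"
    and char_inj: "\<And>e. e \<in> \<E> \<Longrightarrow> inj_on (\<Phi> e) (open_disc (d e))"
    and char_image: "\<And>e. e \<in> \<E> \<Longrightarrow> \<Phi> e ` open_disc (d e) = e"
    and char_boundary: "\<And>e. e \<in> \<E> \<Longrightarrow> \<Phi> e ` boundary_sphere (d e) \<subseteq> \<Union>{c \<in> \<E>. d c < d e}"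
    and closure_finite: "\<And>e. e \<in> \<E> \<Longrightarrow> finite {c \<in> \<E>. c \<inter> Y closure_of e \<noteq> {}}"
    and weak_topology: "\<And>A. A \<subseteq> topspace Y \<Longrightarrow> (\<And>e. e \<in> \<E> \<Longrightarrow> closedin Y (A \<inter> Y closure_of e)) \<Longrightarrow> closedin Y A"

lemma cw_structure_cell_complex:
  assumes "cw_structure Y \<E> d"
  obtains \<Phi> where "cell_complex Y \<E> d \<Phi>"
proof -
  have "\<forall>e\<in>\<E>. \<exists>\<Phi>. continuous_map (disc (d e)) Y \<Phi> \<and> inj_on \<Phi> (open_disc (d e)) \<and>
      \<Phi> ` open_disc (d e) = e \<and> \<Phi> ` boundary_sphere (d e) \<subseteq> \<Union>{c \<in> \<E>. d c < d e}"
  proof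
    fix e assume e: "e \<in> \<E>"
    then have eY: "e \<subseteq> topspace Y" using assms by (auto simp: cw_structure_def)
    obtain \<Phi> where \<Phi>: "continuous_map (disc (d e)) Y \<Phi>"
      "homeomorphic_map (subtopology (disc (d e)) (open_disc (d e))) (subtopology Y e) \<Phi>"
      "\<Phi> ` boundary_sphere (d e) \<subseteq> \<Union>{c \<in> \<E>. d c < d e}"
      using assms e unfolding cw_structure_def by blast
    have "topspace (subtopology (disc (d e)) (open_disc (d e))) = open_disc (d e)"
      by (auto simp: open_disc_def)
    with homeomorphic_imp_injective_map[OF \<Phi>(2)] homeomorphic_imp_surjective_map[OF \<Phi>(2)] eY
    have "inj_on \<Phi> (open_disc (d e))" "\<Phi> ` open_disc (d e) = e"
      by (auto simp: Int_absorb1)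
    with \<Phi>(1,3) show "\<exists>\<Phi>. continuous_map (disc (d e)) Y \<Phi> \<and> inj_on \<Phi> (open_disc (d e)) \<and>
      \<Phi> ` open_disc (d e) = e \<and> \<Phi> ` boundary_sphere (d e) \<subseteq> \<Union>{c \<in> \<E>. d c < d e}" by blast
  qed
  from bchoice[OF this] obtain \<Phi> where \<Phi>: "\<forall>e\<in>\<E>. continuous_map (disc (d e)) Y (\<Phi> e) \<and> inj_on (\<Phi> e) (open_disc (d e)) \<and>
      \<Phi> e ` open_disc (d e) = e \<and> \<Phi> e ` boundary_sphere (d e) \<subseteq> \<Union>{c \<in> \<E>. d c < d e}" by blast
  have "cell_complex Y \<E> d \<Phi>"
    by unfold_locales (use assms \<Phi> in \<open>auto simp: cw_structure_def\<close>)
  then show thesis by (rule that)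
qed

context cell_complex
begin

definition closed_cell :: "'a set \<Rightarrow> 'a set" where
  "closed_cell e = \<Phi> e ` topspace (disc (d e))"

definition cell_boundary :: "'a set \<Rightarrow> 'a set" where
  "cell_boundary e = \<Phi> e ` boundary_sphere (d e)"

definition subcomplex :: "'a set set \<Rightarrow> bool" where
  "subcomplex \<F> \<longleftrightarrow> \<F> \<subseteq> \<E> \<and> (\<forall>e\<in>\<F>. closed_cell e \<subseteq> \<Union>\<F>)"

lemma closed_cell_eq: "e \<in> \<E> \<Longrightarrow> closed_cell e = e \<union> cell_boundary e"
  by (simp add: closed_cell_def cell_boundary_def topspace_disc_Un image_Un char_image)

lemma cell_unique: "c \<in> \<E> \<Longrightarrow> e \<in> \<E> \<Longrightarrow> y \<in> c \<Longrightarrow> y \<in> e \<Longrightarrow> c = e"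
  using disjoint_cells by (auto simp: disjoint_def)

lemma cell_boundary_lower: "e \<in> \<E> \<Longrightarrow> c \<in> \<E> \<Longrightarrow> y \<in> cell_boundary e \<Longrightarrow> y \<in> c \<Longrightarrow> d c < d e"
  using char_boundary[of e] cell_unique unfolding cell_boundary_def by blast

lemma compactin_closed_cell: "e \<in> \<E> \<Longrightarrow> compactin Y (closed_cell e)"
  unfolding closed_cell_def using compact_space_disc char_cont
  by (intro image_compactin) (auto simp: compact_space_def)

lemma closedin_closed_cell: "e \<in> \<E> \<Longrightarrow> closedin Y (closed_cell e)"
  by (rule compactin_imp_closedin[OF Hausdorff compactin_closed_cell])

lemma compactin_cell_boundary: "e \<in> \<E> \<Longrightarrow> compactin Y (cell_boundary e)"
  unfolding cell_boundary_def
  using closedin_compact_space[OF compact_space_disc closedin_boundary_sphere] char_cont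
  by (intro image_compactin) auto

lemma closure_of_subset_closed_cell: "e \<in> \<E> \<Longrightarrow> Y closure_of e \<subseteq> closed_cell e"
  by (intro closure_of_minimal closedin_closed_cell) (simp add: closed_cell_eq)

text \<open>The weak topology is stated for closures of cells. A closed cell is closed and contains
  the closure, so intersecting with the closure passes from one test to the other.\<close>

lemma closedin_if_closed_cells:
  assumes "A \<subseteq> topspace Y" "\<And>e. e \<in> \<E> \<Longrightarrow> closedin Y (A \<inter> closed_cell e)"
  shows "closedin Y A"
proof (rule weak_topology[OF assms(1)])
  fix e assume e: "e \<in> \<E>"
  have "A \<inter> Y closure_of e = (A \<inter> closed_cell e) \<inter> Y closure_of e"
    using closure_of_subset_closed_cell[OF e] by blast
  then show "closedin Y (A \<inter> Y closure_of e)" using assms(2)[OF e] by (simp add: closedin_Int)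
qed

text \<open>One point of \<open>K\<close> is chosen in each cell that meets \<open>K\<close>. By
  closure finiteness any set of such points meets the closure of a cell in a finite set, so it is
  closed in the weak topology. Infinitely many of them would have a limit point in \<open>K\<close>,
  and this contradicts the closedness of all subsets.\<close>

lemma compactin_meets_finite:
  assumes K: "compactin Y K"
  shows "finite {c \<in> \<E>. c \<inter> K \<noteq> {}}"
proof (rule ccontr)
  assume inf: "infinite {c \<in> \<E>. c \<inter> K \<noteq> {}}"
  have "\<forall>c\<in>{c \<in> \<E>. c \<inter> K \<noteq> {}}. \<exists>y. y \<in> c \<inter> K" by blast
  from bchoice[OF this] obtain s where s: "\<And>c. c \<in> \<E> \<Longrightarrow> c \<inter> K \<noteq> {} \<Longrightarrow> s c \<in> c \<inter> K" by blast
  define S where "S = s ` {c \<in> \<E>. c \<inter> K \<noteq> {}}"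
  have "inj_on s {c \<in> \<E>. c \<inter> K \<noteq> {}}"
  proof (rule inj_onI)
    fix b c assume "b \<in> {c \<in> \<E>. c \<inter> K \<noteq> {}}" "c \<in> {c \<in> \<E>. c \<inter> K \<noteq> {}}" "s b = s c"
    then show "b = c" using s[of b] s[of c] cell_unique[of b c "s b"] by auto
  qed
  then have "infinite S" using inf by (simp add: S_def finite_image_iff)
  have SK: "S \<subseteq> K" using s by (auto simp: S_def)
  have KY: "K \<subseteq> topspace Y" using K by (rule compactin_subset_topspace)
  have closed: "closedin Y T" if TS: "T \<subseteq> S" for T
  proof (rule weak_topology)
    show "T \<subseteq> topspace Y" using that SK KY by blast
    fix e assume e: "e \<in> \<E>"
    have "T \<inter> Y closure_of e \<subseteq> s ` {c \<in> \<E>. c \<inter> Y closure_of e \<noteq> {}}"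
    proof
      fix y assume y: "y \<in> T \<inter> Y closure_of e"
      then have "y \<in> s ` {c \<in> \<E>. c \<inter> K \<noteq> {}}" using TS by (auto simp: S_def)
      then obtain c where "c \<in> \<E>" "c \<inter> K \<noteq> {}" "y = s c" by blast
      then show "y \<in> s ` {c \<in> \<E>. c \<inter> Y closure_of e \<noteq> {}}" using y s[of c] by blast
    qed
    then have "finite (T \<inter> Y closure_of e)"
      using closure_finite[OF e] by (meson finite_imageI finite_subset)
    then show "closedin Y (T \<inter> Y closure_of e)"
      using \<open>T \<subseteq> topspace Y\<close> by (intro closedin_Hausdorff_finite[OF Hausdorff]) auto
  qed
  have "K \<inter> Y derived_set_of S \<noteq> {}"
    by (rule compactin_imp_Bolzano_Weierstrass[OF K conjI[OF \<open>infinite S\<close> SK]])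
  then obtain x where x: "x \<in> topspace Y" "x \<in> Y derived_set_of S" using KY by blast
  have "openin Y (topspace Y - (S - {x}))" using closed[of "S - {x}"] by blast
  then have "\<exists>y. y \<noteq> x \<and> y \<in> S \<and> y \<in> topspace Y - (S - {x})"
    using x unfolding in_derived_set_of by (metis DiffI Diff_iff singletonI)
  then show False by blast
qed

lemma boundary_cells:
  assumes e: "e \<in> \<E>"
  defines "S \<equiv> {c \<in> \<E>. c \<inter> cell_boundary e \<noteq> {}}"
  shows "finite S" "\<And>c. c \<in> S \<Longrightarrow> d c < d e" "cell_boundary e \<subseteq> \<Union>S"
proof -
  show "finite S" unfolding S_def by (rule compactin_meets_finite[OF compactin_cell_boundary[OF e]])
  show "d c < d e" if "c \<in> S" for c using that cell_boundary_lower[OF e] by (auto simp: S_def)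
  have "cell_boundary e \<subseteq> topspace Y" by (rule compactin_subset_topspace[OF compactin_cell_boundary[OF e]])
  then show "cell_boundary e \<subseteq> \<Union>S" unfolding S_def using Union_cells[symmetric] by blast
qed

text \<open>The boundary of a cell is compact, so it meets only finitely many cells, all of lower
  dimension; by induction these lie in finite subcomplexes.\<close>

lemma finite_subcomplex_cell:
  assumes "e \<in> \<E>"
  shows "\<exists>\<F>. finite \<F> \<and> subcomplex \<F> \<and> e \<in> \<F>"
  using assms
proof (induction "d e" arbitrary: e rule: less_induct)
  case less
  let ?S = "{c \<in> \<E>. c \<inter> cell_boundary e \<noteq> {}}"
  have "\<forall>c\<in>?S. \<exists>\<F>. finite \<F> \<and> subcomplex \<F> \<and> c \<in> \<F>"
    using less.hyps boundary_cells(2)[OF less.prems] by blast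
  from bchoice[OF this] obtain F where F: "\<And>c. c \<in> ?S \<Longrightarrow> finite (F c) \<and> subcomplex (F c) \<and> c \<in> F c" by blast
  have "finite (insert e (\<Union>c\<in>?S. F c))" using F boundary_cells(1)[OF less.prems] by auto
  moreover have "subcomplex (insert e (\<Union>c\<in>?S. F c))"
    unfolding subcomplex_def
  proof (intro conjI ballI)
    show "insert e (\<Union>c\<in>?S. F c) \<subseteq> \<E>" using less.prems F unfolding subcomplex_def by blast
    fix b assume "b \<in> insert e (\<Union>c\<in>?S. F c)"
    then consider "b = e" | c where "c \<in> ?S" "b \<in> F c" by blast
    then show "closed_cell b \<subseteq> \<Union>(insert e (\<Union>c\<in>?S. F c))"
    proof cases
      case 1
      have "?S \<subseteq> (\<Union>c\<in>?S. F c)" using F by blast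
      then have "\<Union>?S \<subseteq> \<Union>(\<Union>c\<in>?S. F c)" by (rule Union_mono)
      with boundary_cells(3)[OF less.prems] have "cell_boundary e \<subseteq> \<Union>(\<Union>c\<in>?S. F c)" by (rule order_trans)
      then show ?thesis unfolding 1 closed_cell_eq[OF less.prems] by (simp add: le_supI2)
    next
      case 2
      then have "closed_cell b \<subseteq> \<Union>(F c)" using F[OF 2(1)] by (simp add: subcomplex_def)
      also have "\<dots> \<subseteq> \<Union>(insert e (\<Union>c\<in>?S. F c))"
        using UN_upper[OF 2(1), of F] by (intro Union_mono) (rule subset_insertI2)
      finally show ?thesis .
    qed
  qed
  ultimately show ?case by blast
qed

lemma finite_subcomplex_compactin:
  assumes K: "compactin Y K"
  obtains \<F> where "finite \<F>" "subcomplex \<F>" "K \<subseteq> \<Union>\<F>"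
proof -
  let ?S = "{c \<in> \<E>. c \<inter> K \<noteq> {}}"
  have "\<forall>c\<in>?S. \<exists>\<F>. finite \<F> \<and> subcomplex \<F> \<and> c \<in> \<F>" using finite_subcomplex_cell by blast
  from bchoice[OF this] obtain F where F: "\<And>c. c \<in> ?S \<Longrightarrow> finite (F c) \<and> subcomplex (F c) \<and> c \<in> F c" by blast
  have "finite (\<Union>c\<in>?S. F c)" using F compactin_meets_finite[OF K] by auto
  moreover have "subcomplex (\<Union>c\<in>?S. F c)"
    unfolding subcomplex_def
  proof (intro conjI ballI)
    show "(\<Union>c\<in>?S. F c) \<subseteq> \<E>" using F by (intro UN_least) (simp add: subcomplex_def)
    fix b assume "b \<in> (\<Union>c\<in>?S. F c)"
    then obtain c where c: "c \<in> ?S" "b \<in> F c" by blast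
    then have "closed_cell b \<subseteq> \<Union>(F c)" using F[OF c(1)] by (simp add: subcomplex_def)
    also have "\<dots> \<subseteq> \<Union>(\<Union>c\<in>?S. F c)" using UN_upper[OF c(1), of F] by (rule Union_mono)
    finally show "closed_cell b \<subseteq> \<Union>(\<Union>c\<in>?S. F c)" .
  qed
  moreover have "K \<subseteq> \<Union>(\<Union>c\<in>?S. F c)"
  proof
    fix y assume y: "y \<in> K"
    then have "y \<in> \<Union>\<E>" using compactin_subset_topspace[OF K] Union_cells by blast
    then obtain c where "c \<in> \<E>" "y \<in> c" by blast
    with y F[of c] show "y \<in> \<Union>(\<Union>c\<in>?S. F c)" by blast
  qed
  ultimately show thesis by (rule that)
qed

lemma subcomplex_Union:
  assumes "subcomplex \<F>"
  shows "\<Union>\<F> = (\<Union>e\<in>\<F>. closed_cell e)"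
  using assms closed_cell_eq unfolding subcomplex_def by blast

lemma finite_subcomplex_compact:
  assumes "subcomplex \<F>" "finite \<F>"
  shows "compactin Y (\<Union>\<F>)" "closedin Y (\<Union>\<F>)"
proof -
  have "\<F> \<subseteq> \<E>" using assms(1) by (simp add: subcomplex_def)
  then show "compactin Y (\<Union>\<F>)"
    unfolding subcomplex_Union[OF assms(1)]
    using assms(2) compactin_closed_cell by (intro compactin_Union) auto
  then show "closedin Y (\<Union>\<F>)" by (rule compactin_imp_closedin[OF Hausdorff])
qed

text \<open>Each step removes a cell of top dimension. It meets the boundary of no other cell of the
  subcomplex, so the rest is again a subcomplex, to which this cell is attached.\<close>

lemma neighbourhood_retract_subcomplex:
  assumes "finite \<F>" "subcomplex \<F>"
  shows "\<exists>\<iota> Q \<rho>. neighbourhood_retract (subtopology Y (\<Union>\<F>)) \<iota> Q \<rho>"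
  using assms
proof (induction "card \<F>" arbitrary: \<F>)
  case 0
  then have "\<F> = {}" by simp
  then have "neighbourhood_retract (subtopology Y (\<Union>\<F>)) (\<lambda>_ _. 0) {} (\<lambda>_. undefined)"
    by (simp add: neighbourhood_retract_def)
  then show ?case by blast
next
  case (Suc n)
  then have "\<F> \<noteq> {}" by auto
  have \<F>: "\<F> \<subseteq> \<E>" using Suc.prems by (simp add: subcomplex_def)
  obtain e where e: "e \<in> \<F>" "\<And>c. c \<in> \<F> \<Longrightarrow> d c \<le> d e"
    using Max_in[of "d ` \<F>"] Max_ge[of "d ` \<F>"] \<open>\<F> \<noteq> {}\<close> Suc.prems(1)
    by (metis (no_types, lifting) finite_imageI image_iff image_is_empty)
  then have eE: "e \<in> \<E>" using \<F> by blast
  let ?F = "\<F> - {e}"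
  have below: "closed_cell c \<subseteq> \<Union>?F" if "c \<in> ?F" for c
  proof
    fix y assume y: "y \<in> closed_cell c"
    have c: "c \<in> \<E>" "c \<in> \<F>" "c \<noteq> e" using that \<F> by auto
    obtain b where b: "b \<in> \<F>" "y \<in> b" using y c Suc.prems(2) unfolding subcomplex_def by blast
    have "b \<noteq> e"
    proof
      assume "b = e"
      then have "y \<notin> c" using b c eE cell_unique[of c e y] by blast
      then have "y \<in> cell_boundary c" using y closed_cell_eq[OF c(1)] by blast
      then have "d e < d c" using cell_boundary_lower[OF c(1) eE] b \<open>b = e\<close> by blast
      with e(2)[OF c(2)] show False by simp
    qed
    with b show "y \<in> \<Union>?F" by blast
  qed
  then have F: "subcomplex ?F" using \<F> by (auto simp: subcomplex_def)
  have "n = card ?F" using Suc.hyps(2) e(1) Suc.prems(1) by simp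
  from Suc.hyps(1)[OF this _ F] Suc.prems(1) obtain \<iota> Q \<rho>
    where nr: "neighbourhood_retract (subtopology Y (\<Union>?F)) \<iota> Q \<rho>" by auto
  let ?Z = "subtopology Y (\<Union>\<F>)"
  have topZ: "topspace ?Z = \<Union>\<F>" using \<F> Union_cells by auto
  have clF: "closed_cell e \<subseteq> \<Union>\<F>" using e(1) Suc.prems(2) by (simp add: subcomplex_def)
  show ?case
  proof (rule neighbourhood_retract_attach_cell)
    show "compact_space ?Z"
      using finite_subcomplex_compact(1)[OF Suc.prems(2,1)] by (rule compact_space_subtopology)
    show "Hausdorff_space ?Z" using Hausdorff by (rule Hausdorff_space_subtopology)
    show "closedin ?Z (\<Union>?F)"
      using finite_subcomplex_compact(2)[OF F] Suc.prems(1) by (intro closedin_subset_topspace) auto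
    have "\<Union>\<F> \<inter> \<Union>?F = \<Union>?F" by blast
    with nr show "neighbourhood_retract (subtopology ?Z (\<Union>?F)) \<iota> Q \<rho>" by (simp add: subtopology_subtopology)
    show "continuous_map (disc (d e)) ?Z (\<Phi> e)"
      using char_cont[OF eE] clF by (auto simp: continuous_map_in_subtopology closed_cell_def)
    show "inj_on (\<Phi> e) (open_disc (d e))" by (rule char_inj[OF eE])
    have "y \<notin> c" if "c \<in> ?F" "y \<in> e" for c y using that \<F> eE cell_unique[of c e y] by blast
    then show "\<Phi> e ` open_disc (d e) = topspace ?Z - \<Union>?F"
      unfolding topZ char_image[OF eE] using e(1) by blast
    show "\<Phi> e ` boundary_sphere (d e) \<subseteq> \<Union>?F"
    proof
      fix y assume "y \<in> \<Phi> e ` boundary_sphere (d e)"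
      then have y: "y \<in> cell_boundary e" by (simp add: cell_boundary_def)
      then obtain b where b: "b \<in> \<F>" "y \<in> b" using clF closed_cell_eq[OF eE] by blast
      have "b \<noteq> e" using cell_boundary_lower[OF eE eE y] b by auto
      with b show "y \<in> \<Union>?F" by blast
    qed
  qed
qed

lemma continuous_map_if_cells:
  assumes "\<And>e. e \<in> \<E> \<Longrightarrow> continuous_map (subtopology Y (closed_cell e)) T h"
  shows "continuous_map Y T h"
  unfolding continuous_map_closedin
proof (intro conjI allI impI)
  show "h \<in> topspace Y \<rightarrow> topspace T"
  proof
    fix y assume y: "y \<in> topspace Y"
    then obtain e where e: "e \<in> \<E>" "y \<in> e" using Union_cells by blast
    then have "y \<in> topspace (subtopology Y (closed_cell e))" using y closed_cell_eq[OF e(1)] by auto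
    then show "h y \<in> topspace T" using assms[OF e(1)] by (auto simp: continuous_map_def)
  qed
  fix C assume C: "closedin T C"
  show "closedin Y {y \<in> topspace Y. h y \<in> C}"
  proof (rule closedin_if_closed_cells)
    fix e assume e: "e \<in> \<E>"
    have "closedin (subtopology Y (closed_cell e)) {y \<in> topspace (subtopology Y (closed_cell e)). h y \<in> C}"
      by (rule closedin_continuous_map_preimage[OF assms[OF e] C])
    then have "closedin Y {y \<in> topspace (subtopology Y (closed_cell e)). h y \<in> C}"
      using closedin_closed_cell[OF e] closedin_trans_full by blast
    moreover have "{y \<in> topspace (subtopology Y (closed_cell e)). h y \<in> C} = {y \<in> topspace Y. h y \<in> C} \<inter> closed_cell e"
      by auto
    ultimately show "closedin Y ({y \<in> topspace Y. h y \<in> C} \<inter> closed_cell e)" by simp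
  qed simp
qed

text \<open>Currying reduces a homotopy to a map into a path space, so that only the weak topology of
  \<open>Y\<close> itself is needed, not that of the product.\<close>

lemma continuous_map_cylinder_if_cells:
  assumes "\<And>e. e \<in> \<E> \<Longrightarrow> continuous_map (cylinder (subtopology Y (closed_cell e))) T h"
  shows "continuous_map (cylinder Y) T h"
proof -
  let ?c = "\<lambda>y. restrict (\<lambda>t. h (t, y)) {0..1}"
  have "continuous_map Y (mapping_space unit_interval T) ?c"
    by (intro continuous_map_if_cells continuous_map_curry_path assms)
  from continuous_map_compose2[OF continuous_map_path_evaluation continuous_map_fst
      continuous_map_compose[OF continuous_map_snd this, unfolded o_def]]
  show ?thesis by (rule continuous_map_eq) auto
qed

lemma continuous_map_cylinder_finite_cells:
  assumes "finite S" "S \<subseteq> \<E>"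
    "\<And>e. e \<in> S \<Longrightarrow> continuous_map (cylinder (subtopology Y (closed_cell e))) T h"
  shows "continuous_map (cylinder (subtopology Y (\<Union>e\<in>S. closed_cell e))) T h"
    (is "continuous_map ?P T h")
proof (rule pasting_lemma_closed[where I=S and T="\<lambda>e. {0..1} \<times> closed_cell e" and f="\<lambda>_. h"])
  fix e assume e: "e \<in> S"
  have sub: "(\<Union>e\<in>S. closed_cell e) \<inter> closed_cell e = closed_cell e" using e by blast
  have "closedin (subtopology Y (\<Union>e\<in>S. closed_cell e)) (closed_cell e)"
    using e assms(2) closedin_closed_cell by (intro closedin_subset_topspace) auto
  then show "closedin ?P ({0..1} \<times> closed_cell e)" by (simp add: closedin_prod_Times_iff)
  have "subtopology ?P ({0..1} \<times> closed_cell e) = cylinder (subtopology Y (closed_cell e))"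
    by (simp only: subtopology_cylinder subtopology_subtopology sub)
  with assms(3)[OF e] show "continuous_map (subtopology ?P ({0..1} \<times> closed_cell e)) T h" by simp
qed (use assms in auto)

text \<open>Over a cell outside \<open>\<F>\<close> the cylinder is retracted to its bottom and the
  cylinder over the boundary, where cells of lower dimension take over. The recursion descends in
  dimension for each point separately, so cells of all dimensions are treated at once. Continuity is
  proved on the cylinders over closed cells, by induction on the dimension, and passes to
  \<open>Y\<close> by the weak topology.\<close>

lemma subcomplex_cylinder_retraction:
  assumes \<F>: "subcomplex \<F>"
  shows "\<exists>r. cylinder_retraction Y (\<Union>\<F>) r"
proof -
  have FE: "\<F> \<subseteq> \<E>" using \<F> by (simp add: subcomplex_def)
  obtain ret where ret: "\<And>n. cylinder_retraction (disc n) (boundary_sphere n) (ret n)"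
    using disc_cylinder_retraction by metis
  note retD = cylinder_retractionD[OF ret]
  define cell where "cell = (\<lambda>y. THE e. e \<in> \<E> \<and> y \<in> e)"
  have cell_eq: "cell y = e" if "e \<in> \<E>" "y \<in> e" for e y
    unfolding cell_def using that cell_unique by (intro the_equality) auto
  have cell: "cell y \<in> \<E>" "y \<in> cell y" if y: "y \<in> topspace Y" for y
  proof -
    obtain e where e: "e \<in> \<E>" "y \<in> e" using y unfolding Union_cells[symmetric] by blast
    have "cell y = e" using e by (rule cell_eq)
    with e show "cell y \<in> \<E>" "y \<in> cell y" by simp_all
  qed
  define \<theta> where "\<theta> = (\<lambda>y. inv_into (open_disc (d (cell y))) (\<Phi> (cell y)) y)"
  have \<theta>: "\<theta> y \<in> open_disc (d (cell y))" "\<Phi> (cell y) (\<theta> y) = y" if "y \<in> topspace Y" for y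
    using cell[OF that] char_image[of "cell y"] inv_into_into[of y "\<Phi> (cell y)" "open_disc (d (cell y))"]
      f_inv_into_f[of y "\<Phi> (cell y)" "open_disc (d (cell y))"] by (simp_all add: \<theta>_def)
  have \<theta>D: "\<theta> y \<in> topspace (disc (d (cell y)))" if "y \<in> topspace Y" for y
    using \<theta>[OF that] by (simp add: topspace_disc_Un)
  have open_cell: "cell (\<Phi> e x) = e" "\<theta> (\<Phi> e x) = x" if "e \<in> \<E>" "x \<in> open_disc (d e)" for e x
  proof -
    show c: "cell (\<Phi> e x) = e" using that char_image[of e] by (intro cell_eq) auto
    show "\<theta> (\<Phi> e x) = x" unfolding \<theta>_def c using that char_inj by (simp add: inv_into_f_f)
  qed
  have \<Phi>Y: "\<Phi> e x \<in> topspace Y" if "e \<in> \<E>" "x \<in> topspace (disc (d e))" for e x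
    using char_cont[OF that(1)] that(2) by (auto simp: continuous_map_def)
  define q where "q = (\<lambda>z. ret (d (cell (snd z))) (fst z, \<theta> (snd z)))"
  define q' where "q' = (\<lambda>z. (fst (q z), \<Phi> (cell (snd z)) (snd (q z))))"
  define step where "step = (\<lambda>g z. if cell (snd z) \<in> \<F> then z else if fst (q z) = 0 then q' z else g (q' z))"
  \<comment> \<open>Each further step happens in a cell of lower dimension, and over a cell of
    dimension 0, whose boundary sphere is empty, the first step ends on the bottom. So one step more
    than the dimension completes the recursion.\<close>
  define r where "r = (\<lambda>z. (step ^^ Suc (d (cell (snd z)))) id z)"
  have q'1: "fst (q' (t, y)) \<in> {0..1}" "snd (q' (t, y)) \<in> topspace Y" if "t \<in> {0..1}" "y \<in> topspace Y" for t y
    using retD(2,3)[OF that(1) \<theta>D[OF that(2)]] \<Phi>Y[OF cell(1)[OF that(2)]] by (simp_all add: q'_def q_def)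
  have q'2: "d (cell (snd (q' (t, y)))) < d (cell y)"
    if "t \<in> {0..1}" "y \<in> topspace Y" "fst (q (t, y)) \<noteq> 0" for t y
  proof -
    have "snd (q (t, y)) \<in> boundary_sphere (d (cell y))"
      using retD(4)[OF that(1) \<theta>D[OF that(2)]] that(3) by (simp add: q_def)
    then have "snd (q' (t, y)) \<in> cell_boundary (cell y)" by (simp add: q'_def cell_boundary_def)
    then show ?thesis
      using cell_boundary_lower[OF cell(1)[OF that(2)]] cell[OF q'1(2)[OF that(1,2)]] by blast
  qed
  have stable: "(step ^^ n) id (t, y) = r (t, y)" if "y \<in> topspace Y" "t \<in> {0..1}" "d (cell y) < n" for n t y
    using that
  proof (induction "d (cell y)" arbitrary: y t n rule: less_induct)
    case less
    then obtain m where m: "n = Suc m" "d (cell y) \<le> m" by (cases n) auto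
    have "(step ^^ m) id (q' (t, y)) = (step ^^ d (cell y)) id (q' (t, y))" if "fst (q (t, y)) \<noteq> 0"
    proof -
      note lower = q'2[OF less.prems(2,1) that] and in_Y = q'1[OF less.prems(2,1)]
      show ?thesis
        using less.hyps[OF lower in_Y(2,1) lower] less.hyps[OF lower in_Y(2,1), of m] lower m(2) by simp
    qed
    then show ?case by (simp add: m(1) r_def step_def)
  qed
  have r_eq: "r (t, y) = step r (t, y)" if "t \<in> {0..1}" "y \<in> topspace Y" for t y
  proof -
    have "r (t, y) = step ((step ^^ d (cell y)) id) (t, y)" by (simp add: r_def)
    also have "\<dots> = step r (t, y)"
      using stable[OF q'1(2,1)[OF that] q'2[OF that]] by (simp add: step_def)
    finally show ?thesis .
  qed
  have rF: "r (t, y) = (t, y)" if t: "t \<in> {0..1}" and y: "y \<in> \<Union>\<F>" for t y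
  proof -
    obtain e where e: "e \<in> \<F>" "y \<in> e" using y by blast
    then have "e \<in> \<E>" using FE by blast
    with e have "y \<in> topspace Y" "cell y \<in> \<F>"
      using cell_eq[OF \<open>e \<in> \<E>\<close> e(2)] unfolding Union_cells[symmetric] by auto
    then show ?thesis using r_eq[OF t] by (simp add: step_def)
  qed
  have r0: "r (0, y) = (0, y)" if "y \<in> topspace Y" for y
    using r_eq[of 0 y] that retD(5)[OF \<theta>D[OF that]] \<theta>(2)[OF that] by (simp add: step_def q'_def q_def)
  have r_or: "fst (r (t, y)) = 0 \<or> snd (r (t, y)) \<in> \<Union>\<F>" if "t \<in> {0..1}" "y \<in> topspace Y" for t y
    using that
  proof (induction "d (cell y)" arbitrary: y t rule: less_induct)
    case less
    show ?case
    proof (cases "cell y \<in> \<F> \<or> fst (q (t, y)) = 0")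
      case True
      then show ?thesis
        using r_eq[OF less.prems] cell(2)[OF less.prems(2)] by (auto simp: step_def q'_def)
    next
      case False
      then have "r (t, y) = r (q' (t, y))" using r_eq[OF less.prems] by (simp add: step_def)
      then show ?thesis
        using less.hyps[OF q'2[OF less.prems] q'1[OF less.prems]] False by simp
    qed
  qed
  \<comment> \<open>For \<open>x\<close> on the boundary sphere, \<open>cell\<close> and
    \<open>\<theta>\<close> refer to a lower cell, but there \<open>ret\<close> is the identity. The
    formula thus holds on the closed disc and expresses \<open>r\<close> on this cell by
    \<open>r\<close> on its boundary.\<close>
  have r\<Phi>: "r (t, \<Phi> e x) = (let p = ret (d e) (t, x) in if fst p = 0 then (0, \<Phi> e (snd p)) else r (fst p, \<Phi> e (snd p)))"
    if "e \<in> \<E>" "e \<notin> \<F>" "t \<in> {0..1}" "x \<in> topspace (disc (d e))" for e t x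
  proof (cases "x \<in> open_disc (d e)")
    case True
    then show ?thesis
      using r_eq[OF that(3) \<Phi>Y[OF that(1,4)]] open_cell[OF that(1) True] that(2)
      by (simp add: step_def q'_def q_def Let_def)
  next
    case False
    then have "ret (d e) (t, x) = (t, x)" using that(3,4) by (intro retD(6)) (auto simp: topspace_disc_Un)
    then show ?thesis using r0[OF \<Phi>Y[OF that(1,4)]] by (simp add: Let_def)
  qed
  let ?IY = "cylinder Y"
  have rc: "continuous_map (cylinder (subtopology Y (closed_cell e))) ?IY r" if "e \<in> \<E>" for e
    using that
  proof (induction "d e" arbitrary: e rule: less_induct)
    case less
    show ?case
    proof (cases "e \<in> \<F>")
      case True
      then have sub: "closed_cell e \<subseteq> \<Union>\<F>" using \<F> by (simp add: subcomplex_def)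
      have "continuous_map (cylinder (subtopology Y (closed_cell e))) ?IY (\<lambda>z. z)"
        unfolding subtopology_cylinder[symmetric] by (rule continuous_map_from_subtopology) simp
      then show ?thesis
      proof (rule continuous_map_eq)
        fix z assume "z \<in> topspace (cylinder (subtopology Y (closed_cell e)))"
        then have z: "fst z \<in> {0..1}" "snd z \<in> closed_cell e" by auto
        show "z = r z" using rF[OF z(1) subsetD[OF sub z(2)]] by simp
      qed
    next
      case False
      let ?n = "d e"
      let ?ID = "cylinder (disc ?n)"
      let ?S = "{c \<in> \<E>. c \<inter> cell_boundary e \<noteq> {}}"
      let ?L = "\<Union>c\<in>?S. closed_cell c"
      let ?p = "\<lambda>z. (fst (ret ?n z), \<Phi> e (snd (ret ?n z)))"
      have rL: "continuous_map (cylinder (subtopology Y ?L)) ?IY r"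
        using boundary_cells[OF less.prems] less.hyps
        by (intro continuous_map_cylinder_finite_cells) auto
      have bdL: "cell_boundary e \<subseteq> ?L"
        using boundary_cells(3)[OF less.prems] closed_cell_eq by blast
      have p1: "continuous_map ?ID euclideanreal (\<lambda>z. fst (ret ?n z))" and p2: "continuous_map ?ID (disc ?n) (\<lambda>z. snd (ret ?n z))"
        using retD(7,8)[of ?n] by (simp_all add: o_def)
      have p1': "continuous_map ?ID unit_interval (\<lambda>z. fst (ret ?n z))"
        unfolding continuous_map_unit_interval_iff using p1 retD(2)[of _ _ ?n] by auto
      have pc: "continuous_map ?ID ?IY ?p"
        using continuous_map_compose[OF p2 char_cont[OF less.prems]]
        by (intro continuous_map_pairedI p1') (simp add: o_def)
      have "continuous_map ?ID ?IY (\<lambda>z. r (fst z, \<Phi> e (snd z)))"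
      proof (rule continuous_map_closed_Un)
        let ?A = "{z \<in> topspace ?ID. fst (ret ?n z) \<in> {0}}"
        let ?B = "{z \<in> topspace ?ID. snd (ret ?n z) \<in> boundary_sphere ?n}"
        show "closedin ?ID ?A" by (rule closedin_continuous_map_preimage[OF p1]) simp
        show "closedin ?ID ?B" by (rule closedin_continuous_map_preimage[OF p2 closedin_boundary_sphere])
        show "topspace ?ID \<subseteq> ?A \<union> ?B"
        proof
          fix z assume "z \<in> topspace ?ID"
          then show "z \<in> ?A \<union> ?B" using retD(4)[of "fst z" "snd z" ?n] by auto
        qed
        have rp: "r (fst z, \<Phi> e (snd z)) = (if fst (ret ?n z) = 0 then ?p z else r (?p z))" if "z \<in> topspace ?ID" for z
          using that r\<Phi>[OF less.prems False, of "fst z" "snd z"] by (cases z) (auto simp: Let_def)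
        show "continuous_map (subtopology ?ID ?A) ?IY (\<lambda>z. r (fst z, \<Phi> e (snd z)))"
          by (rule continuous_map_eq[OF continuous_map_from_subtopology[OF pc]])
             (simp add: rp del: topspace_prod_topology)
        have "continuous_map (subtopology ?ID ?B) (cylinder (subtopology Y ?L)) ?p"
          unfolding subtopology_cylinder[symmetric] continuous_map_in_subtopology
        proof (intro conjI continuous_map_from_subtopology[OF pc])
          show "?p \<in> topspace (subtopology ?ID ?B) \<rightarrow> {0..1} \<times> ?L"
          proof
            fix z assume z: "z \<in> topspace (subtopology ?ID ?B)"
            then have "\<Phi> e (snd (ret ?n z)) \<in> cell_boundary e" by (auto simp: cell_boundary_def)
            then have "\<Phi> e (snd (ret ?n z)) \<in> ?L" using bdL by (rule rev_subsetD)
            moreover have "fst (ret ?n z) \<in> {0..1}" using z retD(2)[of "fst z" "snd z" ?n] by auto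
            ultimately show "?p z \<in> {0..1} \<times> ?L" by (rule SigmaI[rotated])
          qed
        qed
        from continuous_map_compose[OF this rL]
        show "continuous_map (subtopology ?ID ?B) ?IY (\<lambda>z. r (fst z, \<Phi> e (snd z)))"
        proof (rule continuous_map_eq)
          fix z assume "z \<in> topspace (subtopology ?ID ?B)"
          then have z: "z \<in> topspace ?ID" by simp
          then have "\<Phi> e (snd (ret ?n z)) \<in> topspace Y"
            using p2 by (intro \<Phi>Y[OF less.prems]) (auto simp: continuous_map_def)
          then show "(r \<circ> ?p) z = r (fst z, \<Phi> e (snd z))" using rp[OF z] r0 by auto
        qed
      qed
      from continuous_map_cylinder_cell[OF Hausdorff char_cont[OF less.prems] this]
      show ?thesis by (simp add: closed_cell_def)
    qed
  qed
  have "continuous_map ?IY ?IY r" by (rule continuous_map_cylinder_if_cells[OF rc])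
  then have "cylinder_retraction Y (\<Union>\<F>) r"
    unfolding cylinder_retraction_def by (intro conjI ballI r_or r0 rF)
  then show ?thesis by blast
qed

end

section \<open>Transport along a homotopy in the total space\<close>

text \<open>The target of the extension is the union of the bottom and the interval over
  \<open>x0\<close>, as a subspace of the cylinder. Its points have the type over which
  \<open>cofibred_subspace\<close> ranges, and the extension of the two inclusions is the
  retraction.\<close>

lemma nondegenerate_basepoint_closed_cofibration:
  assumes X: "Hausdorff_space X" and x0: "nondegenerate_basepoint X x0"
  shows "closed_cofibration X {x0}"
proof -
  have x0X: "x0 \<in> topspace X" using x0 by (simp add: nondegenerate_basepoint_def)
  let ?IX = "cylinder X"
  define Z where "Z = subtopology ?IX ({0} \<times> topspace X \<union> {0..1} \<times> {x0})"
  have "homotopy_extension_for Z X {x0}"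
    using x0 by (simp add: nondegenerate_basepoint_def cofibred_subspace_def)
  moreover have "continuous_map X Z (\<lambda>x. (0, x))"
    unfolding Z_def continuous_map_in_subtopology by (intro conjI continuous_map_pairedI) auto
  moreover have "continuous_map (cylinder (subtopology X {x0})) Z (\<lambda>z. z)"
    unfolding Z_def subtopology_cylinder[symmetric] continuous_map_in_subtopology
    by (intro conjI continuous_map_from_subtopology) auto
  ultimately have "\<exists>r. continuous_map ?IX Z r \<and> (\<forall>x\<in>topspace X. r (0, x) = (0, x)) \<and>
      (\<forall>t\<in>{0..1}. \<forall>a\<in>{x0}. r (t, a) = (t, a))"
    unfolding homotopy_extension_for_def by blast
  then obtain r where r: "continuous_map ?IX Z r" and r0: "\<forall>x\<in>topspace X. r (0, x) = (0, x)"
    and ra: "\<forall>t\<in>{0..1}. \<forall>a\<in>{x0}. r (t, a) = (t, a)"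
    by (elim exE conjE)
  have rI: "continuous_map ?IX ?IX r" and rZ: "r \<in> topspace ?IX \<rightarrow> {0} \<times> topspace X \<union> {0..1} \<times> {x0}"
    using r unfolding Z_def continuous_map_in_subtopology by simp_all
  have "fst (r (t, x)) = 0 \<or> snd (r (t, x)) \<in> {x0}" if "t \<in> {0..1}" "x \<in> topspace X" for t x
  proof -
    have "r (t, x) \<in> {0} \<times> topspace X \<union> {0..1} \<times> {x0}" using that by (intro funcset_mem[OF rZ]) simp
    then show ?thesis by auto
  qed
  then have "cylinder_retraction X {x0} r"
    unfolding cylinder_retraction_def using rI r0 ra by blast
  moreover have "closedin X {x0}"
    using X x0X by (simp add: closedin_Hausdorff_sing_eq)
  ultimately show ?thesis unfolding closed_cofibration_def by blast
qed

lemma finite_CW_complex_compact_space: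
  assumes "finite_CW_complex X"
  shows "compact_space X"
proof -
  obtain \<E> d where cw: "cw_structure X \<E> d" "finite \<E>" using assms by (auto simp: finite_CW_complex_def)
  obtain \<Phi> where "cell_complex X \<E> d \<Phi>" using cw_structure_cell_complex[OF cw(1)] .
  then interpret cell_complex X \<E> d \<Phi> .
  have "subcomplex \<E>"
    unfolding subcomplex_def using compactin_closed_cell compactin_subset_topspace Union_cells by blast
  from finite_subcomplex_compact(1)[OF this cw(2)] show ?thesis
    by (simp add: Union_cells compact_space_def)
qed

lemma cw_section_closed_cofibration:
  assumes X: "compact_space X" "closed_cofibration X {x0}" and Y: "cw_structure Y \<E> d"
    and f: "continuous_map X Y f"
  shows "closed_cofibration (prod_topology X Y) ((\<lambda>x. (x, f x)) ` topspace X \<union> {x0} \<times> topspace Y)"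
proof -
  obtain \<Phi> where "cell_complex Y \<E> d \<Phi>" using cw_structure_cell_complex[OF Y] .
  then interpret cell_complex Y \<E> d \<Phi> .
  have "compactin Y (f ` topspace X)" using X(1) f by (intro image_compactin) (auto simp: compact_space_def)
  then obtain \<F> where \<F>: "finite \<F>" "subcomplex \<F>" "f ` topspace X \<subseteq> \<Union>\<F>"
    by (rule finite_subcomplex_compactin)
  let ?K = "subtopology Y (\<Union>\<F>)"
  obtain r where r: "cylinder_retraction Y (\<Union>\<F>) r" using subcomplex_cylinder_retraction[OF \<F>(2)] by blast
  obtain \<iota> Q \<rho> where nr: "neighbourhood_retract ?K \<iota> Q \<rho>" using neighbourhood_retract_subcomplex[OF \<F>(1,2)] by blast
  have K: "compact_space ?K" using finite_subcomplex_compact(1)[OF \<F>(2,1)] by (rule compact_space_subtopology)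
  have fK: "continuous_map X ?K f" using f \<F>(3) by (auto simp: continuous_map_in_subtopology)
  obtain s where s: "cylinder_retraction (prod_topology X ?K) ((\<lambda>x. (x, f x)) ` topspace X) s"
    "\<And>t x z. fst (snd (s (t, x, z))) = x"
    using neighbourhood_retract_section[OF nr K fK] by blast
  obtain s' where s': "cylinder_retraction (prod_topology X Y) ((\<lambda>x. (x, f x)) ` topspace X) s'"
    "\<And>t x y. t \<in> {0..1} \<Longrightarrow> x \<in> topspace X \<Longrightarrow> y \<in> topspace Y \<Longrightarrow> fst (snd (s' (t, x, y))) = x"
    using cylinder_retraction_section_compose[OF r finite_subcomplex_compact(2)[OF \<F>(2,1)] \<F>(3) s] by blast
  show ?thesis by (rule closed_cofibration_section_Un[OF X(2) Hausdorff f s'])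
qed

section \<open>Transport of the fibre along paths in the base\<close>

locale fibre_of_fibration =
  fixes E :: "'e topology" and B :: "'b topology" and p :: "'e \<Rightarrow> 'b" and b0 :: 'b and Y :: "'e topology"
  assumes fibration: "hurewicz_fibration E B p"
    and fibre: "Y = subtopology E {e \<in> topspace E. p e = b0}"
begin

lemma topspace_fibre: "topspace Y = {e \<in> topspace E. p e = b0}"
  by (auto simp: fibre)

lemma continuous_map_into_fibre:
  "continuous_map W Y h \<longleftrightarrow> continuous_map W E h \<and> (\<forall>w\<in>topspace W. p (h w) = b0)"
  by (auto simp: fibre continuous_map_in_subtopology Pi_iff dest: continuous_map_funspace)

text \<open>Only the paths \<open>t \<mapsto> p (G (t, x))\<close> enter, lifted from every point of
  the fibre. \<open>G\<close> itself is one of their lifts, the one from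
  \<open>G (0, x)\<close>.\<close>

definition transports :: "'x topology \<Rightarrow> (real \<times> 'x \<Rightarrow> 'e) \<Rightarrow> (real \<times> 'x \<times> 'e \<Rightarrow> 'e) \<Rightarrow> bool" where
  "transports X G L \<longleftrightarrow> continuous_map (cylinder (prod_topology X Y)) E L \<and>
     (\<forall>x\<in>topspace X. \<forall>y\<in>topspace Y. L (0, (x, y)) = y \<and> (\<forall>t\<in>{0..1}. p (L (t, (x, y))) = p (G (t, x))))"

lemma transportsD:
  assumes "transports X G L"
  shows "continuous_map (cylinder (prod_topology X Y)) E L"
    and "\<And>x y. x \<in> topspace X \<Longrightarrow> y \<in> topspace Y \<Longrightarrow> L (0, (x, y)) = y"
    and "\<And>t x y. t \<in> {0..1} \<Longrightarrow> x \<in> topspace X \<Longrightarrow> y \<in> topspace Y \<Longrightarrow> p (L (t, (x, y))) = p (G (t, x))"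
  using assms by (auto simp: transports_def)

lemma transport:
  assumes cof: "closed_cofibration (prod_topology X Y) A"
    and G: "continuous_map (cylinder X) E G"
    and G0: "\<And>x. x \<in> topspace X \<Longrightarrow> p (G (0, x)) = b0"
    and l: "continuous_map (cylinder (subtopology (prod_topology X Y) A)) E l"
    and l0: "\<And>a. a \<in> A \<Longrightarrow> l (0, a) = snd a"
    and pl: "\<And>t a. t \<in> {0..1} \<Longrightarrow> a \<in> A \<Longrightarrow> p (l (t, a)) = p (G (t, fst a))"
  obtains L where "transports X G L"
    "\<And>t a. t \<in> {0..1} \<Longrightarrow> a \<in> A \<Longrightarrow> L (t, a) = l (t, a)"
proof -
  let ?W = "prod_topology X Y"
  have cp: "continuous_map E B p" using fibration by (simp add: hurewicz_fibration_def)
  have "continuous_map (cylinder ?W) E (\<lambda>z. G (fst z, fst (snd z)))"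
    by (intro continuous_map_compose2[OF G] continuous_map_fst continuous_map_fst_snd)
  from continuous_map_compose[OF this cp]
  have h: "continuous_map (cylinder ?W) B (\<lambda>z. p (G (fst z, fst (snd z))))" by (simp add: o_def)
  have k: "continuous_map ?W E snd"
    using continuous_map_snd[of X Y] by (simp add: continuous_map_into_fibre)
  obtain L where L: "continuous_map (cylinder ?W) E L"
    "\<And>w. w \<in> topspace ?W \<Longrightarrow> L (0, w) = snd w"
    "\<And>t a. t \<in> {0..1} \<Longrightarrow> a \<in> A \<Longrightarrow> L (t, a) = l (t, a)"
    "\<And>t w. t \<in> {0..1} \<Longrightarrow> w \<in> topspace ?W \<Longrightarrow> p (L (t, w)) = p (G (fst (t, w), fst (snd (t, w))))"
  proof (rule hurewicz_fibration_relative_lifting[OF fibration cof h k l])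
    show "p (snd w) = p (G (fst (0, w), fst (snd (0, w))))" if "w \<in> topspace ?W" for w
      using that G0[of "fst w"] by (auto simp: topspace_fibre)
  qed (use l0 pl in auto)
  show thesis by (rule that[OF _ L(3)]) (use L(1,2,4) in \<open>auto simp: transports_def\<close>)
qed

text \<open>\<open>M\<close>, restarted where \<open>L\<close> ends, lifts the reversed path, so
  cancellation moves its end back to \<open>y\<close> within the fibre. On \<open>A\<close> this
  homotopy is constant, because there \<open>M\<close> retraces \<open>L\<close>.\<close>

lemma transport_inverse:
  assumes cof: "closed_cofibration (prod_topology X Y) A"
    and L: "transports X G L" and M: "transports X (\<lambda>z. G (1 - fst z, snd z)) M"
    and G1: "\<And>x. x \<in> topspace X \<Longrightarrow> p (G (1, x)) = b0"
    and A: "\<And>t x y. t \<in> {0..1} \<Longrightarrow> (x, y) \<in> A \<Longrightarrow> M (t, (x, L (1, (x, y)))) = L (1 - t, (x, y))"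
  obtains H where "continuous_map (cylinder (prod_topology X Y)) Y H"
    "\<And>x y. x \<in> topspace X \<Longrightarrow> y \<in> topspace Y \<Longrightarrow> H (0, (x, y)) = M (1, (x, L (1, (x, y))))"
    "\<And>x y. x \<in> topspace X \<Longrightarrow> y \<in> topspace Y \<Longrightarrow> H (1, (x, y)) = y"
    "\<And>t x y. t \<in> {0..1} \<Longrightarrow> (x, y) \<in> A \<Longrightarrow> H (t, (x, y)) = y"
proof -
  note LD = transportsD[OF L] and MD = transportsD[OF M]
  let ?W = "prod_topology X Y"
  let ?IW = "cylinder ?W"
  have AW: "A \<subseteq> topspace ?W" using cof unfolding closed_cofibration_def by (intro closedin_subset) blast
  define F where "F = (\<lambda>w. L (1, w))"
  have F: "continuous_map ?W Y F"
    unfolding continuous_map_into_fibre F_def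
    using LD(3)[of 1] G1 by (intro conjI continuous_map_compose2[OF LD(1)]) auto
  then have FY: "F w \<in> topspace Y" if "w \<in> topspace ?W" for w using that by (auto simp: continuous_map_def)
  define N where "N = (\<lambda>z. M (fst z, (fst (snd z), F (snd z))))"
  have N: "continuous_map ?IW E N"
    unfolding N_def
    by (intro continuous_map_compose2[OF MD(1)] continuous_map_pairedI continuous_map_fst
        continuous_map_fst_snd
        continuous_map_compose[OF continuous_map_snd F, unfolded o_def])
  obtain H where H: "continuous_map ?IW E H"
    "\<And>w. w \<in> topspace ?W \<Longrightarrow> H (0, w) = N (1, w)"
    "\<And>w. w \<in> topspace ?W \<Longrightarrow> H (1, w) = L (0, w)"
    "\<And>s a. s \<in> {0..1} \<Longrightarrow> a \<in> A \<Longrightarrow> H (s, a) = L (0, a)"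
    "\<And>s w. s \<in> {0..1} \<Longrightarrow> w \<in> topspace ?W \<Longrightarrow> p (H (s, w)) = p (L (0, w))"
  proof (rule hurewicz_fibration_cancel[OF fibration cof LD(1) N])
    fix w assume w: "w \<in> topspace ?W"
    then have xy: "fst w \<in> topspace X" "snd w \<in> topspace Y" by auto
    show "N (0, w) = L (1, w)" using MD(2)[OF xy(1) FY[OF w]] by (simp add: N_def F_def)
    show "p (N (t, w)) = p (L (1 - t, w))" if "t \<in> {0..1}" for t
      using MD(3)[OF that xy(1) FY[OF w]] LD(3)[of "1 - t", OF _ xy] that by (simp add: N_def)
  next
    show "N (t, a) = L (1 - t, a)" if "t \<in> {0..1}" "a \<in> A" for t a
      using A[of t "fst a" "snd a"] that by (simp add: N_def F_def)
  qed blast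
  show thesis
  proof
    show "continuous_map ?IW Y H"
      unfolding continuous_map_into_fibre using H(1,5) LD(2) by (auto simp: topspace_fibre)
    show "H (0, (x, y)) = M (1, (x, L (1, (x, y))))" "H (1, (x, y)) = y"
      if "x \<in> topspace X" "y \<in> topspace Y" for x y
      using that H(2,3)[of "(x, y)"] LD(2) by (simp_all add: N_def F_def)
    show "H (t, (x, y)) = y" if "t \<in> {0..1}" "(x, y) \<in> A" for t x y
      using that H(4)[of t "(x, y)"] LD(2)[of x y] AW by auto
  qed
qed

lemma continuous_map_transport_end:
  assumes L: "transports X G L" and G1: "\<And>x. x \<in> topspace X \<Longrightarrow> p (G (1, x)) = b0"
  shows "continuous_map (prod_topology X Y) Y (\<lambda>w. L (1, w))"
  unfolding continuous_map_into_fibre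
  using transportsD(3)[OF L, of 1] G1
  by (intro conjI continuous_map_compose2[OF transportsD(1)[OF L]]) auto

text \<open>\<open>L (1, (x, f x))\<close> and \<open>g x\<close> are the ends of two lifts of one
  path with the same start \<open>f x\<close>. Following \<open>G\<close> backwards from
  \<open>g x\<close> and then \<open>L\<close> is a case for cancellation, which joins the two ends
  within the fibre.\<close>

lemma path_component_transport:
  assumes X: "Hausdorff_space X" and f: "continuous_map X Y f"
    and G: "continuous_map (cylinder X) E G"
    and G0: "\<And>x. x \<in> topspace X \<Longrightarrow> G (0, x) = f x" and G1: "\<And>x. x \<in> topspace X \<Longrightarrow> G (1, x) = g x"
    and g: "\<And>x. x \<in> topspace X \<Longrightarrow> g x \<in> topspace Y"
    and L: "transports X G L"
  shows "path_component_of (mapping_space X Y) (postcompose X (\<lambda>w. L (1, w)) (mapping_point X f)) (mapping_point X g)"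
proof -
  note LD = transportsD[OF L]
  let ?IX = "cylinder X"
  have fY: "f x \<in> topspace Y" if "x \<in> topspace X" for x using f that by (auto simp: continuous_map_def)
  have "continuous_map ?IX euclideanreal (\<lambda>z. 1 - fst z)"
    by (intro continuous_map_real_intros continuous_map_cylinder_fst)
  then have rev: "continuous_map ?IX unit_interval (\<lambda>z. 1 - fst z)"
    by (auto simp: continuous_map_unit_interval_iff)
  have Grev: "continuous_map ?IX E (\<lambda>z. G (1 - fst z, snd z))"
    by (intro continuous_map_compose2[OF G] rev continuous_map_snd)
  have N: "continuous_map ?IX E (\<lambda>z. L (fst z, (snd z, f (snd z))))"
    using continuous_map_compose[OF continuous_map_snd f]
    by (intro continuous_map_compose2[OF LD(1)] continuous_map_pairedI continuous_map_fst continuous_map_snd) (simp add: o_def)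
  obtain H where H: "continuous_map ?IX E H"
    "\<And>x. x \<in> topspace X \<Longrightarrow> H (0, x) = L (fst (1, x), (snd (1, x), f (snd (1, x))))"
    "\<And>x. x \<in> topspace X \<Longrightarrow> H (1, x) = G (1 - fst (0, x), snd (0, x))"
    "\<And>s x. s \<in> {0..1} \<Longrightarrow> x \<in> topspace X \<Longrightarrow> p (H (s, x)) = p (G (1 - fst (0, x), snd (0, x)))"
    by (rule hurewicz_fibration_cancel[OF fibration closed_cofibration_empty Grev N]) (use LD(2,3) G0 fY in auto)
  have HY: "continuous_map ?IX Y H"
    unfolding continuous_map_into_fibre using H(1,4) G1 g by (auto simp: topspace_fibre)
  have "continuous_map (cylinder (prod_topology X Y)) Y (\<lambda>z. H (fst z, fst (snd z)))"
    by (intro continuous_map_compose2[OF HY] continuous_map_fst continuous_map_fst_snd)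
  from path_component_of_postcompose[OF X this mapping_point_in_mapping_space[OF f], of 0 1]
  have "path_component_of (mapping_space X Y) (postcompose X (\<lambda>w. H (0, fst w)) (mapping_point X f))
      (postcompose X (\<lambda>w. H (1, fst w)) (mapping_point X f))" by simp
  moreover have "postcompose X (\<lambda>w. H (0, fst w)) (mapping_point X f) = postcompose X (\<lambda>w. L (1, w)) (mapping_point X f)"
    using H(2) by (auto simp: postcompose_def mapping_point_def)
  moreover have "postcompose X (\<lambda>w. H (1, fst w)) (mapping_point X f) = mapping_point X g"
    using H(3) G1 by (auto simp: postcompose_def mapping_point_def)
  ultimately show ?thesis by simp
qed

text \<open>The constant lift over \<open>x0\<close> is admissible because \<open>G\<close> keeps
  \<open>x0\<close> at \<open>y0\<close>, so the path below is constant at \<open>b0\<close>. For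
  the same reason it agrees with \<open>G\<close> at \<open>(x0, y0)\<close>, where the graph meets
  \<open>{x0} \<times> Y\<close>.\<close>

lemma based_transport:
  assumes Y: "Hausdorff_space Y" and X: "Hausdorff_space X" "x0 \<in> topspace X" and f: "continuous_map X Y f" "f x0 = y0"
    and cof: "closed_cofibration (prod_topology X Y) ((\<lambda>x. (x, f x)) ` topspace X \<union> {x0} \<times> topspace Y)"
    and G: "continuous_map (cylinder X) E G"
    and G0: "\<And>x. x \<in> topspace X \<Longrightarrow> G (0, x) = f x"
    and Gx0: "\<And>t. t \<in> {0..1} \<Longrightarrow> G (t, x0) = y0"
  obtains L where "transports X G L"
    "\<And>t x. t \<in> {0..1} \<Longrightarrow> x \<in> topspace X \<Longrightarrow> L (t, (x, f x)) = G (t, x)"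
    "\<And>t y. t \<in> {0..1} \<Longrightarrow> y \<in> topspace Y \<Longrightarrow> L (t, (x0, y)) = y"
proof -
  let ?W = "prod_topology X Y"
  define A where "A = (\<lambda>x. (x, f x)) ` topspace X \<union> {x0} \<times> topspace Y"
  let ?IW = "cylinder ?W"
  let ?IA = "cylinder (subtopology ?W A)"
  have fY: "f x \<in> topspace Y" if "x \<in> topspace X" for x using f that by (auto simp: continuous_map_def)
  then have y0: "y0 \<in> topspace Y" using X f by auto
  define l where "l = (\<lambda>z::real \<times> 'a \<times> 'e. if fst (snd z) = x0 then snd (snd z) else G (fst z, fst (snd z)))"
  have c1: "continuous_map ?IW X (\<lambda>z. fst (snd z))"
    by (rule continuous_map_fst_snd)
  have c2: "continuous_map ?IW Y (\<lambda>z. snd (snd z))"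
    by (rule continuous_map_snd_snd)
  have lc: "continuous_map ?IA E l"
    unfolding subtopology_cylinder[symmetric]
  proof (rule continuous_map_closed_Un)
    let ?V = "subtopology ?IW ({0..1} \<times> A)"
    let ?S = "{z \<in> topspace ?V. fst (snd z) \<in> {x0}}" and ?T = "{z \<in> topspace ?V. f (fst (snd z)) = snd (snd z)}"
    show "closedin ?V ?S"
      using X by (intro closedin_continuous_map_preimage[OF continuous_map_from_subtopology[OF c1]])
        (simp add: closedin_Hausdorff_sing_eq)
    show "closedin ?V ?T"
      using continuous_map_compose[OF c1 f(1)]
      by (intro closedin_continuous_maps_eq[OF Y] continuous_map_from_subtopology c2) (simp add: o_def)
    show "topspace ?V \<subseteq> ?S \<union> ?T" by (auto simp: A_def)
    have "continuous_map ?IW E (\<lambda>z. snd (snd z))" using c2 by (simp add: continuous_map_into_fibre)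
    then have "continuous_map ?V E (\<lambda>z. snd (snd z))" by (rule continuous_map_from_subtopology)
    then show "continuous_map (subtopology ?V ?S) E l"
      by (rule continuous_map_eq[OF continuous_map_from_subtopology]) (auto simp: l_def)
    have "continuous_map ?IW E (\<lambda>z. G (fst z, fst (snd z)))"
      by (intro continuous_map_compose2[OF G] continuous_map_fst c1)
    then have "continuous_map ?V E (\<lambda>z. G (fst z, fst (snd z)))" by (rule continuous_map_from_subtopology)
    then show "continuous_map (subtopology ?V ?T) E l"
      by (rule continuous_map_eq[OF continuous_map_from_subtopology]) (auto simp: l_def Gx0 f(2))
  qed
  have lG: "l (t, (x, f x)) = G (t, x)" if "t \<in> {0..1}" for t x
    using that Gx0 f(2) by (simp add: l_def)
  have G0': "p (G (0, x)) = b0" if "x \<in> topspace X" for x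
    using G0[OF that] fY[OF that] by (simp add: topspace_fibre)
  show thesis
  proof (rule transport[OF cof[folded A_def] G G0' lc])
    show "l (0, a) = snd a" if "a \<in> A" for a using that G0 by (auto simp: l_def A_def)
    show "p (l (t, a)) = p (G (t, fst a))" if "t \<in> {0..1}" "a \<in> A" for t a
      using that Gx0 y0 f(2) by (auto simp: l_def A_def topspace_fibre)
    fix L assume L: "transports X G L"
      "\<And>t a. t \<in> {0..1} \<Longrightarrow> a \<in> A \<Longrightarrow> L (t, a) = l (t, a)"
    show thesis
    proof (rule that[OF L(1)])
      show "L (t, (x, f x)) = G (t, x)" if "t \<in> {0..1}" "x \<in> topspace X" for t x
        using that L(2)[of t "(x, f x)"] lG by (simp add: A_def)
      show "L (t, (x0, y)) = y" if "t \<in> {0..1}" "y \<in> topspace Y" for t y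
        using that L(2)[of t "(x0, y)"] by (simp add: A_def l_def)
    qed
  qed
qed

text \<open>Stated once for four uses: from \<open>f\<close> to \<open>g\<close> and back, free with
  \<open>A\<close> empty, and based with \<open>A\<close> the union of the graph and
  \<open>{x0} \<times> Y\<close>. \<open>Q\<close> stands for any condition satisfied by composition
  with a map that sends \<open>(x, y)\<close> to \<open>y\<close> on \<open>A\<close>.\<close>

lemma transport_mapping_component:
  assumes X: "Hausdorff_space X" and f: "continuous_map X Y f"
    and G: "continuous_map (cylinder X) E G"
    and G0: "\<And>x. x \<in> topspace X \<Longrightarrow> G (0, x) = f x" and G1: "\<And>x. x \<in> topspace X \<Longrightarrow> G (1, x) = g x"
    and g: "\<And>x. x \<in> topspace X \<Longrightarrow> g x \<in> topspace Y"
    and L: "transports X G L"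
    and M: "transports X (\<lambda>z. G (1 - fst z, snd z)) M"
    and cof: "closed_cofibration (prod_topology X Y) A"
    and A: "\<And>t x y. t \<in> {0..1} \<Longrightarrow> (x, y) \<in> A \<Longrightarrow> M (t, (x, L (1, (x, y)))) = L (1 - t, (x, y))"
    and Q: "\<And>H. (\<And>x y. (x, y) \<in> A \<Longrightarrow> H (x, y) = y) \<Longrightarrow> Q (postcompose X H)"
    and Q_cong: "\<And>h k. (\<And>x. x \<in> topspace (mapping_component X Y f) \<Longrightarrow> h x = k x) \<Longrightarrow> Q h \<longleftrightarrow> Q k"
  shows "continuous_map (mapping_component X Y f) (mapping_component X Y g) (postcompose X (\<lambda>w. L (1, w))) \<and>
    homotopic_with Q (mapping_component X Y f) (mapping_component X Y f)
           (postcompose X (\<lambda>w. M (1, w)) \<circ> postcompose X (\<lambda>w. L (1, w))) id"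
proof -
  have pG1: "p (G (1, x)) = b0" if "x \<in> topspace X" for x
    using G1[OF that] g[OF that] by (simp add: topspace_fibre)
  have "continuous_map (prod_topology X Y) Y (\<lambda>w. L (1, w))"
    by (rule continuous_map_transport_end[OF L pG1])
  then have 1: "continuous_map (mapping_component X Y f) (mapping_component X Y g) (postcompose X (\<lambda>w. L (1, w)))"
    by (rule mapping_component_postcompose[OF X _ path_component_transport[OF X f G G0 G1 g L]])
  obtain H where H: "continuous_map (cylinder (prod_topology X Y)) Y H"
    "\<And>x y. x \<in> topspace X \<Longrightarrow> y \<in> topspace Y \<Longrightarrow> H (0, (x, y)) = M (1, (x, L (1, (x, y))))"
    "\<And>x y. x \<in> topspace X \<Longrightarrow> y \<in> topspace Y \<Longrightarrow> H (1, (x, y)) = y"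
    "\<And>t x y. t \<in> {0..1} \<Longrightarrow> (x, y) \<in> A \<Longrightarrow> H (t, (x, y)) = y"
    using transport_inverse[OF cof L M pG1 A] by blast
  have "homotopic_with Q (mapping_component X Y f) (mapping_component X Y f)
           (postcompose X (\<lambda>w. M (1, w)) \<circ> postcompose X (\<lambda>w. L (1, w))) id"
  proof (rule mapping_component_homotopic_id[OF X H(1)])
    show "Q (postcompose X (\<lambda>w. H (t, w)))" if "t \<in> {0..1}" for t
      by (rule Q) (use that H(4) in simp)
    show "Q h \<longleftrightarrow> Q k" if "\<And>x. x \<in> topspace (mapping_component X Y f) \<Longrightarrow> h x = k x" for h k
      using that by (rule Q_cong)
  qed (use H(2,3) in auto)
  with 1 show ?thesis ..
qed

end

theorem theorem3p2:
  fixes X :: "'a topology" and Y E :: "'e topology" and B :: "'b topology"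
    and p :: "'e \<Rightarrow> 'b" and j :: "'e \<Rightarrow> 'e" and f g :: "'a \<Rightarrow> 'e"
    and x0 :: 'a and y0 :: 'e and b0 :: 'b
  assumes X: "countable_CW_complex X" "connected_space X" "nondegenerate_basepoint X x0"
    and Y: "countable_CW_complex Y" "connected_space Y" "nondegenerate_basepoint Y y0"
    and fibration: "hurewicz_fibration E B p" "b0 \<in> topspace B"
    and fibre: "Y = subtopology E {e \<in> topspace E. p e = b0}" "j = id"
    and f: "continuous_map X Y f" "f x0 = y0"
    and g: "continuous_map X Y g" "g x0 = y0"
    and homotopic: "based_homotopic X x0 E (j y0) (j \<circ> f) (j \<circ> g)"
  shows "mapping_component X Y f homotopy_equivalent_space mapping_component X Y g \<and>
    (finite_CW_complex X \<longrightarrow>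
       fibre_homotopy_equivalent
         (mapping_component X Y f) (mapping_point X f) (evaluation x0)
         (mapping_component X Y g) (mapping_point X g) (evaluation x0))"
proof -
  obtain \<E>X dX where cwX: "cw_structure X \<E>X dX" using X(1) by (auto simp: countable_CW_complex_def)
  obtain \<E> d where cwY: "cw_structure Y \<E> d" using Y(1) by (auto simp: countable_CW_complex_def)
  have HX: "Hausdorff_space X" and HY: "Hausdorff_space Y"
    using cwX cwY by (simp_all add: cw_structure_def)
  have x0: "x0 \<in> topspace X" using X(3) by (simp add: nondegenerate_basepoint_def)
  interpret T: fibre_of_fibration E B p b0 Y
    by unfold_locales (use fibration(1) fibre(1) in auto)
  have fY: "f x \<in> topspace Y" and gY: "g x \<in> topspace Y" if "x \<in> topspace X" for x
    using f(1) g(1) that by (auto simp: continuous_map_def)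
  obtain G where G: "continuous_map (cylinder X) E G"
    and G0: "\<And>x. G (0, x) = f x" and G1: "\<And>x. G (1, x) = g x" and Gx0: "\<And>t. t \<in> {0..1} \<Longrightarrow> G (t, x0) = y0"
    using homotopic by (auto simp: based_homotopic_def homotopic_with_def fibre(2))
  \<comment> \<open>Reversing twice gives back \<open>G\<close>, as \<open>rev\<close> records; so
    the opposite direction is the same lemma with \<open>f\<close> and \<open>g\<close>, and
    \<open>L\<close> and \<open>M\<close>, exchanged.\<close>
  define G' where "G' = (\<lambda>z. G (1 - fst z, snd z))"
  have "continuous_map (cylinder X) euclideanreal (\<lambda>z. 1 - fst z)"
    by (intro continuous_map_real_intros continuous_map_cylinder_fst)
  then have "continuous_map (cylinder X) unit_interval (\<lambda>z. 1 - fst z)"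
    by (auto simp: continuous_map_unit_interval_iff)
  then have G': "continuous_map (cylinder X) E G'"
    unfolding G'_def by (intro continuous_map_compose2[OF G] continuous_map_snd)
  have G'0: "\<And>x. G' (0, x) = g x" and G'1: "\<And>x. G' (1, x) = f x" and G'x0: "\<And>t. t \<in> {0..1} \<Longrightarrow> G' (t, x0) = y0"
    and rev: "(\<lambda>z. G' (1 - fst z, snd z)) = G"
    using G0 G1 Gx0 by (simp_all add: G'_def)
  let ?Mf = "mapping_component X Y f" and ?Mg = "mapping_component X Y g"
  show ?thesis
  proof (intro conjI impI)
    \<comment> \<open>Nothing is prescribed in the free case: the lifts are relative to the empty
      cofibration.\<close>
    have empty: "continuous_map (cylinder (subtopology (prod_topology X Y) {})) E (\<lambda>_. undefined)"
      by simp
    obtain L where L: "T.transports X G L"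
      by (rule T.transport[OF closed_cofibration_empty G _ empty]) (use G0 fY T.topspace_fibre in auto)
    obtain M where M: "T.transports X G' M"
      by (rule T.transport[OF closed_cofibration_empty G' _ empty]) (use G'0 gY T.topspace_fibre in auto)
    have fwd: "continuous_map ?Mf ?Mg (postcompose X (\<lambda>w. L (1, w))) \<and>
        homotopic_with (\<lambda>_. True) ?Mf ?Mf (postcompose X (\<lambda>w. M (1, w)) \<circ> postcompose X (\<lambda>w. L (1, w))) id"
      by (rule T.transport_mapping_component[OF HX f(1) G G0 G1 gY L M[unfolded G'_def] closed_cofibration_empty]) auto
    have bwd: "continuous_map ?Mg ?Mf (postcompose X (\<lambda>w. M (1, w))) \<and>
        homotopic_with (\<lambda>_. True) ?Mg ?Mg (postcompose X (\<lambda>w. L (1, w)) \<circ> postcompose X (\<lambda>w. M (1, w))) id"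
      by (rule T.transport_mapping_component[OF HX g(1) G' G'0 G'1 fY M L[folded rev] closed_cofibration_empty]) auto
    show "?Mf homotopy_equivalent_space ?Mg"
      unfolding homotopy_equivalent_space_def using fwd bwd by auto
  next
    assume "finite_CW_complex X"
    then have compact: "compact_space X" by (rule finite_CW_complex_compact_space)
    have cofX: "closed_cofibration X {x0}"
      by (rule nondegenerate_basepoint_closed_cofibration[OF HX X(3)])
    let ?A = "\<lambda>f. (\<lambda>x. (x, f x)) ` topspace X \<union> {x0} \<times> topspace Y"
    note cof = cw_section_closed_cofibration[OF compact cofX cwY]
    obtain L where L: "T.transports X G L"
      and Lf: "\<And>t x. t \<in> {0..1} \<Longrightarrow> x \<in> topspace X \<Longrightarrow> L (t, (x, f x)) = G (t, x)"
      and Lx0: "\<And>t y. t \<in> {0..1} \<Longrightarrow> y \<in> topspace Y \<Longrightarrow> L (t, (x0, y)) = y"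
      using T.based_transport[OF HY HX x0 f cof[OF f(1)] G G0 Gx0] by blast
    obtain M where M: "T.transports X G' M"
      and Mg: "\<And>t x. t \<in> {0..1} \<Longrightarrow> x \<in> topspace X \<Longrightarrow> M (t, (x, g x)) = G' (t, x)"
      and Mx0: "\<And>t y. t \<in> {0..1} \<Longrightarrow> y \<in> topspace Y \<Longrightarrow> M (t, (x0, y)) = y"
      using T.based_transport[OF HY HX x0 g cof[OF g(1)] G' G'0 G'x0] by blast
    let ?\<Phi> = "postcompose X (\<lambda>w. L (1, w))" and ?\<Psi> = "postcompose X (\<lambda>w. M (1, w))"
    \<comment> \<open>The two conditions correspond to the two parts of \<open>?A k\<close>: the
      graph of \<open>k\<close> yields the base point, \<open>{x0} \<times> Y\<close> the
      compatibility with evaluation.\<close>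
    define Q where "Q = (\<lambda>k u. u (mapping_point X k) = mapping_point X k \<and>
      (\<forall>h\<in>topspace (mapping_component X Y k). evaluation x0 (u h) = evaluation x0 h))"
    have at_x0: "h x0 \<in> topspace Y" if "h \<in> topspace (mapping_component X Y k)" for h k
      using that x0 by (auto simp: mapping_component_def topspace_mapping_space continuous_map_def)
    have Q: "Q k (postcompose X H)" if "\<And>x y. (x, y) \<in> ?A k \<Longrightarrow> H (x, y) = y" for k H
    proof -
      have "postcompose X H (mapping_point X k) = mapping_point X k"
        using that by (auto simp: postcompose_def mapping_point_def)
      moreover have "evaluation x0 (postcompose X H h) = evaluation x0 h" if "h \<in> topspace (mapping_component X Y k)" for h
        using \<open>\<And>x y. (x, y) \<in> ?A k \<Longrightarrow> H (x, y) = y\<close>[of x0 "h x0"] at_x0[OF that] x0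
        by (simp add: evaluation_def postcompose_def)
      ultimately show ?thesis by (simp add: Q_def)
    qed
    have Q_cong: "Q k u \<longleftrightarrow> Q k v" if "continuous_map X Y k" "\<And>h. h \<in> topspace (mapping_component X Y k) \<Longrightarrow> u h = v h" for k u v
      using that(2) that(2)[OF mapping_point_in_mapping_component[OF that(1)]] by (simp add: Q_def)
    \<comment> \<open>Over \<open>x0\<close> both lifts are constant. On the graph \<open>L\<close>
      follows \<open>G\<close> to \<open>g x\<close>, and from there \<open>M\<close> follows
      \<open>G\<close> back.\<close>
    have AL: "M (t, (x, L (1, (x, y)))) = L (1 - t, (x, y))" if t: "t \<in> {0..1}" and xy: "(x, y) \<in> ?A f" for t x y
    proof (cases "x = x0")
      case True
      then have "y \<in> topspace Y" using xy fY by auto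
      then show ?thesis using True Lx0 Mx0 t by simp
    next
      case False
      then show ?thesis using xy Lf Mg t G1 by (auto simp: G'_def)
    qed
    have AM: "L (t, (x, M (1, (x, y)))) = M (1 - t, (x, y))" if t: "t \<in> {0..1}" and xy: "(x, y) \<in> ?A g" for t x y
    proof (cases "x = x0")
      case True
      then have "y \<in> topspace Y" using xy gY by auto
      then show ?thesis using True Lx0 Mx0 t by simp
    next
      case False
      then show ?thesis using xy Lf Mg t G'1 by (auto simp: G'_def)
    qed
    have fwd: "continuous_map ?Mf ?Mg ?\<Phi> \<and> homotopic_with (Q f) ?Mf ?Mf (?\<Psi> \<circ> ?\<Phi>) id"
    proof (rule T.transport_mapping_component[OF HX f(1) G G0 G1 gY L M[unfolded G'_def] cof[OF f(1)] AL])
      show "Q f (postcompose X H)" if "\<And>x y. (x, y) \<in> ?A f \<Longrightarrow> H (x, y) = y" for H using that by (rule Q)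
      show "Q f u \<longleftrightarrow> Q f v" if "\<And>h. h \<in> topspace ?Mf \<Longrightarrow> u h = v h" for u v
        using that by (rule Q_cong[OF f(1)])
    qed
    have bwd: "continuous_map ?Mg ?Mf ?\<Psi> \<and> homotopic_with (Q g) ?Mg ?Mg (?\<Phi> \<circ> ?\<Psi>) id"
    proof (rule T.transport_mapping_component[OF HX g(1) G' G'0 G'1 fY M L[folded rev] cof[OF g(1)] AM])
      show "Q g (postcompose X H)" if "\<And>x y. (x, y) \<in> ?A g \<Longrightarrow> H (x, y) = y" for H using that by (rule Q)
      show "Q g u \<longleftrightarrow> Q g v" if "\<And>h. h \<in> topspace ?Mg \<Longrightarrow> u h = v h" for u v
        using that by (rule Q_cong[OF g(1)])
    qed
    have "?\<Phi> (mapping_point X f) = mapping_point X g" "?\<Psi> (mapping_point X g) = mapping_point X f"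
      using Lf[of 1] Mg[of 1] G1 G'1 by (auto simp: postcompose_def mapping_point_def)
    moreover have "evaluation x0 (?\<Phi> h) = evaluation x0 h" if "h \<in> topspace ?Mf" for h
      using Lx0[of 1] at_x0[OF that] x0 by (simp add: evaluation_def postcompose_def)
    moreover have "evaluation x0 (?\<Psi> h) = evaluation x0 h" if "h \<in> topspace ?Mg" for h
      using Mx0[of 1] at_x0[OF that] x0 by (simp add: evaluation_def postcompose_def)
    ultimately show "fibre_homotopy_equivalent ?Mf (mapping_point X f) (evaluation x0) ?Mg (mapping_point X g) (evaluation x0)"
      unfolding fibre_homotopy_equivalent_def
      using fwd bwd by (intro exI[of _ ?\<Phi>] exI[of _ ?\<Psi>] conjI ballI) (simp_all add: Q_def)
  qed
qed

end
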